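(* Let $s\ge 2$, let $n_1<\dots<n_s$ be integers, let $i_1,\dots,i_s$ be positive integers with $r=i_1+\dots+i_s$, and let $E_N=\bigoplus_{k=1}^{s}\mathcal{O}(n_k)^{i_k}$ over $\mathbb{CP}^1$. Put $d_l=n_{l+1}-n_l$ and let $z_0=0,z_1,\dots,z_{d_1+\dots+d_{s-1}}$ be arbitrary distinct points of $\mathbb{CP}^1$. Let $$\mathcal{C}_N=\mathcal{F}^{0}_{\lambda_0,[\Pi_0]}\times\left(\prod_{i=1}^{d_1}\mathcal{F}^{i}_{\lambda_1,[\Pi_1]}\right)\times\dots\times\left(\prod_{i=1}^{d_{s-1}}\mathcal{F}^{d_1+\dots+d_{s-2}+i}_{\lambda_{s-1},[\Pi_{s-1}]}\right),$$ where $\mathcal{F}^{i}_{\lambda_l,[\Pi_l]}$ is the Bruhat cell of type $[\Pi_l]$ in the manifold of generalized flags of type $\lambda_l$ in the fiber of $E_N$ over $z_i$. Then the left action on $\mathcal{C}_N$ of the subgroup $(G_1\cdots G_{s-1})\rtimes \mathrm{N}_N\subset \mathrm{Aut}(E_N)$, induced by restricting automorphisms to the fibers over the points $z_i$, is free and transitive (in particular, the action is proper).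
   Context: Bundle conventions. $N=\mathrm{diag}(n_1 I_{i_1},\dots,n_s I_{i_s})$, and $E_N$ is given by the transition function $z^N$ between the trivializations over $\mathbb{C}_0=\mathbb{CP}^1\setminus\{\infty\}$ and $\mathbb{C}_1=\mathbb{CP}^1\setminus\{0\}$. An automorphism of $E_N$ is a pair of holomorphic maps $g_i:\mathbb{C}_i\to \mathrm{GL}(r,\mathbb{C})$ with $g_0=z^N g_1z^{-N}$ on $\mathbb{C}^*$; equivalently, a block-lower-triangular matrix polynomial $g_0(z)$ (blocks with respect to $r=i_1+\dots+i_s$) with constant invertible diagonal blocks and with $(j,k)$ block, $j>k$, of degree at most $n_j-n_k$. Fibers over points of $\mathbb{C}_0$ are identified with $\mathbb{C}^r$ by the first trivialization, and the fiber over $\infty$ by the second; the restriction of an automorphism to the fiber over $z$ is $g_0(z)$ if $z\neq\infty$ and $g_1(\infty)$ if $z=\infty$. The subgroup. $\mathrm{N}_N$ is the group of constant block-lower-triangular matrices with identity diagonal blocks. For $j>k$ decompose the space of $i_j\times i_k$ matrix polynomials of degree at most $n_j-n_k$ vanishing at $z=0$ as $\bigoplus_{l=k}^{j-1}V^l_{jk}$, where each matrix entry of $V^l_{jk}$ ranges over a $d_l$-dimensional space of polynomials. $G_l$ ($1\le l\le s-1$) is the group of block-unipotent elements of $\mathrm{Aut}(E_N)$ whose $(j,k)$ block lies in $V^l_{jk}$ if $k\le l<j$, and all of whose other off-diagonal blocks are zero. The group $(G_1\cdots G_{s-1})\rtimes\mathrm{N}_N$ is the group of all elements of $\mathrm{Aut}(E_N)$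 whose diagonal blocks are identities. Flags and Bruhat cells. For an ordered partition $\mu: r=p_1+\dots+p_t$, $\mathrm{P}_\mu\subset \mathrm{GL}(r,\mathbb{C})$ is the group of invertible block-lower-triangular matrices with diagonal blocks of sizes $p_1,\dots,p_t$; the flag manifold is $\mathcal{F}_\mu=\mathrm{GL}(r,\mathbb{C})/\mathrm{P}_\mu$ with left action of $\mathrm{GL}(r,\mathbb{C})$ (descending flags $\mathbb{C}^r=V_1\supset\dots\supset V_t\supset\{0\}$ with $\dim V_q-\dim V_{q+1}=p_q$). For a permutation matrix $\Pi$ with $\Pi e_k=e_{\sigma(k)}$, $\mathrm{N}^{c}_{\mu,[\Pi]}$ is the group of lower triangular unipotent matrices whose $(j,k)$ entry, $j>k$, vanishes unless $\sigma^{-1}(j)<\sigma^{-1}(k)$ and $\sigma^{-1}(j),\sigma^{-1}(k)$ lie in different partition intervals $\{p_1+\dots+p_{q-1}+1,\dots,p_1+\dots+p_q\}$ of $\mu$. The Bruhat cell of type $[\Pi]$ is $\mathcal{F}_{\mu,[\Pi]}=\mathrm{N}^{c}_{\mu,[\Pi]}\,\Pi\,\mathrm{P}_\mu/\mathrm{P}_\mu$. Special partitions and permutations. $\lambda_0: r=i_s+\dots+i_1$ and $\Pi_0e_k=e_{r+1-k}$. For $1\le l\le s-1$: $\lambda_l: r=i_{l+1}+\dots+i_s+i_1+\dots+i_l$ and $\Pi_le_k=e_{\tau_l(k)}$ with $\tau_l(k)\equiv k+i_1+\dots+i_l\pmod r$, $\tau_l(k)\in\{1,\dots,r\}$. *)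

theory Defs
  imports
    "HOL-Complex_Analysis.Complex_Analysis"
    "HOL-Algebra.Group_Action"
    "HOL-Computational_Algebra.Polynomial"
    "Jordan_Normal_Form.Matrix"
begin

text \<open>Rows and columns of matrices are numbered \<open>0, \<dots>, r - 1\<close>; the summands of a partition, and
  hence the blocks, are numbered from 1.\<close>

section \<open>Partitions, flag manifolds and Bruhat cells\<close>

definition GL :: "nat \<Rightarrow> complex mat monoid" where
  "GL r = units_of (ring_mat TYPE(complex) r ())"

text \<open>The number of the partition interval of \<open>p\<close> containing the index \<open>x\<close>, for \<open>x < sum_list p\<close>.\<close>

definition blk :: "nat list \<Rightarrow> nat \<Rightarrow> nat" where
  "blk p x = (LEAST q. x < sum_list (take q p))"

definition parabolic :: "nat list \<Rightarrow> complex mat set" where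
  "parabolic p = {A \<in> carrier (GL (sum_list p)).
     \<forall>a < sum_list p. \<forall>b < sum_list p. blk p a < blk p b \<longrightarrow> A $$ (a, b) = 0}"

definition flags :: "nat list \<Rightarrow> complex mat set set" where
  "flags p = {A <#\<^bsub>GL (sum_list p)\<^esub> parabolic p | A. A \<in> carrier (GL (sum_list p))}"

text \<open>The matrix sending the basis vector \<open>e\<^sub>k\<close> to \<open>e\<^sub>m\<close>, \<open>m = \<sigma> k\<close>, for \<open>\<sigma>\<close> a bijection of \<open>{..<r}\<close>.\<close>

definition perm_mat :: "nat \<Rightarrow> (nat \<Rightarrow> nat) \<Rightarrow> complex mat" where
  "perm_mat r \<sigma> = mat r r (\<lambda>(a, k). if a = \<sigma> k then 1 else 0)"

definition bruhat_group :: "nat list \<Rightarrow> (nat \<Rightarrow> nat) \<Rightarrow> complex mat set" where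
  "bruhat_group p \<sigma> =
    (let r = sum_list p; \<sigma>' = inv_into {..<r} \<sigma> in
     {A \<in> carrier_mat r r.
        (\<forall>a < r. A $$ (a, a) = 1) \<and>
        (\<forall>a < r. \<forall>b < r. a < b \<longrightarrow> A $$ (a, b) = 0) \<and>
        (\<forall>a < r. \<forall>b < a. \<not> (\<sigma>' a < \<sigma>' b \<and> blk p (\<sigma>' a) \<noteq> blk p (\<sigma>' b)) \<longrightarrow> A $$ (a, b) = 0)})"

definition bruhat_cell :: "nat list \<Rightarrow> (nat \<Rightarrow> nat) \<Rightarrow> complex mat set set" where
  "bruhat_cell p \<sigma> =
    (\<lambda>A. (A * perm_mat (sum_list p) \<sigma>) <#\<^bsub>GL (sum_list p)\<^esub> parabolic p) ` bruhat_group p \<sigma>"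


section \<open>The bundle and its automorphisms\<close>

text \<open>The bundle is given by \<open>s\<close>, the multiplicities \<open>i 1, \<dots>, i s\<close> and the degrees \<open>n 1, \<dots>, n s\<close>.\<close>

definition parts :: "nat \<Rightarrow> (nat \<Rightarrow> nat) \<Rightarrow> nat list" where
  "parts s i = map i [1..<Suc s]"

definition rk :: "nat \<Rightarrow> (nat \<Rightarrow> nat) \<Rightarrow> nat" where
  "rk s i = (\<Sum>k = 1..s. i k)"

text \<open>\<open>row_blk s i a\<close> is the number of the block of \<open>r = i 1 + \<dots> + i s\<close> containing \<open>a\<close>.\<close>

abbreviation row_blk :: "nat \<Rightarrow> (nat \<Rightarrow> nat) \<Rightarrow> nat \<Rightarrow> nat" where
  "row_blk s i \<equiv> blk (parts s i)"

definition zN :: "nat \<Rightarrow> (nat \<Rightarrow> nat) \<Rightarrow> (nat \<Rightarrow> int) \<Rightarrow> complex \<Rightarrow> complex mat" where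
  "zN s i n z = mat (rk s i) (rk s i) (\<lambda>(a, b). if a = b then z powi n (row_blk s i a) else 0)"

text \<open>The second component \<open>g1\<close> of an automorphism is written in the coordinate \<open>w = 1 / z\<close> of the
  chart around \<open>\<infinity>\<close>. In particular its value at the point \<open>\<infinity>\<close> is \<open>g1 0\<close>.\<close>

type_synonym aut = "(complex \<Rightarrow> complex mat) \<times> (complex \<Rightarrow> complex mat)"

definition holomorphic_GL :: "nat \<Rightarrow> (complex \<Rightarrow> complex mat) \<Rightarrow> bool" where
  "holomorphic_GL r g \<longleftrightarrow> (\<forall>z. g z \<in> carrier (GL r)) \<and>
     (\<forall>a < r. \<forall>b < r. (\<lambda>z. g z $$ (a, b)) holomorphic_on UNIV)"

definition AutE :: "nat \<Rightarrow> (nat \<Rightarrow> nat) \<Rightarrow> (nat \<Rightarrow> int) \<Rightarrow> aut monoid" where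
  "AutE s i n = \<lparr>
     carrier = {(g0, g1). holomorphic_GL (rk s i) g0 \<and> holomorphic_GL (rk s i) g1 \<and>
       (\<forall>z. z \<noteq> 0 \<longrightarrow> g0 z = zN s i n z * g1 (1 / z) * zN s i (\<lambda>k. - n k) z)},
     mult = (\<lambda>(g0, g1) (h0, h1). (\<lambda>z. g0 z * h0 z, \<lambda>w. g1 w * h1 w)),
     one = (\<lambda>_. 1\<^sub>m (rk s i), \<lambda>_. 1\<^sub>m (rk s i))\<rparr>"

text \<open>The projective line, with \<open>None\<close> as the point \<open>\<infinity>\<close>.\<close>

type_synonym cp1 = "complex option"

fun restr :: "aut \<Rightarrow> cp1 \<Rightarrow> complex mat" where
  "restr (g0, g1) (Some z) = g0 z"
| "restr (g0, g1) None = g1 0"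


section \<open>The subgroup\<close>

definition deg_gap :: "(nat \<Rightarrow> int) \<Rightarrow> nat \<Rightarrow> nat" where
  "deg_gap n l = nat (n (l + 1) - n l)"

text \<open>A choice of the decompositions into the spaces \<open>V\<^sup>l\<^sub>j\<^sub>k\<close>, given entry by entry: for \<open>(a, b)\<close> in the
  block \<open>(j, k)\<close>, \<open>W l a b\<close> is the space of polynomials over which the entry \<open>(a, b)\<close> ranges.
  So \<open>V\<^sup>l\<^sub>j\<^sub>k\<close> consists of the matrices whose \<open>(a, b)\<close> entry is in \<open>W l a b\<close> for all such \<open>a, b\<close>,
  and bijectivity of the sum map says that the sum of the spaces is direct and is all of the
  polynomials of degree at most \<open>n j - n k\<close> vanishing at 0.\<close>

definition decomposition ::
  "nat \<Rightarrow> (nat \<Rightarrow> nat) \<Rightarrow> (nat \<Rightarrow> int) \<Rightarrow> (nat \<Rightarrow> nat \<Rightarrow> nat \<Rightarrow> complex poly set) \<Rightarrow> bool" where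
  "decomposition s i n W \<longleftrightarrow>
    (\<forall>a < rk s i. \<forall>b < rk s i. let j = row_blk s i a; k = row_blk s i b in k < j \<longrightarrow>
       (\<forall>l \<in> {k..<j}. module.subspace Polynomial.smult (W l a b) \<and>
                      vector_space.dim Polynomial.smult (W l a b) = deg_gap n l) \<and>
       bij_betw (\<lambda>q. \<Sum>l \<in> {k..<j}. q l) (\<Pi>\<^sub>E l \<in> {k..<j}. W l a b)
         {p. degree p \<le> nat (n j - n k) \<and> poly p 0 = 0})"

definition G_sub :: "nat \<Rightarrow> (nat \<Rightarrow> nat) \<Rightarrow> (nat \<Rightarrow> int) \<Rightarrow>
    (nat \<Rightarrow> nat \<Rightarrow> nat \<Rightarrow> complex poly set) \<Rightarrow> nat \<Rightarrow> aut set" where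
  "G_sub s i n W l = {(g0, g1) \<in> carrier (AutE s i n).
     \<forall>a < rk s i. \<forall>b < rk s i. let j = row_blk s i a; k = row_blk s i b in
       if j = k then (\<forall>z. g0 z $$ (a, b) = (if a = b then 1 else 0))
       else if k \<le> l \<and> l < j then (\<exists>p \<in> W l a b. \<forall>z. g0 z $$ (a, b) = poly p z)
       else (\<forall>z. g0 z $$ (a, b) = 0)}"

definition N_sub :: "nat \<Rightarrow> (nat \<Rightarrow> nat) \<Rightarrow> (nat \<Rightarrow> int) \<Rightarrow> aut set" where
  "N_sub s i n = {(g0, g1) \<in> carrier (AutE s i n). \<exists>A. (\<forall>z. g0 z = A) \<and>
     (\<forall>a < rk s i. \<forall>b < rk s i.
        (row_blk s i a = row_blk s i b \<longrightarrow> A $$ (a, b) = (if a = b then 1 else 0)) \<and>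
        (row_blk s i a < row_blk s i b \<longrightarrow> A $$ (a, b) = 0))}"

text \<open>The set of products \<open>g\<^sub>1 \<cdots> g\<^sub>s\<^sub>-\<^sub>1 h\<close> with \<open>g\<^sub>l\<close> in the \<open>l\<close>-th subgroup \<open>G_sub\<close> and \<open>h\<close> in \<open>N_sub\<close>, which
  is the underlying set of the internal semidirect product.\<close>

definition GN_sub :: "nat \<Rightarrow> (nat \<Rightarrow> nat) \<Rightarrow> (nat \<Rightarrow> int) \<Rightarrow>
    (nat \<Rightarrow> nat \<Rightarrow> nat \<Rightarrow> complex poly set) \<Rightarrow> aut set" where
  "GN_sub s i n W =
    foldr (\<lambda>l S. G_sub s i n W l <#>\<^bsub>AutE s i n\<^esub> S) [1..<s] {\<one>\<^bsub>AutE s i n\<^esub>} <#>\<^bsub>AutE s i n\<^esub> N_sub s i n"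

definition GN_group :: "nat \<Rightarrow> (nat \<Rightarrow> nat) \<Rightarrow> (nat \<Rightarrow> int) \<Rightarrow>
    (nat \<Rightarrow> nat \<Rightarrow> nat \<Rightarrow> complex poly set) \<Rightarrow> aut monoid" where
  "GN_group s i n W = (AutE s i n)\<lparr>carrier := GN_sub s i n W\<rparr>"


section \<open>The product of Bruhat cells and the action\<close>

text \<open>The partitions and permutations of type \<open>l\<close>, for \<open>l < s\<close>.\<close>

definition lam :: "nat \<Rightarrow> (nat \<Rightarrow> nat) \<Rightarrow> nat \<Rightarrow> nat list" where
  "lam s i l = (if l = 0 then rev (parts s i) else drop l (parts s i) @ take l (parts s i))"

text \<open>In 1-based numbering these are \<open>k \<mapsto> r + 1 - k\<close> for \<open>l = 0\<close> and the shift
  \<open>k \<mapsto> k + i 1 + \<dots> + i l\<close> modulo \<open>r\<close> for \<open>l > 0\<close>.\<close>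

definition tau :: "nat \<Rightarrow> (nat \<Rightarrow> nat) \<Rightarrow> nat \<Rightarrow> nat \<Rightarrow> nat" where
  "tau s i l k = (if l = 0 then rk s i - 1 - k else (k + (\<Sum>q = 1..l. i q)) mod rk s i)"

definition num_pts :: "nat \<Rightarrow> (nat \<Rightarrow> int) \<Rightarrow> nat" where
  "num_pts s n = (\<Sum>l = 1..<s. deg_gap n l)"

text \<open>The type \<open>l\<close> of the cell over the \<open>m\<close>-th point: 0 for \<open>m = 0\<close>, and otherwise the \<open>l\<close> with
  \<open>d\<^sub>1 + \<dots> + d\<^sub>l\<^sub>-\<^sub>1 < m \<le> d\<^sub>1 + \<dots> + d\<^sub>l\<close>, where \<open>d\<^sub>q = deg_gap n q\<close>.\<close>

definition pt_type :: "(nat \<Rightarrow> int) \<Rightarrow> nat \<Rightarrow> nat" where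
  "pt_type n m = (LEAST l. m \<le> (\<Sum>q = 1..l. deg_gap n q))"

definition cells :: "nat \<Rightarrow> (nat \<Rightarrow> nat) \<Rightarrow> (nat \<Rightarrow> int) \<Rightarrow> (nat \<Rightarrow> complex mat set) set" where
  "cells s i n =
    (\<Pi>\<^sub>E m \<in> {..num_pts s n}. bruhat_cell (lam s i (pt_type n m)) (tau s i (pt_type n m)))"

definition act :: "nat \<Rightarrow> (nat \<Rightarrow> nat) \<Rightarrow> (nat \<Rightarrow> int) \<Rightarrow> (nat \<Rightarrow> cp1) \<Rightarrow>
    aut \<Rightarrow> (nat \<Rightarrow> complex mat set) \<Rightarrow> (nat \<Rightarrow> complex mat set)" where
  "act s i n z g = (\<lambda>x \<in> cells s i n. \<lambda>m \<in> {..num_pts s n}. restr g (z m) <#\<^bsub>GL (rk s i)\<^esub> x m)"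


section \<open>Topologies and proper actions\<close>

definition GL_top :: "nat \<Rightarrow> complex mat topology" where
  "GL_top r = pullback_topology (carrier (GL r)) (\<lambda>A. \<lambda>x \<in> {..<r} \<times> {..<r}. A $$ x)
     (product_topology (\<lambda>_. euclidean) ({..<r} \<times> {..<r}))"

text \<open>The quotient topology of \<open>GL_top\<close>.\<close>

definition flag_top :: "nat list \<Rightarrow> complex mat set topology" where
  "flag_top p = topology (\<lambda>U. U \<subseteq> flags p \<and>
     openin (GL_top (sum_list p))
       {A \<in> carrier (GL (sum_list p)). A <#\<^bsub>GL (sum_list p)\<^esub> parabolic p \<in> U})"

definition cells_top :: "nat \<Rightarrow> (nat \<Rightarrow> nat) \<Rightarrow> (nat \<Rightarrow> int) \<Rightarrow> (nat \<Rightarrow> complex mat set) topology" where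
  "cells_top s i n = product_topology
     (\<lambda>m. subtopology (flag_top (lam s i (pt_type n m)))
            (bruhat_cell (lam s i (pt_type n m)) (tau s i (pt_type n m)))) {..num_pts s n}"

text \<open>The coarsest topology for which restriction to every fiber is continuous. By the growth
  condition at \<open>\<infinity>\<close>, automorphisms are matrix polynomials of bounded degree; they lie in a
  finite-dimensional space of functions, on which pointwise convergence gives the usual topology,
  that is, convergence of the coefficients.\<close>

definition AutE_top :: "nat \<Rightarrow> (nat \<Rightarrow> nat) \<Rightarrow> (nat \<Rightarrow> int) \<Rightarrow> aut topology" where
  "AutE_top s i n = pullback_topology (carrier (AutE s i n)) restr
     (product_topology (\<lambda>_. GL_top (rk s i)) UNIV)"

definition proper_action :: "'g topology \<Rightarrow> 'x topology \<Rightarrow> ('g \<Rightarrow> 'x \<Rightarrow> 'x) \<Rightarrow> bool" where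
  "proper_action TG TX \<phi> \<longleftrightarrow>
     continuous_map (prod_topology TG TX) TX (\<lambda>(g, x). \<phi> g x) \<and>
     proper_map (prod_topology TG TX) (prod_topology TX TX) (\<lambda>(g, x). (\<phi> g x, x))"

end

theory Submission
  imports Defs "Jordan_Normal_Form.Determinant"
begin

text \<open>Elements of the group are unipotent block-lower-triangular matrix polynomials \<open>g\<close>. Each Bruhat cell of
  type \<open>t\<close> is parametrized by the unipotent matrices \<open>A\<close> supported on a set of blocks depending on \<open>t\<close>, and
  \<open>g\<close> moves the point with parameter \<open>A\<close> to that with parameter \<open>A'\<close> iff \<open>g A = A' L(g)\<close>, where \<open>L(g)\<close> is \<open>g\<close>
  with these blocks replaced by 0. Entrywise, this prescribes the value of \<open>g\<^sub>j\<^sub>k\<close> at the point in terms of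
  blocks of \<open>g\<close> closer to the diagonal. Since \<open>g\<^sub>j\<^sub>k\<close> has degree at most \<open>n\<^sub>j - n\<^sub>k = d\<^sub>k + \<dots> + d\<^sub>j\<^sub>-\<^sub>1\<close> and is
  prescribed at exactly \<open>n\<^sub>j - n\<^sub>k + 1\<close> points, Lagrange interpolation yields a unique \<open>g\<close> carrying one
  given point of the product to another. It depends continuously on the two points, because the
  parameter is a continuous function on the cell; so \<open>(g, x) \<mapsto> (g x, x)\<close> is a homeomorphism and the
  action is proper.\<close>

section \<open>Unipotent matrices\<close>

text \<open>The count n_j - n_k + 1 comes from the permutations. Reversal inverts every pair of
  blocks, so the cell over z_0 has a parameter in every block below the diagonal; the cyclic shift
  of type l inverts exactly the pairs k <= l < j, and d_l points have that type. Hence block (j, k)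
  is prescribed at 1 + d_k + ... + d_{j-1} points. L(g) appears because it fixes the base flag of
  the cell: what remains of g after deleting the parameter blocks is absorbed by the stabilizer.

  Two matters need arguments of their own. A cell carries a subspace topology of a quotient, so
  continuity of its parameter is a question about the matrices representing a flag; it becomes
  continuity of a factor in a block LU factorization. And the group is defined through an arbitrary
  choice of spaces V; it is shown to consist of all block-unipotent automorphisms, whose inverses
  are read off from the free transitive action instead of being constructed as holomorphic matrix
  functions.\<close>

lemma mat_mult_entry:
  assumes "A \<in> carrier_mat r r" "B \<in> carrier_mat r r" "a < r" "b < r"
  shows "(A * B) $$ (a, b) = (\<Sum>c<r. A $$ (a, c) * B $$ (c, b))"
  using assms by (auto simp: scalar_prod_def lessThan_atLeast0 intro!: sum.cong)

lemma mult_mat_vec_entry: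
  assumes "A \<in> carrier_mat r r" "v \<in> carrier_vec r" "a < r"
  shows "(A *\<^sub>v v) $ a = (\<Sum>c<r. A $$ (a, c) * v $ c)"
  using assms by (auto simp: scalar_prod_def lessThan_atLeast0 intro!: sum.cong)

lemma square_mat_eq_iff:
  assumes "A \<in> carrier_mat r r" "B \<in> carrier_mat r r"
  shows "A = B \<longleftrightarrow> (\<forall>a<r. \<forall>b<r. A $$ (a, b) = B $$ (a, b))"
  using assms by (auto intro!: eq_matI)

lemma carrier_GL_iff:
  "A \<in> carrier (GL r) \<longleftrightarrow> A \<in> carrier_mat r r \<and> Determinant.det A \<noteq> 0"
proof
  assume "A \<in> carrier (GL r)"
  then show "A \<in> carrier_mat r r \<and> Determinant.det A \<noteq> 0"
    unfolding GL_def units_of_carrier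
    using unit_imp_det_non_zero[of A r "()"] by (auto simp: Units_def ring_mat_def)
next
  assume "A \<in> carrier_mat r r \<and> Determinant.det A \<noteq> 0"
  then show "A \<in> carrier (GL r)"
    unfolding GL_def units_of_carrier using det_non_zero_imp_unit[of A r "()"] by auto
qed

lemma mult_GL [simp]: "A \<otimes>\<^bsub>GL r\<^esub> B = A * B"
  by (simp add: GL_def units_of_def ring_mat_def)

lemma one_GL [simp]: "\<one>\<^bsub>GL r\<^esub> = 1\<^sub>m r"
  by (simp add: GL_def units_of_def ring_mat_def)

lemma group_GL: "group (GL r)"
  unfolding GL_def
  by (intro monoid.units_group ring.is_monoid ring_mat)

lemma GL_carrier_mat: "A \<in> carrier (GL r) \<Longrightarrow> A \<in> carrier_mat r r"
  by (simp add: carrier_GL_iff)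

lemma GL_mult_closed: "A \<in> carrier (GL r) \<Longrightarrow> B \<in> carrier (GL r) \<Longrightarrow> A * B \<in> carrier (GL r)"
  using monoid.m_closed[OF group.is_monoid[OF group_GL], of A r B] by simp

lemma GL_inverse:
  assumes "A \<in> carrier (GL r)"
  obtains B where "B \<in> carrier (GL r)" "A * B = 1\<^sub>m r" "B * A = 1\<^sub>m r"
  using group.inv_closed[OF group_GL assms] group.r_inv[OF group_GL assms]
    group.l_inv[OF group_GL assms] by auto

text \<open>The grading \<open>\<beta>\<close> is a parameter because two kinds of groups occur:
  with block numbers as grades these are the block-unipotent matrices, with a coarser grading the
  parameters of a Bruhat cell.\<close>

definition unip :: "nat \<Rightarrow> (nat \<Rightarrow> nat) \<Rightarrow> complex mat set" where
  "unip r \<beta> = {A \<in> carrier_mat r r.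
     \<forall>a<r. \<forall>b<r. \<beta> a \<le> \<beta> b \<longrightarrow> A $$ (a, b) = (if a = b then 1 else 0)}"

lemma unip_carrier_mat: "A \<in> unip r \<beta> \<Longrightarrow> A \<in> carrier_mat r r"
  by (simp add: unip_def)

lemma unip_entry:
  "A \<in> unip r \<beta> \<Longrightarrow> a < r \<Longrightarrow> b < r \<Longrightarrow> \<beta> a \<le> \<beta> b \<Longrightarrow> A $$ (a, b) = (if a = b then 1 else 0)"
  by (simp add: unip_def)

lemma one_unip: "1\<^sub>m r \<in> unip r \<beta>"
  by (auto simp: unip_def)

lemma unip_eqI:
  assumes "A \<in> unip r \<beta>" "B \<in> unip r \<beta>"
    and "\<And>a b. a < r \<Longrightarrow> b < r \<Longrightarrow> \<beta> b < \<beta> a \<Longrightarrow> A $$ (a, b) = B $$ (a, b)"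
  shows "A = B"
proof (rule eq_matI)
  show "A $$ (a, b) = B $$ (a, b)" if "a < dim_row B" "b < dim_col B" for a b
    using assms that by (cases "\<beta> a \<le> \<beta> b") (auto simp: unip_def)
qed (use assms in \<open>auto simp: unip_def\<close>)

lemma unip_mult_entry:
  assumes A: "A \<in> unip r \<beta>" and B: "B \<in> carrier_mat r r" and ab: "a < r" "b < r"
  shows "(A * B) $$ (a, b) = B $$ (a, b) + (\<Sum>c | c < r \<and> \<beta> c < \<beta> a. A $$ (a, c) * B $$ (c, b))"
proof -
  have "(A * B) $$ (a, b) = (\<Sum>c<r. A $$ (a, c) * B $$ (c, b))"
    using assms by (intro mat_mult_entry) (auto simp: unip_def)
  also have "\<dots> = (\<Sum>c<r. (if c = a then B $$ (c, b) else 0) +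
      (if \<beta> c < \<beta> a then A $$ (a, c) * B $$ (c, b) else 0))"
    using A ab by (intro sum.cong) (auto simp: unip_def)
  also have "\<dots> = B $$ (a, b) + (\<Sum>c<r. if \<beta> c < \<beta> a then A $$ (a, c) * B $$ (c, b) else 0)"
    using ab by (simp add: sum.distrib)
  also have "(\<Sum>c<r. if \<beta> c < \<beta> a then A $$ (a, c) * B $$ (c, b) else 0)
      = (\<Sum>c | c < r \<and> \<beta> c < \<beta> a. A $$ (a, c) * B $$ (c, b))"
    by (intro sum.mono_neutral_cong_right) auto
  finally show ?thesis .
qed

lemma mult_unip_entry:
  assumes A: "A \<in> carrier_mat r r" and B: "B \<in> unip r \<beta>" and ab: "a < r" "b < r"
  shows "(A * B) $$ (a, b) = A $$ (a, b) + (\<Sum>c | c < r \<and> \<beta> b < \<beta> c. A $$ (a, c) * B $$ (c, b))"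
proof -
  have "(A * B) $$ (a, b) = (\<Sum>c<r. A $$ (a, c) * B $$ (c, b))"
    using assms by (intro mat_mult_entry) (auto simp: unip_def)
  also have "\<dots> = (\<Sum>c<r. (if c = b then A $$ (a, c) else 0) +
      (if \<beta> b < \<beta> c then A $$ (a, c) * B $$ (c, b) else 0))"
    using B ab by (intro sum.cong) (auto simp: unip_def)
  also have "\<dots> = A $$ (a, b) + (\<Sum>c<r. if \<beta> b < \<beta> c then A $$ (a, c) * B $$ (c, b) else 0)"
    using ab by (simp add: sum.distrib)
  also have "(\<Sum>c<r. if \<beta> b < \<beta> c then A $$ (a, c) * B $$ (c, b) else 0)
      = (\<Sum>c | c < r \<and> \<beta> b < \<beta> c. A $$ (a, c) * B $$ (c, b))"
    by (intro sum.mono_neutral_cong_right) auto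
  finally show ?thesis .
qed

lemma unip_mult_closed:
  assumes A: "A \<in> unip r \<beta>" and B: "B \<in> unip r \<beta>"
  shows "A * B \<in> unip r \<beta>"
proof -
  have "(A * B) $$ (a, b) = (if a = b then 1 else 0)" if ab: "a < r" "b < r" "\<beta> a \<le> \<beta> b" for a b
  proof -
    have "(\<Sum>c | c < r \<and> \<beta> c < \<beta> a. A $$ (a, c) * B $$ (c, b)) = 0"
      using B ab by (intro sum.neutral) (auto simp: unip_def)
    then show ?thesis
      using unip_mult_entry[OF A unip_carrier_mat[OF B] ab(1,2)] unip_entry[OF B ab] by simp
  qed
  then show ?thesis
    using A B by (auto simp: unip_def)
qed

text \<open>Forward substitution: row \<open>a\<close> of \<open>A *\<^sub>v v = 0\<close> expresses
  \<open>v $ a\<close> through entries of strictly smaller grade, so a kernel vector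
  vanishes.\<close>

lemma unip_det: 
  assumes A: "A \<in> unip r \<beta>"
  shows "Determinant.det A \<noteq> 0"
proof
  note Am = unip_carrier_mat[OF A]
  assume "Determinant.det A = 0"
  then obtain v where v: "v \<in> carrier_vec r" "v \<noteq> 0\<^sub>v r" "A *\<^sub>v v = 0\<^sub>v r"
    using det_0_iff_vec_prod_zero_field[OF Am] by blast
  have "v $ a = 0" if "a < r" for a
    using that
  proof (induction "\<beta> a" arbitrary: a rule: less_induct)
    case less
    have "0 = (A *\<^sub>v v) $ a" using v(3) less.prems by simp
    also have "\<dots> = (\<Sum>c<r. A $$ (a, c) * v $ c)"
      by (rule mult_mat_vec_entry[OF Am v(1) less.prems])
    also have "\<dots> = (\<Sum>c<r. if c = a then v $ a else 0)"
    proof (intro sum.cong refl)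
      fix c assume "c \<in> {..<r}"
      then show "A $$ (a, c) * v $ c = (if c = a then v $ a else 0)"
        using less A by (cases "\<beta> c < \<beta> a") (auto simp: unip_def)
    qed
    also have "\<dots> = v $ a" using less.prems by simp
    finally show ?case by simp
  qed
  then have "v = 0\<^sub>v r" using v(1) by (intro eq_vecI) auto
  with v(2) show False by simp
qed

lemma unip_GL: "A \<in> unip r \<beta> \<Longrightarrow> A \<in> carrier (GL r)"
  by (simp add: carrier_GL_iff unip_det unip_carrier_mat)

text \<open>The inverse exists in \<open>GL r\<close>; that it is unipotent follows by forward
  substitution in \<open>A * B = 1\<close>, rows of smaller grade being known.\<close>

lemma unip_inverse:
  assumes A: "A \<in> unip r \<beta>"
  obtains B where "B \<in> unip r \<beta>" "A * B = 1\<^sub>m r" "B * A = 1\<^sub>m r"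
proof -
  obtain B where B: "B \<in> carrier (GL r)" "A * B = 1\<^sub>m r" "B * A = 1\<^sub>m r"
    using GL_inverse[OF unip_GL[OF A]] .
  note Bm = GL_carrier_mat[OF B(1)]
  have "B $$ (a, b) = (if a = b then 1 else 0)" if "a < r" "b < r" "\<beta> a \<le> \<beta> b" for a b
    using that
  proof (induction "\<beta> a" arbitrary: a rule: less_induct)
    case less
    have "(\<Sum>c | c < r \<and> \<beta> c < \<beta> a. A $$ (a, c) * B $$ (c, b)) = 0"
      using less by (intro sum.neutral) auto
    then show ?case
      using unip_mult_entry[OF A Bm less.prems(1,2)] B(2) less.prems by simp
  qed
  then have "B \<in> unip r \<beta>" using Bm by (auto simp: unip_def)
  with B that show thesis by blast
qed

lemma unip_antimono:
  assumes "\<And>a b. a < r \<Longrightarrow> b < r \<Longrightarrow> \<beta> a \<le> \<beta> b \<Longrightarrow> \<gamma> a \<le> \<gamma> b"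
  shows "unip r \<gamma> \<subseteq> unip r \<beta>"
  using assms by (auto simp: unip_def)

text \<open>Only the part below the \<open>\<gamma>\<close>-diagonal is deleted. For the matrices it
  is applied to, the part above vanishes already, so the result is the block-diagonal Levi part with
  respect to \<open>\<gamma>\<close>.\<close>

definition levi :: "nat \<Rightarrow> (nat \<Rightarrow> nat) \<Rightarrow> complex mat \<Rightarrow> complex mat" where
  "levi r \<gamma> A = mat r r (\<lambda>(a, b). if \<gamma> b < \<gamma> a then 0 else A $$ (a, b))"

lemma levi_unip: "A \<in> unip r \<beta> \<Longrightarrow> levi r \<gamma> A \<in> unip r \<beta>"
  by (auto simp: unip_def levi_def)

text \<open>Uniqueness of a block LU factorization, \<open>q\<close> being block upper triangular
  for \<open>\<gamma>\<close>. Once the rows of \<open>q\<close> of smaller grade are those of the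
  identity, comparing row \<open>a\<close> of \<open>A = A' * q\<close> gives the same for row
  \<open>a\<close>.\<close>

lemma unip_unique_factor:
  assumes A: "A \<in> unip r \<gamma>" and A': "A' \<in> unip r \<gamma>" and q: "q \<in> carrier_mat r r"
    and q0: "\<And>a b. a < r \<Longrightarrow> b < r \<Longrightarrow> \<gamma> b < \<gamma> a \<Longrightarrow> q $$ (a, b) = 0"
    and eq: "A = A' * q"
  shows "A = A'"
proof -
  have q_delta: "q $$ (a, b) = (if a = b then 1 else 0)" if "a < r" "b < r" for a b
    using that
  proof (induction "\<gamma> a" arbitrary: a rule: less_induct)
    case less
    have "(\<Sum>c | c < r \<and> \<gamma> c < \<gamma> a. A' $$ (a, c) * q $$ (c, b))
      = (\<Sum>c | c < r \<and> \<gamma> c < \<gamma> a. if c = b then A' $$ (a, b) else 0)"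
      using less by (intro sum.cong) auto
    also have "\<dots> = (if \<gamma> b < \<gamma> a then A' $$ (a, b) else 0)"
      using less.prems by (subst sum.delta) auto
    finally have "A $$ (a, b) = q $$ (a, b) + (if \<gamma> b < \<gamma> a then A' $$ (a, b) else 0)"
      using unip_mult_entry[OF A' q less.prems] eq by simp
    then show ?case
      using less.prems q0[of a b] unip_entry[OF A less.prems] by (cases "\<gamma> b < \<gamma> a") auto
  qed
  have "q = 1\<^sub>m r" using q q_delta by (intro eq_matI) auto
  then show ?thesis using eq right_mult_one_mat[OF unip_carrier_mat[OF A']] by simp
qed

text \<open>\<open>\<gamma>\<close> may merge grades of \<open>\<beta>\<close> but never reverses
  their order. Below, \<open>g\<close> in \<open>unip r \<beta>\<close> is an automorphism
  restricted to one fiber and \<open>A\<close> in \<open>unip r \<gamma>\<close> the parameter of a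
  flag in that fiber.\<close>

locale graded =
  fixes r :: nat and \<beta> \<gamma> :: "nat \<Rightarrow> nat"
  assumes mono: "\<And>a b. a < r \<Longrightarrow> b < r \<Longrightarrow> \<beta> a \<le> \<beta> b \<Longrightarrow> \<gamma> a \<le> \<gamma> b"
begin

lemma less_imp: "a < r \<Longrightarrow> b < r \<Longrightarrow> \<gamma> a < \<gamma> b \<Longrightarrow> \<beta> a < \<beta> b"
  using mono[of b a] by (meson leD leI)

lemma unip_sub: "unip r \<gamma> \<subseteq> unip r \<beta>"
  by (rule unip_antimono[OF mono])

text \<open>In a term \<open>g $$ (a, c) * A $$ (c, b)\<close> with
  \<open>\<gamma> b < \<gamma> c\<close> one has \<open>\<gamma> a < \<gamma> c\<close>, and there
  \<open>g\<close> vanishes.\<close>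

lemma mult_entry_ge:
  assumes g: "g \<in> unip r \<beta>" and A: "A \<in> unip r \<gamma>" and ab: "a < r" "b < r" "\<gamma> a \<le> \<gamma> b"
  shows "(g * A) $$ (a, b) = g $$ (a, b)"
proof -
  have "(\<Sum>c | c < r \<and> \<gamma> b < \<gamma> c. g $$ (a, c) * A $$ (c, b)) = 0"
    using ab unip_entry[OF g ab(1)] less_imp[OF ab(1)]
    by (intro sum.neutral) (auto, metis less_imp less_le_not_le nat_less_le order_le_less_trans)
  then show ?thesis using mult_unip_entry[OF unip_carrier_mat[OF g] A ab(1,2)] by simp
qed

text \<open>The correction sum runs over indices strictly between \<open>b\<close> and
  \<open>a\<close>. This is what later allows the entries of an automorphism to be determined
  successively, moving away from the diagonal blocks.\<close>

lemma mult_entry_less: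
  assumes g: "g \<in> unip r \<beta>" and A: "A \<in> unip r \<gamma>" and ab: "a < r" "b < r" "\<gamma> b < \<gamma> a"
  shows "(g * A) $$ (a, b) = g $$ (a, b) + A $$ (a, b) +
     (\<Sum>c | c < r \<and> \<beta> b < \<beta> c \<and> \<beta> c < \<beta> a. g $$ (a, c) * A $$ (c, b))"
proof -
  have A': "A \<in> unip r \<beta>" using A unip_sub by auto
  have "(g * A) $$ (a, b) = A $$ (a, b) + (\<Sum>c | c < r \<and> \<beta> c < \<beta> a. g $$ (a, c) * A $$ (c, b))"
    by (rule unip_mult_entry[OF g unip_carrier_mat[OF A] ab(1,2)])
  also have "(\<Sum>c | c < r \<and> \<beta> c < \<beta> a. g $$ (a, c) * A $$ (c, b))
    = (\<Sum>c | c < r \<and> \<beta> c < \<beta> a. (if c = b then g $$ (a, b) else 0)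
         + (if \<beta> b < \<beta> c then g $$ (a, c) * A $$ (c, b) else 0))"
    using A' ab by (intro sum.cong) (auto simp: unip_def)
  also have "\<dots> = (\<Sum>c | c < r \<and> \<beta> c < \<beta> a. (if c = b then g $$ (a, b) else 0))
         + (\<Sum>c | c < r \<and> \<beta> c < \<beta> a. if \<beta> b < \<beta> c then g $$ (a, c) * A $$ (c, b) else 0)"
    by (rule sum.distrib)
  also have "(\<Sum>c | c < r \<and> \<beta> c < \<beta> a. (if c = b then g $$ (a, b) else 0)) = g $$ (a, b)"
    using ab less_imp[of b a] by (subst sum.delta) auto
  also have "(\<Sum>c | c < r \<and> \<beta> c < \<beta> a. if \<beta> b < \<beta> c then g $$ (a, c) * A $$ (c, b) else 0)
    = (\<Sum>c | c < r \<and> \<beta> b < \<beta> c \<and> \<beta> c < \<beta> a. g $$ (a, c) * A $$ (c, b))"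
    by (intro sum.mono_neutral_cong_right) auto
  finally show ?thesis by simp
qed

lemma levi_mult_entry_ge:
  assumes g: "g \<in> unip r \<beta>" and A: "A \<in> unip r \<gamma>" and ab: "a < r" "b < r" "\<gamma> a \<le> \<gamma> b"
  shows "(A * levi r \<gamma> g) $$ (a, b) = g $$ (a, b)"
proof -
  have "levi r \<gamma> g $$ (c, b) = 0" if "c < r" "\<gamma> c < \<gamma> a" for c
  proof -
    have "\<beta> c < \<beta> b" using that ab less_imp[of c b] by simp
    then show ?thesis using that ab g by (auto simp: levi_def unip_def)
  qed
  then have "(\<Sum>c | c < r \<and> \<gamma> c < \<gamma> a. A $$ (a, c) * levi r \<gamma> g $$ (c, b)) = 0"
    by (intro sum.neutral) auto
  then show ?thesis
    using unip_mult_entry[OF A _ ab(1,2), of "levi r \<gamma> g"] ab by (simp add: levi_def)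
qed

lemma levi_mult_entry_less:
  assumes g: "g \<in> unip r \<beta>" and A: "A \<in> unip r \<gamma>" and ab: "a < r" "b < r" "\<gamma> b < \<gamma> a"
  shows "(A * levi r \<gamma> g) $$ (a, b) = A $$ (a, b) +
     (\<Sum>c | c < r \<and> \<beta> b < \<beta> c \<and> \<beta> c < \<beta> a. A $$ (a, c) * levi r \<gamma> g $$ (c, b))"
proof -
  \<comment> \<open>Both factors are unipotent for \<open>\<beta>\<close>, so
    \<open>mult_entry_less\<close> applies with equal gradings; the summand
    \<open>levi r \<gamma> g $$ (a, b)\<close> in it is 0.\<close>
  interpret \<beta>: graded r \<beta> \<beta> by unfold_locales
  have "A \<in> unip r \<beta>" using A unip_sub by auto
  from \<beta>.mult_entry_less[OF this levi_unip[OF g] ab(1,2) less_imp[OF ab(2,1,3)]]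
  show ?thesis using ab by (simp add: levi_def)
qed

text \<open>Where \<open>\<gamma> a \<le> \<gamma> b\<close> both products have the entry of
  \<open>g\<close>, so no condition arises. Each remaining entry gives one equation, solved for
  \<open>g $$ (a, b)\<close>.\<close>

lemma levi_factor_iff:
  assumes g: "g \<in> unip r \<beta>" and A: "A \<in> unip r \<gamma>" and A': "A' \<in> unip r \<gamma>"
  shows "g * A = A' * levi r \<gamma> g \<longleftrightarrow>
    (\<forall>a<r. \<forall>b<r. \<gamma> b < \<gamma> a \<longrightarrow> g $$ (a, b) = A' $$ (a, b) - A $$ (a, b) +
       (\<Sum>c | c < r \<and> \<beta> b < \<beta> c \<and> \<beta> c < \<beta> a.
          A' $$ (a, c) * levi r \<gamma> g $$ (c, b) - g $$ (a, c) * A $$ (c, b)))"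
    (is "_ \<longleftrightarrow> ?R")
proof -
  have "g * A = A' * levi r \<gamma> g \<longleftrightarrow>
      (\<forall>a<r. \<forall>b<r. (g * A) $$ (a, b) = (A' * levi r \<gamma> g) $$ (a, b))"
    using unip_carrier_mat[OF g] unip_carrier_mat[OF A] unip_carrier_mat[OF A']
      unip_carrier_mat[OF levi_unip[OF g]]
    by (intro square_mat_eq_iff mult_carrier_mat[of _ r r]) auto
  also have "\<dots> \<longleftrightarrow> (\<forall>a<r. \<forall>b<r. \<gamma> b < \<gamma> a \<longrightarrow> (g * A) $$ (a, b) = (A' * levi r \<gamma> g) $$ (a, b))"
    using mult_entry_ge[OF g A] levi_mult_entry_ge[OF g A'] by (metis linorder_not_less)
  also have "\<dots> \<longleftrightarrow> ?R"
  proof -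
    have "(g * A) $$ (a, b) = (A' * levi r \<gamma> g) $$ (a, b) \<longleftrightarrow>
       g $$ (a, b) = A' $$ (a, b) - A $$ (a, b) +
       (\<Sum>c | c < r \<and> \<beta> b < \<beta> c \<and> \<beta> c < \<beta> a.
          A' $$ (a, c) * levi r \<gamma> g $$ (c, b) - g $$ (a, c) * A $$ (c, b))"
      if "a < r" "b < r" "\<gamma> b < \<gamma> a" for a b
      unfolding mult_entry_less[OF g A that] levi_mult_entry_less[OF g A' that] sum_subtractf
      by (simp only: algebra_simps)
    then show ?thesis by (simp del: index_mult_mat cong: imp_cong)
  qed
  finally show ?thesis .
qed

lemma levi_factor_exists:
  assumes g: "g \<in> unip r \<beta>" and A: "A \<in> unip r \<gamma>"
  obtains A' where "A' \<in> unip r \<gamma>" "g * A = A' * levi r \<gamma> g"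
proof -
  let ?L = "levi r \<gamma> g"
  obtain B where B: "B \<in> unip r \<beta>" "?L * B = 1\<^sub>m r" "B * ?L = 1\<^sub>m r"
    using unip_inverse[OF levi_unip[OF g]] .
  note c = unip_carrier_mat[OF g] unip_carrier_mat[OF A] unip_carrier_mat[OF B(1)]
    unip_carrier_mat[OF levi_unip[OF g]]
  define A' where "A' = g * A * B"
  have A'm: "A' \<in> carrier_mat r r" using c by (simp add: A'_def)
  have eq: "g * A = A' * ?L"
  proof -
    have "A' * ?L = g * A * (B * ?L)" unfolding A'_def using c by (intro assoc_mult_mat) auto
    then show ?thesis using c B by simp
  qed
  \<comment> \<open>With \<open>L\<close> the Levi part and \<open>B\<close> its inverse,
    \<open>A' - 1 = (g * A - L) * B\<close>. The first factor is supported strictly below the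
    \<open>\<gamma>\<close>-diagonal, and multiplying by the \<open>\<beta>\<close>-unipotent
    \<open>B\<close> preserves this support.\<close>
  define E where "E = g * A - ?L"
  have Em: "E \<in> carrier_mat r r" using c by (simp add: E_def minus_carrier_mat)
  have E0: "E $$ (a, b) = 0" if "a < r" "b < r" "\<gamma> a \<le> \<gamma> b" for a b
    using mult_entry_ge[OF g A that] that c by (simp add: E_def levi_def)
  have AE: "A' = E * B + 1\<^sub>m r"
    unfolding E_def A'_def using c B by (subst minus_mult_distrib_mat[of _ r r]) auto
  have "A' $$ (a, b) = (if a = b then 1 else 0)" if ab: "a < r" "b < r" "\<gamma> a \<le> \<gamma> b" for a b
  proof -
    have "(E * B) $$ (a, b) = (\<Sum>c<r. E $$ (a, c) * B $$ (c, b))"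
      using ab c Em by (intro mat_mult_entry) auto
    also have "\<dots> = 0"
    proof (intro sum.neutral ballI)
      fix c assume c: "c \<in> {..<r}"
      show "E $$ (a, c) * B $$ (c, b) = 0"
      proof (cases "\<gamma> a \<le> \<gamma> c")
        case False
        then have "\<beta> c < \<beta> b" using less_imp[of c b] c ab by auto
        then show ?thesis using unip_entry[OF B(1), of c b] c ab by auto
      qed (use E0 ab c in auto)
    qed
    finally show ?thesis using ab c Em by (simp add: AE)
  qed
  then have "A' \<in> unip r \<gamma>" using A'm by (auto simp: unip_def)
  with eq that show thesis by blast
qed

end

section \<open>Continuity of matrix-valued maps\<close>

lemma continuous_map_mult_algebra:
  fixes f g :: "'a \<Rightarrow> 'b::real_normed_algebra"
  assumes "continuous_map X euclidean f" "continuous_map X euclidean g"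
  shows "continuous_map X euclidean (\<lambda>x. f x * g x)"
  using assms by (simp add: continuous_map_atin tendsto_mult)

lemma continuous_map_divide_field:
  fixes f g :: "'a \<Rightarrow> 'b::real_normed_field"
  assumes "continuous_map X euclidean f" "continuous_map X euclidean g"
    and "\<And>x. x \<in> topspace X \<Longrightarrow> g x \<noteq> 0"
  shows "continuous_map X euclidean (\<lambda>x. f x / g x)"
  using assms by (simp add: continuous_map_atin tendsto_divide)

lemma continuous_map_prod_algebra:
  fixes f :: "'a \<Rightarrow> 'i \<Rightarrow> 'b::{real_normed_algebra, comm_ring_1}"
  assumes "\<And>i. i \<in> I \<Longrightarrow> continuous_map X euclidean (\<lambda>x. f x i)"
  shows "continuous_map X euclidean (\<lambda>x. \<Prod>i\<in>I. f x i)"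
  using assms
  by (induction I rule: infinite_finite_induct) (auto intro: continuous_map_mult_algebra)

text \<open>Continuity is entrywise, on an arbitrary topology \<open>X\<close>, since the domains
  will be subspaces of quotients and of products; fixing the size excludes the values of
  \<open>$$\<close> out of range.\<close>

definition mat_continuous :: "'x topology \<Rightarrow> nat \<Rightarrow> ('x \<Rightarrow> complex mat) \<Rightarrow> bool" where
  "mat_continuous X r F \<longleftrightarrow> (\<forall>x\<in>topspace X. F x \<in> carrier_mat r r) \<and>
     (\<forall>a<r. \<forall>b<r. continuous_map X euclidean (\<lambda>x. F x $$ (a, b)))"

lemma mat_continuous_mult:
  assumes F: "mat_continuous X r F" and G: "mat_continuous X r G"
  shows "mat_continuous X r (\<lambda>x. F x * G x)"
proof -
  have "continuous_map X euclidean (\<lambda>x. (F x * G x) $$ (a, b))" if "a < r" "b < r" for a b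
  proof (rule continuous_map_eq)
    show "continuous_map X euclidean (\<lambda>x. \<Sum>c<r. F x $$ (a, c) * G x $$ (c, b))"
      using F G that
      by (intro continuous_map_sum continuous_map_mult_algebra) (auto simp: mat_continuous_def)
  qed (use F G that in \<open>auto simp: mat_continuous_def mat_mult_entry simp del: index_mult_mat\<close>)
  moreover have "F x * G x \<in> carrier_mat r r" if "x \<in> topspace X" for x
    using F G that by (intro mult_carrier_mat[of _ r r]) (auto simp: mat_continuous_def)
  ultimately show ?thesis by (auto simp: mat_continuous_def)
qed

lemma mat_continuous_const: "A \<in> carrier_mat r r \<Longrightarrow> mat_continuous X r (\<lambda>_. A)"
  by (simp add: mat_continuous_def)

lemma mat_continuous_compose:
  assumes "continuous_map X Y f" "mat_continuous Y r F"
  shows "mat_continuous X r (\<lambda>x. F (f x))"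
  unfolding mat_continuous_def
proof (intro conjI allI impI ballI)
  show "continuous_map X euclidean (\<lambda>x. F (f x) $$ (a, b))" if "a < r" "b < r" for a b
    using continuous_map_compose[OF assms(1), of euclidean "\<lambda>x. F x $$ (a, b)"] assms(2) that
    by (simp add: mat_continuous_def o_def)
qed (use assms continuous_map_funspace[OF assms(1)] in \<open>auto simp: mat_continuous_def\<close>)

lemma mat_continuous_det:
  assumes F: "mat_continuous X r F"
  shows "continuous_map X euclidean (\<lambda>x. Determinant.det (F x))"
proof (rule continuous_map_eq)
  show "continuous_map X euclidean
    (\<lambda>x. \<Sum>p\<in>{p. p permutes {0..<r}}. signof p * (\<Prod>i = 0..<r. F x $$ (i, p i)))"
  proof (intro continuous_map_sum continuous_map_mult_algebra continuous_map_prod_algebra)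
    fix p i assume "p \<in> {p. p permutes {0..<r}}" "i \<in> {0..<r}"
    then have "p i < r" using permutes_in_image[of p "{0..<r}" i] by auto
    then show "continuous_map X euclidean (\<lambda>x. F x $$ (i, p i))"
      using F \<open>i \<in> {0..<r}\<close> by (auto simp: mat_continuous_def)
  qed (auto intro: finite_permutations)
qed (use F in \<open>auto simp: mat_continuous_def intro: det_def'[symmetric]\<close>)

lemma mat_continuous_adj:
  assumes F: "mat_continuous X r F"
  shows "mat_continuous X r (\<lambda>x. adj_mat (F x))"
proof -
  have car: "F x \<in> carrier_mat r r" if "x \<in> topspace X" for x
    using F that by (auto simp: mat_continuous_def)
  have "continuous_map X euclidean (\<lambda>x. adj_mat (F x) $$ (a, b))" if ab: "a < r" "b < r" for a b
  proof (rule continuous_map_eq)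
    let ?D = "\<lambda>x. mat_delete (F x) b a"
    have "mat_continuous X (r - 1) ?D"
    proof -
      have "continuous_map X euclidean (\<lambda>x. ?D x $$ (c, d))" if cd: "c < r - 1" "d < r - 1" for c d
      proof (rule continuous_map_eq)
        show "continuous_map X euclidean
          (\<lambda>x. F x $$ (if c < b then c else Suc c, if d < a then d else Suc d))"
          using F ab cd by (auto simp: mat_continuous_def)
        show "F x $$ (if c < b then c else Suc c, if d < a then d else Suc d) = ?D x $$ (c, d)"
          if "x \<in> topspace X" for x
          using car[OF that] cd by (simp add: mat_delete_def)
      qed
      moreover have "?D x \<in> carrier_mat (r - 1) (r - 1)" if "x \<in> topspace X" for x
        using car[OF that] by (rule mat_delete_carrier)
      ultimately show ?thesis by (simp add: mat_continuous_def)
    qed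
    then show "continuous_map X euclidean (\<lambda>x. (-1) ^ (b + a) * Determinant.det (?D x))"
      by (intro continuous_map_mult_algebra mat_continuous_det) auto
    show "(-1) ^ (b + a) * Determinant.det (mat_delete (F x) b a) = adj_mat (F x) $$ (a, b)"
      if "x \<in> topspace X" for x
      using car[OF that] ab by (simp add: adj_mat_def cofactor_def)
  qed
  then show ?thesis using adj_mat(1)[OF car] by (simp add: mat_continuous_def)
qed

text \<open>Cramer's rule for the row equation \<open>x q = m\<close>. Its point is continuity: the
  solution is a quotient of expressions polynomial in \<open>q\<close> and \<open>m\<close>.\<close>

lemma cramer_row:
  fixes q :: "complex mat"
  assumes q: "q \<in> carrier_mat r r" "Determinant.det q \<noteq> 0"
    and eq: "\<And>b. b < r \<Longrightarrow> (\<Sum>c<r. x c * q $$ (c, b)) = m b" and d: "d < r"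
  shows "x d = (\<Sum>b<r. m b * adj_mat q $$ (b, d)) / Determinant.det q"
proof -
  have "(\<Sum>b<r. m b * adj_mat q $$ (b, d))
      = (\<Sum>b<r. \<Sum>c<r. x c * q $$ (c, b) * adj_mat q $$ (b, d))"
    by (intro sum.cong refl) (simp add: eq[symmetric] sum_distrib_right)
  also have "\<dots> = (\<Sum>c<r. \<Sum>b<r. x c * q $$ (c, b) * adj_mat q $$ (b, d))"
    by (rule sum.swap)
  also have "\<dots> = (\<Sum>c<r. x c * (q * adj_mat q) $$ (c, d))"
    using q adj_mat(1)[OF q(1)] d
    by (intro sum.cong) (auto simp: mat_mult_entry sum_distrib_left mult.assoc simp del: index_mult_mat)
  also have "\<dots> = (\<Sum>c<r. if c = d then x d * Determinant.det q else 0)"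
    using d unfolding adj_mat(2)[OF q(1)] by (intro sum.cong) auto
  also have "\<dots> = x d * Determinant.det q" using d by simp
  finally show ?thesis using q(2) by simp
qed

definition principal_block :: "nat \<Rightarrow> (nat \<Rightarrow> bool) \<Rightarrow> complex mat \<Rightarrow> complex mat" where
  "principal_block r S q =
     mat r r (\<lambda>(c, b). if S c \<and> S b then q $$ (c, b) else if c = b then 1 else 0)"

lemma principal_block_carrier [simp]: "principal_block r S q \<in> carrier_mat r r"
  by (simp add: principal_block_def)

text \<open>The hypothesis says that \<open>q\<close> preserves the span of the coordinates in
  \<open>S\<close>. A kernel vector of the padded block vanishes outside \<open>S\<close>, hence is
  a kernel vector of \<open>q\<close>.\<close>

lemma det_principal_block:
  assumes q: "q \<in> carrier (GL r)"
    and q0: "\<And>c b. c < r \<Longrightarrow> b < r \<Longrightarrow> \<not> S c \<Longrightarrow> S b \<Longrightarrow> q $$ (c, b) = 0"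
  shows "Determinant.det (principal_block r S q) \<noteq> 0"
proof
  let ?B = "principal_block r S q"
  assume "Determinant.det ?B = 0"
  then obtain v where v: "v \<in> carrier_vec r" "v \<noteq> 0\<^sub>v r" "?B *\<^sub>v v = 0\<^sub>v r"
    using det_0_iff_vec_prod_zero_field[of ?B r] by auto
  note qm = GL_carrier_mat[OF q]
  have Bv: "(\<Sum>c<r. ?B $$ (a, c) * v $ c) = 0" if "a < r" for a
  proof -
    have "(?B *\<^sub>v v) $ a = (\<Sum>c<r. ?B $$ (a, c) * v $ c)"
      using v(1) that by (intro mult_mat_vec_entry) auto
    then show ?thesis using v(3) that by simp
  qed
  have v0: "v $ a = 0" if "a < r" "\<not> S a" for a
  proof -
    have "(\<Sum>c<r. ?B $$ (a, c) * v $ c) = (\<Sum>c<r. if c = a then v $ a else 0)"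
      using that by (intro sum.cong) (auto simp: principal_block_def)
    then show ?thesis using Bv[OF that(1)] that by simp
  qed
  have "(q *\<^sub>v v) $ a = 0" if a: "a < r" for a
  proof -
    have "(q *\<^sub>v v) $ a = (\<Sum>c<r. q $$ (a, c) * v $ c)"
      by (rule mult_mat_vec_entry[OF qm v(1) a])
    also have "\<dots> = (\<Sum>c<r. if S a then ?B $$ (a, c) * v $ c else 0)"
      using a v0 q0 by (intro sum.cong refl) (auto simp: principal_block_def)
    also have "\<dots> = 0" using Bv[OF a] by (cases "S a") auto
    finally show ?thesis .
  qed
  then have "q *\<^sub>v v = 0\<^sub>v r" using qm by (intro eq_vecI) auto
  then have "Determinant.det q = 0"
    using det_0_iff_vec_prod_zero_field[OF qm] v by blast
  then show False using q by (simp add: carrier_GL_iff)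
qed

text \<open>Continuity of both block LU factors, row by row in increasing grade. In columns of
  smaller grade row \<open>a\<close> of \<open>q\<close> vanishes, so the unknown part of row
  \<open>a\<close> of \<open>A\<close> solves a linear system whose matrix is the smaller-grade
  block of \<open>q\<close>, invertible and already continuous. Row \<open>a\<close> of
  \<open>q\<close> is then recovered by subtraction.\<close>

lemma factor_continuous:
  assumes A: "\<And>x. x \<in> topspace X \<Longrightarrow> A x \<in> unip r \<gamma>"
    and q: "\<And>x. x \<in> topspace X \<Longrightarrow> q x \<in> carrier (GL r)"
    and q0: "\<And>x a b. x \<in> topspace X \<Longrightarrow> a < r \<Longrightarrow> b < r \<Longrightarrow> \<gamma> b < \<gamma> a \<Longrightarrow> q x $$ (a, b) = 0"
    and cont: "mat_continuous X r (\<lambda>x. A x * q x)"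
  shows "mat_continuous X r A"
proof -
  let ?M = "\<lambda>x. A x * q x"
  have Am: "A x \<in> carrier_mat r r" and qm: "q x \<in> carrier_mat r r" if "x \<in> topspace X" for x
    using A[OF that] q[OF that] by (auto simp: unip_def carrier_GL_iff)
  have Mc: "continuous_map X euclidean (\<lambda>x. ?M x $$ (a, b))" if "a < r" "b < r" for a b
    using cont that by (simp add: mat_continuous_def del: index_mult_mat)
  have M: "?M x $$ (a, b) = q x $$ (a, b) + (\<Sum>c | c < r \<and> \<gamma> c < \<gamma> a. A x $$ (a, c) * q x $$ (c, b))"
    if "x \<in> topspace X" "a < r" "b < r" for x a b
    by (rule unip_mult_entry[OF A qm]) (use that in auto)
  have "\<forall>b<r. continuous_map X euclidean (\<lambda>x. A x $$ (a, b)) \<and>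
         continuous_map X euclidean (\<lambda>x. q x $$ (a, b))" if "a < r" for a
    using that
  proof (induction "\<gamma> a" arbitrary: a rule: less_induct)
    case less
    note a = \<open>a < r\<close>
    let ?S = "\<lambda>c. \<gamma> c < \<gamma> a"
    let ?q = "\<lambda>x. principal_block r ?S (q x)"
    let ?m = "\<lambda>x b. if ?S b then ?M x $$ (a, b) else 0"
    have IH: "continuous_map X euclidean (\<lambda>x. A x $$ (c, b))"
        "continuous_map X euclidean (\<lambda>x. q x $$ (c, b))" if "c < r" "?S c" "b < r" for c b
      using less.hyps[of c] that by auto
    have det: "Determinant.det (?q x) \<noteq> 0" if "x \<in> topspace X" for x
      using q0[OF that] by (intro det_principal_block q that) auto
    have qc: "mat_continuous X r ?q"
      using IH(2) unfolding mat_continuous_def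
      by (auto simp: principal_block_def intro: continuous_map_eq)
    have sol: "A x $$ (a, d) = (\<Sum>b<r. ?m x b * adj_mat (?q x) $$ (b, d)) / Determinant.det (?q x)"
      if x: "x \<in> topspace X" and d: "d < r" "?S d" for x d
    proof -
      have "(\<Sum>c<r. (if ?S c then A x $$ (a, c) else 0) * ?q x $$ (c, b)) = ?m x b" if b: "b < r" for b
      proof (cases "?S b")
        case True
        have "(\<Sum>c<r. (if ?S c then A x $$ (a, c) else 0) * ?q x $$ (c, b))
           = (\<Sum>c | c < r \<and> ?S c. A x $$ (a, c) * q x $$ (c, b))"
          using True b by (intro sum.mono_neutral_cong_right) (auto simp: principal_block_def)
        then show ?thesis using True M[OF x a b] q0[OF x a b] by simp
      next
        case False
        then show ?thesis using b by (auto simp: principal_block_def intro!: sum.neutral)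
      qed
      from cramer_row[OF _ det[OF x] this d(1)] show ?thesis using d by simp
    qed
    have Ac: "continuous_map X euclidean (\<lambda>x. A x $$ (a, d))" if d: "d < r" for d
    proof (cases "?S d")
      case True
      show ?thesis
      proof (rule continuous_map_eq)
        show "continuous_map X euclidean
          (\<lambda>x. (\<Sum>b<r. ?m x b * adj_mat (?q x) $$ (b, d)) / Determinant.det (?q x))"
        proof (intro continuous_map_divide_field continuous_map_sum continuous_map_mult_algebra
            mat_continuous_det[OF qc] det)
          fix b assume b: "b \<in> {..<r}"
          show "continuous_map X euclidean (\<lambda>x. adj_mat (?q x) $$ (b, d))"
            using mat_continuous_adj[OF qc] b d by (simp add: mat_continuous_def)
          show "continuous_map X euclidean (\<lambda>x. ?m x b)"
            using Mc[OF a, of b] b by (cases "?S b") auto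
        qed auto
      qed (use sol d True in auto)
    next
      case False
      show ?thesis
        by (rule continuous_map_eq[of _ _ "\<lambda>_. if a = d then 1 else 0"])
          (use unip_entry[OF A a d] False in auto)
    qed
    have "continuous_map X euclidean (\<lambda>x. q x $$ (a, b))" if b: "b < r" for b
    proof (rule continuous_map_eq)
      show "continuous_map X euclidean
        (\<lambda>x. ?M x $$ (a, b) - (\<Sum>c | c < r \<and> ?S c. A x $$ (a, c) * q x $$ (c, b)))"
        using IH(2) Ac b
        by (intro continuous_map_diff Mc[OF a b] continuous_map_sum continuous_map_mult_algebra) auto
    qed (use M a b in auto)
    then show ?case using Ac by blast
  qed
  then show ?thesis using Am by (auto simp: mat_continuous_def)
qed

section \<open>The topology of flag manifolds\<close>

lemma topspace_GL_top: "topspace (GL_top r) = carrier (GL r)"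
  by (auto simp: GL_top_def topspace_pullback_topology)

lemma continuous_map_GL_top:
  "continuous_map X (GL_top r) F \<longleftrightarrow>
     F \<in> topspace X \<rightarrow> carrier (GL r) \<and> mat_continuous X r F"
proof
  assume F: "continuous_map X (GL_top r) F"
  then have 1: "F \<in> topspace X \<rightarrow> carrier (GL r)"
    by (auto simp: continuous_map_def topspace_GL_top)
  have "continuous_map X euclidean (\<lambda>x. F x $$ (a, b))" if "a < r" "b < r" for a b
  proof -
    have "continuous_map (GL_top r) (product_topology (\<lambda>_. euclidean) ({..<r} \<times> {..<r}))
        (\<lambda>A. \<lambda>x \<in> {..<r} \<times> {..<r}. A $$ x)"
      unfolding GL_top_def
      using continuous_map_pullback[OF continuous_map_id, of "carrier (GL r)"
        "\<lambda>A. \<lambda>x \<in> {..<r} \<times> {..<r}. A $$ x"] by (simp add: o_def)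
    from continuous_map_compose[OF F this]
    have "continuous_map X (product_topology (\<lambda>_. euclidean) ({..<r} \<times> {..<r}))
        (\<lambda>y. \<lambda>x \<in> {..<r} \<times> {..<r}. F y $$ x)" by (simp add: o_def)
    then show ?thesis
      using that unfolding continuous_map_componentwise by auto
  qed
  with 1 show "F \<in> topspace X \<rightarrow> carrier (GL r) \<and> mat_continuous X r F"
    by (auto simp: mat_continuous_def intro: GL_carrier_mat)
next
  assume F: "F \<in> topspace X \<rightarrow> carrier (GL r) \<and> mat_continuous X r F"
  show "continuous_map X (GL_top r) F"
    unfolding GL_top_def
  proof (rule continuous_map_pullback')
    show "continuous_map X (product_topology (\<lambda>_. euclidean) ({..<r} \<times> {..<r}))
       ((\<lambda>A. \<lambda>x \<in> {..<r} \<times> {..<r}. A $$ x) \<circ> F)"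
      unfolding continuous_map_componentwise using F by (auto simp: mat_continuous_def)
  qed (use F in auto)
qed

lemma mat_continuous_id_GL: "mat_continuous (GL_top r) r (\<lambda>A. A)"
  using continuous_map_GL_top[of "GL_top r" r "\<lambda>A. A"] by simp

lemma continuous_map_GL_right_mult:
  assumes "h \<in> carrier (GL r)"
  shows "continuous_map (GL_top r) (GL_top r) (\<lambda>A. A * h)"
  unfolding continuous_map_GL_top topspace_GL_top
  using assms mat_continuous_mult[OF mat_continuous_id_GL mat_continuous_const, of h r]
  by (auto intro: GL_mult_closed GL_carrier_mat)

section \<open>Parabolic subgroups and their cosets\<close>

lemma subgroup_parabolic: "subgroup (parabolic p) (GL (sum_list p))"
proof -
  let ?r = "sum_list p"
  interpret G: group "GL ?r" by (rule group_GL)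
  show ?thesis
  proof (rule G.subgroupI)
    show "parabolic p \<subseteq> carrier (GL ?r)" by (auto simp: parabolic_def)
    have "1\<^sub>m ?r \<in> parabolic p"
      using G.one_closed by (auto simp: parabolic_def)
    then show "parabolic p \<noteq> {}" by auto
  next
    fix A B assume A: "A \<in> parabolic p" and B: "B \<in> parabolic p"
    have "(A * B) $$ (a, b) = 0" if ab: "a < ?r" "b < ?r" "blk p a < blk p b" for a b
    proof -
      have "(A * B) $$ (a, b) = (\<Sum>c<?r. A $$ (a, c) * B $$ (c, b))"
        using A B ab by (intro mat_mult_entry GL_carrier_mat) (auto simp: parabolic_def)
      also have "\<dots> = 0"
      proof (intro sum.neutral ballI)
        fix c assume "c \<in> {..<?r}"
        then show "A $$ (a, c) * B $$ (c, b) = 0"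
          using A B ab by (cases "blk p a < blk p c") (auto simp: parabolic_def)
      qed
      finally show ?thesis .
    qed
    then show "A \<otimes>\<^bsub>GL ?r\<^esub> B \<in> parabolic p"
      using A B by (auto simp: parabolic_def GL_mult_closed simp del: index_mult_mat)
  next
    fix A assume A: "A \<in> parabolic p"
    then have AG: "A \<in> carrier (GL ?r)" by (simp add: parabolic_def)
    define B where "B = inv\<^bsub>GL ?r\<^esub> A"
    have B: "B \<in> carrier (GL ?r)" "B * A = 1\<^sub>m ?r"
      unfolding B_def using AG G.l_inv[OF AG] by auto
    have "B $$ (a, d) = 0" if ad: "a < ?r" "d < ?r" "blk p a < blk p d" for a d
    proof -
      \<comment> \<open>The entries of row \<open>a\<close> of the inverse in the later blocks solve
        a homogeneous system: the entries of \<open>B * A = 1\<close> in these columns are 0. Its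
        matrix is an invertible principal block of \<open>A\<close>, so they vanish.\<close>
      let ?S = "\<lambda>c. blk p a < blk p c"
      let ?x = "\<lambda>c. if ?S c then B $$ (a, c) else 0"
      have "(\<Sum>c<?r. ?x c * principal_block ?r ?S A $$ (c, b)) = 0" if b: "b < ?r" for b
      proof (cases "?S b")
        case True
        have "(\<Sum>c<?r. ?x c * principal_block ?r ?S A $$ (c, b)) = (\<Sum>c<?r. B $$ (a, c) * A $$ (c, b))"
          using A b True by (intro sum.cong) (auto simp: principal_block_def parabolic_def)
        also have "\<dots> = (B * A) $$ (a, b)"
          by (rule mat_mult_entry[symmetric]) (use AG B ad b in \<open>auto intro: GL_carrier_mat\<close>)
        finally show ?thesis using B ad b True by auto
      next
        case False
        then show ?thesis using b by (auto simp: principal_block_def intro!: sum.neutral)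
      qed
      from cramer_row[OF _ det_principal_block[OF AG] this ad(2)]
      show ?thesis using ad A by (auto simp: parabolic_def)
    qed
    then show "inv\<^bsub>GL ?r\<^esub> A \<in> parabolic p" using B by (simp add: parabolic_def B_def)
  qed
qed

lemma parabolic_GL: "h \<in> parabolic p \<Longrightarrow> h \<in> carrier (GL (sum_list p))"
  by (simp add: parabolic_def)

lemma flag_eq_iff:
  assumes "r = sum_list p" "A \<in> carrier (GL r)" "B \<in> carrier (GL r)"
  shows "A <#\<^bsub>GL r\<^esub> parabolic p = B <#\<^bsub>GL r\<^esub> parabolic p \<longleftrightarrow> (\<exists>h\<in>parabolic p. A = B * h)"
proof
  interpret G: group "GL r" by (rule group_GL)
  have sub: "subgroup (parabolic p) (GL r)" using subgroup_parabolic assms by simp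
  assume "A <#\<^bsub>GL r\<^esub> parabolic p = B <#\<^bsub>GL r\<^esub> parabolic p"
  moreover have "A \<in> A <#\<^bsub>GL r\<^esub> parabolic p"
    using subgroup.one_closed[OF sub] GL_carrier_mat[OF assms(2)]
    by (auto simp: l_coset_def intro!: bexI[of _ "1\<^sub>m r"])
  ultimately show "\<exists>h\<in>parabolic p. A = B * h" by (auto simp: l_coset_def)
next
  interpret G: group "GL r" by (rule group_GL)
  have sub: "subgroup (parabolic p) (GL r)" using subgroup_parabolic assms by simp
  assume "\<exists>h\<in>parabolic p. A = B * h"
  then have "A \<in> B <#\<^bsub>GL r\<^esub> parabolic p" by (auto simp: l_coset_def)
  from G.l_repr_independence[OF this assms(3) sub]
  show "A <#\<^bsub>GL r\<^esub> parabolic p = B <#\<^bsub>GL r\<^esub> parabolic p" by simp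
qed

lemma flag_mult:
  assumes "r = sum_list p" "A \<in> carrier (GL r)" "B \<in> carrier (GL r)"
  shows "A <#\<^bsub>GL r\<^esub> (B <#\<^bsub>GL r\<^esub> parabolic p) = (A * B) <#\<^bsub>GL r\<^esub> parabolic p"
  using group.lcos_m_assoc[OF group_GL _ assms(2,3), of "parabolic p"] assms(1) parabolic_GL by auto

text \<open>\<open>topology\<close> returns the family it is given only if this family is a
  topology, so the axioms are checked here, on preimages in the general linear group.\<close>

lemma openin_flag_top:
  "openin (flag_top p) U \<longleftrightarrow> U \<subseteq> flags p \<and> openin (GL_top (sum_list p))
       {A \<in> carrier (GL (sum_list p)). A <#\<^bsub>GL (sum_list p)\<^esub> parabolic p \<in> U}"
proof -
  have "istopology (\<lambda>U. U \<subseteq> flags p \<and> openin (GL_top (sum_list p))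
       {A \<in> carrier (GL (sum_list p)). A <#\<^bsub>GL (sum_list p)\<^esub> parabolic p \<in> U})"
    unfolding istopology_def
  proof (intro conjI allI impI)
    fix S T
    assume "S \<subseteq> flags p \<and> openin (GL_top (sum_list p))
       {A \<in> carrier (GL (sum_list p)). A <#\<^bsub>GL (sum_list p)\<^esub> parabolic p \<in> S}"
     "T \<subseteq> flags p \<and> openin (GL_top (sum_list p))
       {A \<in> carrier (GL (sum_list p)). A <#\<^bsub>GL (sum_list p)\<^esub> parabolic p \<in> T}"
    then have "openin (GL_top (sum_list p))
       ({A \<in> carrier (GL (sum_list p)). A <#\<^bsub>GL (sum_list p)\<^esub> parabolic p \<in> S} \<inter>
        {A \<in> carrier (GL (sum_list p)). A <#\<^bsub>GL (sum_list p)\<^esub> parabolic p \<in> T})"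
      by (intro openin_Int) auto
    moreover have "({A \<in> carrier (GL (sum_list p)). A <#\<^bsub>GL (sum_list p)\<^esub> parabolic p \<in> S} \<inter>
        {A \<in> carrier (GL (sum_list p)). A <#\<^bsub>GL (sum_list p)\<^esub> parabolic p \<in> T})
      = {A \<in> carrier (GL (sum_list p)). A <#\<^bsub>GL (sum_list p)\<^esub> parabolic p \<in> S \<inter> T}" by auto
    ultimately show "openin (GL_top (sum_list p))
       {A \<in> carrier (GL (sum_list p)). A <#\<^bsub>GL (sum_list p)\<^esub> parabolic p \<in> S \<inter> T}" by simp
  next
    fix K
    assume "\<forall>S\<in>K. S \<subseteq> flags p \<and> openin (GL_top (sum_list p))
       {A \<in> carrier (GL (sum_list p)). A <#\<^bsub>GL (sum_list p)\<^esub> parabolic p \<in> S}"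
    then have "openin (GL_top (sum_list p))
       (\<Union>S\<in>K. {A \<in> carrier (GL (sum_list p)). A <#\<^bsub>GL (sum_list p)\<^esub> parabolic p \<in> S})"
      by (intro openin_clauses) auto
    moreover have "(\<Union>S\<in>K. {A \<in> carrier (GL (sum_list p)). A <#\<^bsub>GL (sum_list p)\<^esub> parabolic p \<in> S})
      = {A \<in> carrier (GL (sum_list p)). A <#\<^bsub>GL (sum_list p)\<^esub> parabolic p \<in> \<Union>K}" by auto
    ultimately show "openin (GL_top (sum_list p))
       {A \<in> carrier (GL (sum_list p)). A <#\<^bsub>GL (sum_list p)\<^esub> parabolic p \<in> \<Union>K}" by simp
  qed auto
  from topology_inverse'[OF this] show ?thesis unfolding flag_top_def by simp
qed

lemma topspace_flag_top: "topspace (flag_top p) = flags p"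
proof
  show "topspace (flag_top p) \<subseteq> flags p"
    using openin_topspace openin_flag_top by blast
  have "{A \<in> carrier (GL (sum_list p)). A <#\<^bsub>GL (sum_list p)\<^esub> parabolic p \<in> flags p} =
     topspace (GL_top (sum_list p))"
    by (auto simp: flags_def topspace_GL_top)
  then have "openin (flag_top p) (flags p)"
    unfolding openin_flag_top by simp
  then show "flags p \<subseteq> topspace (flag_top p)" by (rule openin_subset)
qed

lemma continuous_map_flag_proj:
  assumes "r = sum_list p"
  shows "continuous_map (GL_top r) (flag_top p) (\<lambda>A. A <#\<^bsub>GL r\<^esub> parabolic p)"
  unfolding continuous_map_def topspace_GL_top topspace_flag_top openin_flag_top
  using assms by (auto simp: flags_def)

text \<open>The saturation of an open set is a union of preimages under right translations by
  parabolic elements, hence open. Openness is wanted because, unlike the quotient property, it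
  passes to the restriction over any subset, such as a Bruhat cell.\<close>

lemma open_map_flag_proj:
  assumes r: "r = sum_list p"
  shows "open_map (GL_top r) (flag_top p) (\<lambda>A. A <#\<^bsub>GL r\<^esub> parabolic p)"
  unfolding open_map_def
proof (intro allI impI)
  fix U assume U: "openin (GL_top r) U"
  let ?pr = "\<lambda>A. A <#\<^bsub>GL r\<^esub> parabolic p"
  have UG: "U \<subseteq> carrier (GL r)" using openin_subset[OF U] by (simp add: topspace_GL_top)
  have "{A \<in> carrier (GL r). ?pr A \<in> ?pr ` U}
    = (\<Union>h\<in>parabolic p. {A \<in> topspace (GL_top r). A * h \<in> U})"
  proof (intro equalityI subsetI)
    fix A assume "A \<in> {A \<in> carrier (GL r). ?pr A \<in> ?pr ` U}"
    then obtain B where AB: "A \<in> carrier (GL r)" "B \<in> U" "?pr B = ?pr A" by auto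
    then obtain h where "h \<in> parabolic p" "B = A * h"
      using flag_eq_iff[OF r, of B A] UG by auto
    with AB show "A \<in> (\<Union>h\<in>parabolic p. {A \<in> topspace (GL_top r). A * h \<in> U})"
      by (auto simp: topspace_GL_top)
  next
    fix A assume "A \<in> (\<Union>h\<in>parabolic p. {A \<in> topspace (GL_top r). A * h \<in> U})"
    then obtain h where h: "h \<in> parabolic p" "A \<in> carrier (GL r)" "A * h \<in> U"
      by (auto simp: topspace_GL_top)
    then have "?pr (A * h) = ?pr A"
      using flag_eq_iff[OF r, of "A * h" A] UG by auto
    with h show "A \<in> {A \<in> carrier (GL r). ?pr A \<in> ?pr ` U}" by (auto intro: rev_image_eqI)
  qed
  moreover have "openin (GL_top r) (\<Union>h\<in>parabolic p. {A \<in> topspace (GL_top r). A * h \<in> U})"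
    using r U parabolic_GL
    by (intro openin_clauses) (auto intro!: openin_continuous_map_preimage[OF continuous_map_GL_right_mult])
  ultimately show "openin (flag_top p) (?pr ` U)"
    unfolding openin_flag_top using r UG by (auto simp: flags_def)
qed

section \<open>Coordinates on Bruhat cells\<close>

lemma mat_continuous_eq:
  assumes "mat_continuous X r F" "\<And>x. x \<in> topspace X \<Longrightarrow> F x = G x"
  shows "mat_continuous X r G"
  unfolding mat_continuous_def
proof (intro conjI allI impI ballI)
  show "continuous_map X euclidean (\<lambda>x. G x $$ (a, b))" if "a < r" "b < r" for a b
    by (rule continuous_map_eq[of _ _ "\<lambda>x. F x $$ (a, b)"])
      (use assms that in \<open>auto simp: mat_continuous_def\<close>)
qed (use assms in \<open>auto simp: mat_continuous_def\<close>)

lemma square_mult_closed [simp, intro]: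
  "A \<in> carrier_mat r r \<Longrightarrow> B \<in> carrier_mat r r \<Longrightarrow> A * B \<in> carrier_mat r r"
  by (rule mult_carrier_mat)

lemma square_mult_assoc:
  "A \<in> carrier_mat r r \<Longrightarrow> B \<in> carrier_mat r r \<Longrightarrow> C \<in> carrier_mat r r \<Longrightarrow> A * B * C = A * (B * C)"
  by (rule assoc_mult_mat)

lemma perm_mat_carrier [simp]: "perm_mat r \<sigma> \<in> carrier_mat r r"
  by (simp add: perm_mat_def)

lemma mult_perm_mat_entry:
  assumes "A \<in> carrier_mat r r" "a < r" "b < r" "\<sigma> b < r"
  shows "(A * perm_mat r \<sigma>) $$ (a, b) = A $$ (a, \<sigma> b)"
proof -
  have "(A * perm_mat r \<sigma>) $$ (a, b) = (\<Sum>c<r. A $$ (a, c) * perm_mat r \<sigma> $$ (c, b))"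
    using assms by (intro mat_mult_entry) auto
  also have "\<dots> = (\<Sum>c<r. if c = \<sigma> b then A $$ (a, \<sigma> b) else 0)"
    using assms by (intro sum.cong) (auto simp: perm_mat_def)
  also have "\<dots> = A $$ (a, \<sigma> b)" using assms by simp
  finally show ?thesis .
qed

text \<open>The inverse is an explicit parameter, so that computations with block numbers use a
  formula and not \<open>inv_into\<close>.\<close>

locale permutation_pair =
  fixes r :: nat and \<sigma> \<sigma>' :: "nat \<Rightarrow> nat"
  assumes perm: "\<And>a. a < r \<Longrightarrow> \<sigma> a < r" "\<And>a. a < r \<Longrightarrow> \<sigma>' a < r"
    "\<And>a. a < r \<Longrightarrow> \<sigma> (\<sigma>' a) = a" "\<And>a. a < r \<Longrightarrow> \<sigma>' (\<sigma> a) = a"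
begin

lemma perm_mat_mult_entry:
  assumes "A \<in> carrier_mat r r" "a < r" "b < r"
  shows "(perm_mat r \<sigma> * A) $$ (a, b) = A $$ (\<sigma>' a, b)"
proof -
  have "(perm_mat r \<sigma> * A) $$ (a, b) = (\<Sum>c<r. perm_mat r \<sigma> $$ (a, c) * A $$ (c, b))"
    using assms by (intro mat_mult_entry) auto
  also have "\<dots> = (\<Sum>c<r. if c = \<sigma>' a then A $$ (\<sigma>' a, b) else 0)"
    using assms perm by (intro sum.cong) (auto simp: perm_mat_def)
  also have "\<dots> = A $$ (\<sigma>' a, b)" using assms perm by simp
  finally show ?thesis .
qed

lemma perm_mat_inverse: "perm_mat r \<sigma> * perm_mat r \<sigma>' = 1\<^sub>m r"
proof (rule eq_matI)
  fix a b assume "a < dim_row (1\<^sub>m r :: complex mat)" "b < dim_col (1\<^sub>m r :: complex mat)"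
  then have ab: "a < r" "b < r" by auto
  have "(perm_mat r \<sigma> * perm_mat r \<sigma>') $$ (a, b) = perm_mat r \<sigma>' $$ (\<sigma>' a, b)"
    using ab by (intro perm_mat_mult_entry) auto
  also have "\<dots> = (if a = b then 1 else 0)"
  proof -
    have "\<sigma>' a = \<sigma>' b \<longleftrightarrow> a = b" using perm(3) ab by metis
    then show ?thesis using ab perm(2)[of a] by (simp add: perm_mat_def)
  qed
  finally show "(perm_mat r \<sigma> * perm_mat r \<sigma>') $$ (a, b) = 1\<^sub>m r $$ (a, b)" using ab by simp
qed (auto simp: perm_mat_def)

lemma perm_mat_GL: "perm_mat r \<sigma> \<in> carrier (GL r)"
proof -
  have "Determinant.det (perm_mat r \<sigma>) * Determinant.det (perm_mat r \<sigma>') = 1"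
    using det_mult[of "perm_mat r \<sigma>" r "perm_mat r \<sigma>'"] by (simp add: perm_mat_inverse)
  then show ?thesis by (auto simp: carrier_GL_iff)
qed

lemma swap: "permutation_pair r \<sigma>' \<sigma>"
  using perm by unfold_locales auto

lemma conj_entry:
  assumes "A \<in> carrier_mat r r" "a < r" "b < r"
  shows "(perm_mat r \<sigma> * A * perm_mat r \<sigma>') $$ (a, b) = A $$ (\<sigma>' a, \<sigma>' b)"
  using assms perm mult_perm_mat_entry[of "perm_mat r \<sigma> * A" r a b \<sigma>']
    perm_mat_mult_entry[of A a "\<sigma>' b"] mult_carrier_mat[OF perm_mat_carrier assms(1)] by auto

end

text \<open>The two block conditions compare the parabolic group, conjugated by the permutation,
  with the gradings: by \<open>blk_less\<close> the conjugate vanishes below the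
  \<open>\<gamma>\<close>-diagonal, and by \<open>blk_lessD\<close> it contains the Levi part of
  every \<open>\<beta>\<close>-unipotent matrix.\<close>

locale bruhat_data = graded r \<beta> \<gamma> + permutation_pair r \<sigma> \<sigma>'
  for r \<beta> \<gamma> \<sigma> \<sigma>' +
  fixes p :: "nat list"
  assumes r_eq: "r = sum_list p"
    and bruhat_group_eq: "bruhat_group p \<sigma> = unip r \<gamma>"
    and blk_less: "\<And>a b. a < r \<Longrightarrow> b < r \<Longrightarrow> \<gamma> b < \<gamma> a \<Longrightarrow> blk p (\<sigma>' a) < blk p (\<sigma>' b)"
    and blk_lessD: "\<And>a b. a < r \<Longrightarrow> b < r \<Longrightarrow> blk p (\<sigma>' a) < blk p (\<sigma>' b) \<Longrightarrow> \<gamma> b < \<gamma> a \<or> \<beta> a < \<beta> b"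
begin

abbreviation Pm where "Pm \<equiv> perm_mat r \<sigma>"
abbreviation Pm' where "Pm' \<equiv> perm_mat r \<sigma>'"

lemma Pm_inv: "Pm * Pm' = 1\<^sub>m r" "Pm' * Pm = 1\<^sub>m r"
  using perm_mat_inverse permutation_pair.perm_mat_inverse[OF swap] by auto

lemma Pm'_GL: "Pm' \<in> carrier (GL r)"
  by (rule permutation_pair.perm_mat_GL[OF swap])

definition flag_of :: "complex mat \<Rightarrow> complex mat set" where
  "flag_of A = (A * Pm) <#\<^bsub>GL r\<^esub> parabolic p"

lemma bruhat_cell_eq: "bruhat_cell p \<sigma> = flag_of ` unip r \<gamma>"
  by (simp add: bruhat_cell_def flag_of_def bruhat_group_eq r_eq[symmetric])

lemma parabolic_conj:
  assumes h: "h \<in> parabolic p"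
  shows "Pm * h * Pm' \<in> carrier (GL r)"
    and "a < r \<Longrightarrow> b < r \<Longrightarrow> \<gamma> b < \<gamma> a \<Longrightarrow> (Pm * h * Pm') $$ (a, b) = 0"
proof -
  have hG: "h \<in> carrier (GL r)" using parabolic_GL[OF h] r_eq by simp
  then show "Pm * h * Pm' \<in> carrier (GL r)"
    by (intro GL_mult_closed perm_mat_GL Pm'_GL)
  show "(Pm * h * Pm') $$ (a, b) = 0" if "a < r" "b < r" "\<gamma> b < \<gamma> a"
    using conj_entry[OF GL_carrier_mat[OF hG] that(1,2)] h blk_less[OF that] perm that
    by (simp add: parabolic_def r_eq del: index_mult_mat)
qed

lemma levi_conj:
  assumes g: "g \<in> unip r \<beta>"
  shows "Pm' * levi r \<gamma> g * Pm \<in> parabolic p"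
proof -
  have L: "levi r \<gamma> g \<in> unip r \<beta>" using g by (rule levi_unip)
  have "(Pm' * levi r \<gamma> g * Pm) $$ (a, b) = 0"
    if ab: "a < r" "b < r" "blk p a < blk p b" for a b
  proof -
    have "(Pm' * levi r \<gamma> g * Pm) $$ (a, b) = levi r \<gamma> g $$ (\<sigma> a, \<sigma> b)"
      using permutation_pair.conj_entry[OF swap unip_carrier_mat[OF L] ab(1,2)] .
    also have "\<dots> = 0"
      using blk_lessD[of "\<sigma> a" "\<sigma> b"] ab perm unip_entry[OF g, of "\<sigma> a" "\<sigma> b"]
      by (auto simp: levi_def)
    finally show ?thesis .
  qed
  moreover have "Pm' * levi r \<gamma> g * Pm \<in> carrier (GL r)"
    using unip_GL[OF L] by (intro GL_mult_closed perm_mat_GL Pm'_GL)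
  ultimately show ?thesis by (simp add: parabolic_def r_eq)
qed

lemma factor_GL:
  assumes A: "A \<in> carrier_mat r r" and B: "B \<in> carrier_mat r r" and h: "h \<in> carrier_mat r r"
  shows "A = B * Pm * h \<longleftrightarrow> A * Pm' = B * (Pm * h * Pm')"
proof -
  have 1: "B * (Pm * h * Pm') = B * Pm * h * Pm'"
    using B h by (simp add: square_mult_assoc[where r = r])
  have 2: "A * Pm' * Pm = A" "B * Pm * h * Pm' * Pm = B * Pm * h"
    using A B h by (simp_all add: square_mult_assoc[where r = r] Pm_inv)
  show ?thesis using 1 2 by metis
qed

text \<open>Two parameters of the same flag differ by a factor from the conjugated parabolic group,
  which is block upper triangular for \<open>\<gamma>\<close>; uniqueness of the factorization makes
  them equal.\<close>

lemma flag_of_inj: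
  assumes A: "A \<in> unip r \<gamma>" and A': "A' \<in> unip r \<gamma>" and eq: "flag_of A = flag_of A'"
  shows "A = A'"
proof -
  note c = unip_carrier_mat[OF A] unip_carrier_mat[OF A']
  obtain h where h: "h \<in> parabolic p" "A * Pm = A' * Pm * h"
    using eq flag_eq_iff[OF r_eq, of "A * Pm" "A' * Pm"] A A'
    by (auto simp: flag_of_def unip_GL perm_mat_GL GL_mult_closed)
  have hm: "h \<in> carrier_mat r r" using parabolic_GL[OF h(1)] r_eq by (simp add: carrier_GL_iff)
  have "A * Pm * Pm' = A' * (Pm * h * Pm')"
    using factor_GL[OF square_mult_closed[OF c(1) perm_mat_carrier] c(2) hm] h(2) by blast
  then have "A = A' * (Pm * h * Pm')"
    using c by (simp add: assoc_mult_mat[of A r r Pm r Pm' r] Pm_inv)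
  then show ?thesis
    using unip_unique_factor[OF A A' GL_carrier_mat[OF parabolic_conj(1)[OF h(1)]] parabolic_conj(2)[OF h(1)]]
    by blast
qed

lemma act_flag_of_levi:
  assumes g: "g \<in> unip r \<beta>" and A: "A \<in> unip r \<gamma>" and A': "A' \<in> unip r \<gamma>"
    and eq: "g * A = A' * levi r \<gamma> g"
  shows "g <#\<^bsub>GL r\<^esub> flag_of A = flag_of A'"
proof -
  let ?L = "levi r \<gamma> g"
  note c = unip_carrier_mat[OF A] unip_carrier_mat[OF A'] unip_carrier_mat[OF g]
    unip_carrier_mat[OF levi_unip[OF g]]
  have "g * (A * Pm) = A' * ?L * Pm"
    using c eq square_mult_assoc[of g r A Pm] by simp
  \<comment> \<open>Inserting \<open>Pm * Pm'\<close> carries the Levi part past the permutation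
    into the parabolic group, where the coset absorbs it.\<close>
  also have "\<dots> = A' * (Pm * Pm') * ?L * Pm" using c by (simp add: Pm_inv)
  also have "\<dots> = A' * Pm * (Pm' * ?L * Pm)"
    using c by (simp add: square_mult_assoc[where r = r])
  finally have "g * (A * Pm) = A' * Pm * (Pm' * ?L * Pm)" .
  then have "(g * (A * Pm)) <#\<^bsub>GL r\<^esub> parabolic p = (A' * Pm) <#\<^bsub>GL r\<^esub> parabolic p"
    using levi_conj[OF g] unip_GL[OF g] unip_GL[OF A] unip_GL[OF A'] perm_mat_GL
    by (subst flag_eq_iff[OF r_eq]) (blast intro: GL_mult_closed)+
  then show ?thesis
    unfolding flag_of_def
    using flag_mult[OF r_eq unip_GL[OF g] GL_mult_closed[OF unip_GL[OF A] perm_mat_GL]] by simp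
qed

text \<open>For the forward direction, \<open>levi_factor_exists\<close> yields some parameter
  \<open>B\<close> of the moved flag, and injectivity of the parametrization gives
  \<open>B = A'\<close>.\<close>

lemma act_flag_of_iff:
  assumes g: "g \<in> unip r \<beta>" and A: "A \<in> unip r \<gamma>" and A': "A' \<in> unip r \<gamma>"
  shows "g <#\<^bsub>GL r\<^esub> flag_of A = flag_of A' \<longleftrightarrow> g * A = A' * levi r \<gamma> g"
proof
  assume L: "g <#\<^bsub>GL r\<^esub> flag_of A = flag_of A'"
  obtain B where B: "B \<in> unip r \<gamma>" "g * A = B * levi r \<gamma> g"
    using levi_factor_exists[OF g A] .
  then have "flag_of B = flag_of A'" using act_flag_of_levi[OF g A B] L by simp
  then show "g * A = A' * levi r \<gamma> g" using flag_of_inj[OF B(1) A'] B(2) by simp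
qed (rule act_flag_of_levi[OF assms])

lemma act_bruhat_cell:
  assumes g: "g \<in> unip r \<beta>" and x: "x \<in> bruhat_cell p \<sigma>"
  shows "g <#\<^bsub>GL r\<^esub> x \<in> bruhat_cell p \<sigma>"
proof -
  obtain A where A: "A \<in> unip r \<gamma>" "x = flag_of A" using x by (auto simp: bruhat_cell_eq)
  obtain B where B: "B \<in> unip r \<gamma>" "g * A = B * levi r \<gamma> g"
    using levi_factor_exists[OF g A(1)] .
  show ?thesis using act_flag_of_levi[OF g A(1) B] A(2) B(1) by (simp add: bruhat_cell_eq)
qed

lemma bruhat_cell_subset_flags: "bruhat_cell p \<sigma> \<subseteq> flags p"
  using unip_GL perm_mat_GL GL_mult_closed
  by (fastforce simp: bruhat_cell_eq flag_of_def flags_def r_eq[symmetric])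

lemma act_assoc:
  assumes "g \<in> carrier (GL r)" "h \<in> carrier (GL r)" "x \<in> flags p"
  shows "g <#\<^bsub>GL r\<^esub> (h <#\<^bsub>GL r\<^esub> x) = (g * h) <#\<^bsub>GL r\<^esub> x"
proof -
  obtain A where A: "A \<in> carrier (GL r)" "x = A <#\<^bsub>GL r\<^esub> parabolic p"
    using assms(3) by (auto simp: flags_def r_eq)
  have "g * (h * A) = g * h * A"
    using assms A by (intro assoc_mult_mat[symmetric]) (auto intro: GL_carrier_mat)
  then show ?thesis
    using assms(1,2) A by (simp add: flag_mult[OF r_eq] GL_mult_closed)
qed

lemma act_one:
  assumes "x \<in> flags p"
  shows "1\<^sub>m r <#\<^bsub>GL r\<^esub> x = x"
proof -
  obtain A where A: "A \<in> carrier (GL r)" "x = A <#\<^bsub>GL r\<^esub> parabolic p"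
    using assms by (auto simp: flags_def r_eq)
  have "1\<^sub>m r \<in> carrier (GL r)" using unip_GL[OF one_unip] .
  then show ?thesis
    using A GL_carrier_mat[OF A(1)] by (simp add: flag_mult[OF r_eq])
qed

definition coord :: "complex mat set \<Rightarrow> complex mat" where
  "coord = inv_into (unip r \<gamma>) flag_of"

lemma coord_flag_of: "A \<in> unip r \<gamma> \<Longrightarrow> coord (flag_of A) = A"
  unfolding coord_def by (rule inv_into_f_f) (auto intro: inj_onI flag_of_inj)

lemma flag_of_coord: "x \<in> bruhat_cell p \<sigma> \<Longrightarrow> flag_of (coord x) = x"
  and coord_unip: "x \<in> bruhat_cell p \<sigma> \<Longrightarrow> coord x \<in> unip r \<gamma>"
  by (auto simp: bruhat_cell_eq coord_flag_of)

text \<open>The projection from the preimage of the cell is open, hence a quotient map onto the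
  cell, so it is enough to treat the parameter as a function of a representing matrix
  \<open>M\<close>. There \<open>M * Pm'\<close> is a product of the parameter and a block upper
  triangular matrix, to which \<open>factor_continuous\<close> applies.\<close>

lemma coord_continuous:
  "mat_continuous (subtopology (flag_top p) (bruhat_cell p \<sigma>)) r coord"
proof -
  let ?C = "bruhat_cell p \<sigma>"
  let ?pr = "\<lambda>M. M <#\<^bsub>GL r\<^esub> parabolic p"
  let ?E = "{M \<in> topspace (GL_top r). ?pr M \<in> ?C}"
  let ?X = "subtopology (GL_top r) ?E"
  let ?Y = "subtopology (flag_top p) ?C"
  let ?A = "\<lambda>M. coord (?pr M)"
  have EX: "topspace ?X = ?E" by auto
  have C: "topspace ?Y = ?C"
    using bruhat_cell_subset_flags by (auto simp: topspace_flag_top)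
  define Q where "Q M q \<longleftrightarrow> q \<in> carrier (GL r) \<and>
    (\<forall>a<r. \<forall>b<r. \<gamma> b < \<gamma> a \<longrightarrow> q $$ (a, b) = 0) \<and> M * Pm' = ?A M * q" for M q
  have "\<exists>q. Q M q" if M: "M \<in> ?E" for M
  proof -
    have A: "?A M \<in> unip r \<gamma>" "flag_of (?A M) = ?pr M"
      using M coord_unip flag_of_coord by auto
    have MG: "M \<in> carrier (GL r)" using M by (simp add: topspace_GL_top)
    obtain h where h: "h \<in> parabolic p" "M = ?A M * Pm * h"
      using flag_eq_iff[OF r_eq MG, of "?A M * Pm"] A(2) unip_GL[OF A(1)]
      by (auto simp: flag_of_def GL_mult_closed perm_mat_GL)
    have "h \<in> carrier_mat r r" using parabolic_GL[OF h(1)] r_eq by (simp add: carrier_GL_iff)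
    then have "M * Pm' = ?A M * (Pm * h * Pm')"
      using factor_GL[OF GL_carrier_mat[OF MG] unip_carrier_mat[OF A(1)]] h(2) by blast
    then show ?thesis unfolding Q_def using parabolic_conj[OF h(1)] by blast
  qed
  then have "\<forall>M\<in>?E. \<exists>q. Q M q" by blast
  \<comment> \<open>The second factor is chosen pointwise, with no control on its continuity;
    \<open>factor_continuous\<close> asks only that the product be continuous.\<close>
  from bchoice[OF this] obtain q where "\<forall>M\<in>?E. Q M (q M)" ..
  then have q: "\<And>M. M \<in> ?E \<Longrightarrow> q M \<in> carrier (GL r)"
      "\<And>M a b. M \<in> ?E \<Longrightarrow> a < r \<Longrightarrow> b < r \<Longrightarrow> \<gamma> b < \<gamma> a \<Longrightarrow> q M $$ (a, b) = 0"
      "\<And>M. M \<in> ?E \<Longrightarrow> M * Pm' = ?A M * q M"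
    unfolding Q_def by blast+
  have "mat_continuous ?X r (\<lambda>M. M * Pm')"
    using mat_continuous_compose[OF continuous_map_from_subtopology[OF continuous_map_id] mat_continuous_id_GL]
    by (intro mat_continuous_mult mat_continuous_const) (auto simp: id_def)
  then have "mat_continuous ?X r (\<lambda>M. ?A M * q M)"
    by (rule mat_continuous_eq) (use q(3) in auto)
  then have A: "mat_continuous ?X r ?A"
    by (rule factor_continuous[where \<gamma> = \<gamma> and q = q, rotated 3]) (use q coord_unip EX in auto)
  have om: "open_map ?X ?Y ?pr"
    by (rule open_map_restriction[OF open_map_flag_proj[OF r_eq]]) auto
  moreover have "continuous_map ?X ?Y ?pr"
    using continuous_map_from_subtopology[OF continuous_map_flag_proj[OF r_eq], of ?E]
    by (auto simp: continuous_map_in_subtopology)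
  moreover have "?pr ` topspace ?X = topspace ?Y"
    unfolding EX C
  proof (intro equalityI subsetI)
    fix x assume x: "x \<in> ?C"
    have eq: "?pr (coord x * Pm) = x" using flag_of_coord[OF x] by (simp add: flag_of_def)
    have "coord x * Pm \<in> carrier (GL r)"
      by (intro GL_mult_closed unip_GL[OF coord_unip[OF x]] perm_mat_GL)
    then have "coord x * Pm \<in> ?E" using x by (simp only: mem_Collect_eq topspace_GL_top eq simp_thms)
    then have "?pr (coord x * Pm) \<in> ?pr ` ?E" by (rule imageI)
    then show "x \<in> ?pr ` ?E" by (simp only: eq)
  qed auto
  ultimately have qm: "quotient_map ?X ?Y ?pr"
    by (intro continuous_open_imp_quotient_map) auto
  have "continuous_map ?Y euclidean (\<lambda>x. coord x $$ (a, b))" if "a < r" "b < r" for a b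
    by (rule continuous_compose_quotient_map[OF qm])
      (use A that in \<open>auto simp: mat_continuous_def o_def\<close>)
  then show ?thesis
    using unip_carrier_mat[OF coord_unip] C by (auto simp: mat_continuous_def)
qed

lemma act_flag_of_continuous:
  assumes F: "mat_continuous X r F" "\<And>x. x \<in> topspace X \<Longrightarrow> F x \<in> unip r \<beta>"
    and A: "mat_continuous X r A" "\<And>x. x \<in> topspace X \<Longrightarrow> A x \<in> unip r \<gamma>"
  shows "continuous_map X (subtopology (flag_top p) (bruhat_cell p \<sigma>))
     (\<lambda>x. F x <#\<^bsub>GL r\<^esub> flag_of (A x))"
proof -
  have "continuous_map X (GL_top r) (\<lambda>x. F x * (A x * Pm))"
    unfolding continuous_map_GL_top
    using F A by (auto intro!: mat_continuous_mult mat_continuous_const GL_mult_closed unip_GL[OF F(2)]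
        unip_GL[OF A(2)] perm_mat_GL)
  from continuous_map_compose[OF this continuous_map_flag_proj[OF r_eq]]
  have "continuous_map X (flag_top p) (\<lambda>x. (F x * (A x * Pm)) <#\<^bsub>GL r\<^esub> parabolic p)"
    by (simp add: o_def)
  then have "continuous_map X (flag_top p) (\<lambda>x. F x <#\<^bsub>GL r\<^esub> flag_of (A x))"
  proof (rule continuous_map_eq)
    show "(F x * (A x * Pm)) <#\<^bsub>GL r\<^esub> parabolic p = F x <#\<^bsub>GL r\<^esub> flag_of (A x)"
      if "x \<in> topspace X" for x
      unfolding flag_of_def
      using flag_mult[OF r_eq unip_GL[OF F(2)[OF that]]
          GL_mult_closed[OF unip_GL[OF A(2)[OF that]] perm_mat_GL]] by simp
  qed
  moreover have "F x <#\<^bsub>GL r\<^esub> flag_of (A x) \<in> bruhat_cell p \<sigma>" if "x \<in> topspace X" for x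
    using act_bruhat_cell[OF F(2)[OF that]] A(2)[OF that] by (simp add: bruhat_cell_eq)
  ultimately show ?thesis by (auto simp: continuous_map_in_subtopology)
qed

end

section \<open>Partition blocks\<close>

lemma sum_list_take_mono:
  fixes p :: "nat list"
  assumes "q \<le> q'"
  shows "sum_list (take q p) \<le> sum_list (take q' p)"
proof -
  have "take q' p = take q p @ drop q (take q' p)"
    using assms by (metis append_take_drop_id min.absorb1 take_take)
  then show ?thesis by (metis le_add1 sum_list_append)
qed

text \<open>Block numbers and partial sums form a Galois connection, from which the other facts
  about blocks follow.\<close>

lemma blk_le_iff:
  assumes "x < sum_list p"
  shows "blk p x \<le> q \<longleftrightarrow> x < sum_list (take q p)"
proof
  have "x < sum_list (take (length p) p)" using assms by simp
  then have "x < sum_list (take (blk p x) p)"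
    unfolding blk_def by (rule LeastI)
  then show "x < sum_list (take q p)" if "blk p x \<le> q"
    using sum_list_take_mono[OF that, of p] by simp
  show "blk p x \<le> q" if "x < sum_list (take q p)"
    unfolding blk_def using that by (rule Least_le)
qed

lemma blk_eqI:
  assumes "x < sum_list p" "x < sum_list (take q p)" "sum_list (take (q - 1) p) \<le> x"
  shows "blk p x = q"
proof -
  have "blk p x \<le> q" "\<not> blk p x \<le> q - 1"
    using assms by (auto simp: blk_le_iff)
  then show ?thesis by simp
qed

lemma blk_mono: "a \<le> b \<Longrightarrow> b < sum_list p \<Longrightarrow> blk p a \<le> blk p b"
  using blk_le_iff[of b p "blk p b"] blk_le_iff[of a p "blk p b"] by auto

lemma blk_bounds:
  assumes "x < sum_list p"
  shows "1 \<le> blk p x" "blk p x \<le> length p"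
  using blk_le_iff[OF assms, of 0] blk_le_iff[OF assms, of "length p"] assms by auto

lemma blk_sandwich:
  assumes "x < sum_list p"
  shows "x < sum_list (take (blk p x) p)" "sum_list (take (blk p x - 1) p) \<le> x"
  using blk_le_iff[OF assms, of "blk p x"] blk_le_iff[OF assms, of "blk p x - 1"]
    blk_bounds[OF assms] by auto

lemma length_parts [simp]: "length (parts s i) = s"
  by (simp add: parts_def)

lemma sum_list_take_parts: "sum_list (take q (parts s i)) = (\<Sum>k = 1..min q s. i k)"
proof -
  have "take q [1..<Suc s] = [1..<Suc (min q s)]"
    by (cases "q \<le> s") (auto simp: take_upt min_def simp del: upt_Suc)
  then have "take q (parts s i) = map i [1..<Suc (min q s)]"
    by (simp add: parts_def take_map)
  then have "sum_list (take q (parts s i)) = sum i (set [1..<Suc (min q s)])"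
    by (simp add: sum_list_distinct_conv_sum_set)
  also have "set [1..<Suc (min q s)] = {1..min q s}" by auto
  finally show ?thesis .
qed

lemma sum_list_parts: "sum_list (parts s i) = rk s i"
  using sum_list_take_parts[of s s i] by (simp add: rk_def)

lemma row_blk_bounds:
  assumes "a < rk s i"
  shows "1 \<le> row_blk s i a" "row_blk s i a \<le> s"
  using blk_bounds[of a "parts s i"] assms by (auto simp: sum_list_parts)

lemma row_blk_mono: "a \<le> b \<Longrightarrow> b < rk s i \<Longrightarrow> row_blk s i a \<le> row_blk s i b"
  using blk_mono[of a b "parts s i"] by (simp add: sum_list_parts)

lemma sum_list_drop: "sum_list (drop k p) = sum_list p - sum_list (take k (p :: nat list))"
  by (metis append_take_drop_id diff_add_inverse sum_list_append)

text \<open>The grading whose unipotent group is the group \<open>N\<^sup>c\<close> of the Bruhat cell of type \<open>t\<close>.\<close>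

definition grading :: "nat \<Rightarrow> (nat \<Rightarrow> nat) \<Rightarrow> nat \<Rightarrow> nat \<Rightarrow> nat" where
  "grading s i t a = (if t = 0 then row_blk s i a else if row_blk s i a \<le> t then 0 else 1)"

definition tau_inv :: "nat \<Rightarrow> (nat \<Rightarrow> nat) \<Rightarrow> nat \<Rightarrow> nat \<Rightarrow> nat" where
  "tau_inv s i l a = (if l = 0 then rk s i - 1 - a
     else if a < (\<Sum>q = 1..l. i q) then a + (rk s i - (\<Sum>q = 1..l. i q)) else a - (\<Sum>q = 1..l. i q))"

lemma partial_sum_le_rk: "l \<le> s \<Longrightarrow> (\<Sum>q = 1..l. i q) \<le> rk s i"
  unfolding rk_def by (rule sum_mono2) auto

lemma permutation_pair_tau:
  assumes "l \<le> s"
  shows "permutation_pair (rk s i) (tau s i l) (tau_inv s i l)"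
proof (cases "l = 0")
  case True
  then show ?thesis by unfold_locales (auto simp: tau_def tau_inv_def)
next
  case False
  let ?S = "\<Sum>q = 1..l. i q"
  have S: "?S \<le> rk s i" by (rule partial_sum_le_rk[OF assms])
  have tau: "tau s i l a = (if a + ?S < rk s i then a + ?S else a + ?S - rk s i)"
    if "a < rk s i" for a
    using False S that by (simp add: tau_def mod_if)
  show ?thesis
    using False S by unfold_locales (auto simp: tau tau_inv_def)
qed

lemma sum_list_lam: "sum_list (lam s i l) = rk s i"
proof -
  have "sum_list (drop l (parts s i)) + sum_list (take l (parts s i)) = sum_list (parts s i)"
    by (metis add.commute append_take_drop_id sum_list_append)
  then show ?thesis by (simp add: lam_def sum_list_parts sum_list_rev)
qed

text \<open>The reversal inverts the order of all blocks, so the conjugated parabolic group is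
  opposite to the block-lower-triangular one: this is the cell with a parameter in every block below
  the diagonal.\<close>

lemma blk_lam_tau_inv_0:
  assumes a: "a < rk s i"
  shows "blk (lam s i 0) (tau_inv s i 0 a) = s + 1 - row_blk s i a"
proof (rule blk_eqI)
  let ?p = "parts s i"
  have rev: "sum_list (take q (rev ?p)) = rk s i - sum_list (take (s - q) ?p)" for q
    by (simp add: take_rev sum_list_rev sum_list_drop sum_list_parts)
  have b: "a < sum_list (take (row_blk s i a) ?p)" "sum_list (take (row_blk s i a - 1) ?p) \<le> a"
    using blk_sandwich[of a ?p] a by (auto simp: sum_list_parts)
  note bd = row_blk_bounds[OF a]
  show "tau_inv s i 0 a < sum_list (lam s i 0)"
    using a by (simp add: sum_list_lam tau_inv_def)
  have "s - (s + 1 - row_blk s i a) = row_blk s i a - 1" using bd by simp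
  then show "tau_inv s i 0 a < sum_list (take (s + 1 - row_blk s i a) (lam s i 0))"
    using b a by (simp add: lam_def rev tau_inv_def)
  have "s - (s + 1 - row_blk s i a - 1) = row_blk s i a" using bd by simp
  then show "sum_list (take (s + 1 - row_blk s i a - 1) (lam s i 0)) \<le> tau_inv s i 0 a"
    using b a by (simp add: lam_def rev tau_inv_def)
qed

lemma partial_sum_less_iff:
  assumes "a < rk s i" "l \<le> s"
  shows "a < (\<Sum>q = 1..l. i q) \<longleftrightarrow> row_blk s i a \<le> l"
  using blk_le_iff[of a "parts s i" l] assms by (simp add: sum_list_parts sum_list_take_parts)

text \<open>The shift moves blocks \<open>1, ..., l\<close> behind the others and keeps the order
  within both groups. So it inverts exactly the pairs of blocks separated by \<open>l\<close>, which
  is why \<open>grading\<close> takes only two values for positive types.\<close>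

lemma blk_lam_tau_inv:
  assumes a: "a < rk s i" and l: "0 < l" "l < s"
  shows "blk (lam s i l) (tau_inv s i l a) =
    (if row_blk s i a \<le> l then row_blk s i a + (s - l) else row_blk s i a - l)"
proof -
  let ?p = "parts s i"
  let ?S = "\<Sum>q = 1..l. i q"
  let ?b = "row_blk s i a"
  have S: "?S = sum_list (take l ?p)" using l by (simp add: sum_list_take_parts)
  have Sle: "?S \<le> rk s i" using l by (intro partial_sum_le_rk) simp
  have b: "a < sum_list (take ?b ?p)" "sum_list (take (?b - 1) ?p) \<le> a"
    using blk_sandwich[of a ?p] a by (auto simp: sum_list_parts)
  note bd = row_blk_bounds[OF a]
  have lt: "tau_inv s i l a < sum_list (lam s i l)"
    using permutation_pair.perm(2)[OF permutation_pair_tau[of l s i] a] l by (simp add: sum_list_lam)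
  show ?thesis
  proof (cases "?b \<le> l")
    case True
    have 1: "sum_list (take (q + (s - l)) (lam s i l)) = rk s i - ?S + sum_list (take q ?p)"
      if "q \<le> l" for q
      using that l S Sle
      by (simp add: lam_def sum_list_drop sum_list_parts take_drop min_def)
    have pred: "?b + (s - l) - 1 = (?b - 1) + (s - l)" using bd by simp
    have ti: "tau_inv s i l a = rk s i - ?S + a"
      using True l partial_sum_less_iff[OF a, of l] by (simp add: tau_inv_def)
    have "blk (lam s i l) (tau_inv s i l a) = ?b + (s - l)"
    proof (rule blk_eqI[OF lt])
      show "tau_inv s i l a < sum_list (take (?b + (s - l)) (lam s i l))"
        unfolding ti 1[OF True] using b(1) by simp
      have "?b - 1 \<le> l" using True by simp
      then show "sum_list (take (?b + (s - l) - 1) (lam s i l)) \<le> tau_inv s i l a"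
        unfolding ti pred using b(2) 1[of "?b - 1"] by simp
    qed
    then show ?thesis using True by simp
  next
    case False
    have 1: "sum_list (take (q - l) (lam s i l)) = sum_list (take q ?p) - ?S"
      if "l \<le> q" "q \<le> s" for q
    proof -
      have "take (q - l) (lam s i l) = drop l (take q ?p)"
        using that l by (simp add: lam_def drop_take)
      then show ?thesis using that S by (simp add: sum_list_drop min_def)
    qed
    have pred: "?b - l - 1 = (?b - 1) - l" by simp
    have Sa: "?S \<le> a" using False l partial_sum_less_iff[OF a, of l] by simp
    then have ti: "tau_inv s i l a = a - ?S" using l by (simp add: tau_inv_def)
    have "blk (lam s i l) (tau_inv s i l a) = ?b - l"
    proof (rule blk_eqI[OF lt])
      show "tau_inv s i l a < sum_list (take (?b - l) (lam s i l))"
        unfolding ti using False bd(2) b(1) Sa by (subst 1) simp_all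
      show "sum_list (take (?b - l - 1) (lam s i l)) \<le> tau_inv s i l a"
        unfolding ti pred using False bd(2) b(2) Sa by (subst 1) simp_all
    qed
    then show ?thesis using False by simp
  qed
qed

lemma graded_grading: "graded (rk s i) (row_blk s i) (grading s i t)"
  by unfold_locales (auto simp: grading_def)

lemma bruhat_group_lam_tau:
  assumes l: "l < s"
  shows "bruhat_group (lam s i l) (tau s i l) = unip (rk s i) (grading s i l)"
proof -
  let ?r = "rk s i" and ?p = "lam s i l" and ?\<sigma>' = "tau_inv s i l" and ?\<gamma> = "grading s i l"
  interpret permutation_pair ?r "tau s i l" ?\<sigma>'
    using l by (intro permutation_pair_tau) simp
  have inj: "inj_on (tau s i l) {..<?r}"
    by (rule inj_on_inverseI[of _ ?\<sigma>']) (use perm in auto)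
  have inv: "inv_into {..<?r} (tau s i l) a = ?\<sigma>' a" if "a < ?r" for a
    using inv_into_f_f[OF inj, of "?\<sigma>' a"] perm that by auto
  \<comment> \<open>Inversions between different blocks are exactly the strict increases of the
    grading. Inside a block the shift creates no inversions; those created by the reversal are
    excluded by the condition on blocks.\<close>
  have less: "?\<sigma>' a < ?\<sigma>' b \<and> blk ?p (?\<sigma>' a) \<noteq> blk ?p (?\<sigma>' b) \<longleftrightarrow> ?\<gamma> b < ?\<gamma> a"
    if "a < ?r" "b < a" for a b
  proof -
    have b: "b < ?r" using that by simp
    note bd = row_blk_bounds[OF that(1)] row_blk_bounds[OF b]
    have m: "row_blk s i b \<le> row_blk s i a" using that by (intro row_blk_mono) auto
    show ?thesis
    proof (cases "l = 0")
      case True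
      then show ?thesis
        using that b bd m by (auto simp: blk_lam_tau_inv_0 grading_def) (auto simp: tau_inv_def)
    next
      case False
      then show ?thesis
        using that b bd m l partial_sum_less_iff[OF that(1), of l] partial_sum_less_iff[OF b, of l]
          partial_sum_le_rk[of l s i]
        by (auto simp: blk_lam_tau_inv grading_def) (auto simp: tau_inv_def)
    qed
  qed
  have ge: "?\<gamma> a \<le> ?\<gamma> b" if "a \<le> b" "b < ?r" for a b
    using row_blk_mono[OF that] by (auto simp: grading_def)
  have "A \<in> bruhat_group ?p (tau s i l) \<longleftrightarrow> A \<in> unip ?r ?\<gamma>" for A
  proof -
    have "A \<in> bruhat_group ?p (tau s i l) \<longleftrightarrow> A \<in> carrier_mat ?r ?r \<and>
        (\<forall>a < ?r. A $$ (a, a) = 1) \<and> (\<forall>a < ?r. \<forall>b < ?r. a < b \<longrightarrow> A $$ (a, b) = 0) \<and>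
        (\<forall>a < ?r. \<forall>b < a. \<not> ?\<gamma> b < ?\<gamma> a \<longrightarrow> A $$ (a, b) = 0)"
      unfolding bruhat_group_def Let_def sum_list_lam
      using less inv by (simp cong: conj_cong imp_cong)
    also have "\<dots> \<longleftrightarrow> A \<in> unip ?r ?\<gamma>"
    proof
      assume R: "A \<in> carrier_mat ?r ?r \<and>
        (\<forall>a < ?r. A $$ (a, a) = 1) \<and> (\<forall>a < ?r. \<forall>b < ?r. a < b \<longrightarrow> A $$ (a, b) = 0) \<and>
        (\<forall>a < ?r. \<forall>b < a. \<not> ?\<gamma> b < ?\<gamma> a \<longrightarrow> A $$ (a, b) = 0)"
      then have "A $$ (a, b) = (if a = b then 1 else 0)" if "a < ?r" "b < ?r" "?\<gamma> a \<le> ?\<gamma> b" for a b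
        using that by (cases a b rule: linorder_cases) auto
      then show "A \<in> unip ?r ?\<gamma>" using R by (simp add: unip_def)
    next
      assume "A \<in> unip ?r ?\<gamma>"
      then show "A \<in> carrier_mat ?r ?r \<and>
        (\<forall>a < ?r. A $$ (a, a) = 1) \<and> (\<forall>a < ?r. \<forall>b < ?r. a < b \<longrightarrow> A $$ (a, b) = 0) \<and>
        (\<forall>a < ?r. \<forall>b < a. \<not> ?\<gamma> b < ?\<gamma> a \<longrightarrow> A $$ (a, b) = 0)"
        using ge by (auto simp: unip_def)
    qed
    finally show ?thesis .
  qed
  then show ?thesis by blast
qed

lemma bruhat_data_lam_tau:
  assumes l: "l < s"
  shows "bruhat_data (rk s i) (row_blk s i) (grading s i l) (tau s i l) (tau_inv s i l) (lam s i l)"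
proof -
  interpret graded "rk s i" "row_blk s i" "grading s i l" by (rule graded_grading)
  interpret permutation_pair "rk s i" "tau s i l" "tau_inv s i l"
    using l by (intro permutation_pair_tau) simp
  show ?thesis
  proof
    fix a b assume ab: "a < rk s i" "b < rk s i"
    note bd = row_blk_bounds[OF ab(1)] row_blk_bounds[OF ab(2)]
    show "blk (lam s i l) (tau_inv s i l a) < blk (lam s i l) (tau_inv s i l b)"
      if "grading s i l b < grading s i l a"
      using that ab bd l
      by (cases "l = 0") (auto simp: blk_lam_tau_inv_0 blk_lam_tau_inv grading_def split: if_splits)
    show "grading s i l b < grading s i l a \<or> row_blk s i a < row_blk s i b"
      if "blk (lam s i l) (tau_inv s i l a) < blk (lam s i l) (tau_inv s i l b)"
      using that ab bd l
      by (cases "l = 0") (auto simp: blk_lam_tau_inv_0 blk_lam_tau_inv grading_def split: if_splits)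
  qed (use sum_list_lam bruhat_group_lam_tau[OF l] in auto)
qed

section \<open>Counting the points of each type\<close>

lemma pt_type_le_iff:
  assumes "m \<le> num_pts s n"
  shows "pt_type n m \<le> t \<longleftrightarrow> m \<le> (\<Sum>q = 1..t. deg_gap n q)"
proof
  \<comment> \<open>For \<open>m \<le> num_pts s n\<close> the type \<open>s - 1\<close> is a
    candidate, so the \<open>LEAST\<close> in \<open>pt_type\<close> is attained.\<close>
  have "{1..<s} = {1..s - 1}" by auto
  then have "m \<le> (\<Sum>q = 1..s - 1. deg_gap n q)" using assms by (simp add: num_pts_def)
  then have "m \<le> (\<Sum>q = 1..pt_type n m. deg_gap n q)"
    unfolding pt_type_def by (rule LeastI)
  also have "\<dots> \<le> (\<Sum>q = 1..t. deg_gap n q)" if "pt_type n m \<le> t"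
    using that by (intro sum_mono2) auto
  finally show "m \<le> (\<Sum>q = 1..t. deg_gap n q)" if "pt_type n m \<le> t" using that by simp
  show "pt_type n m \<le> t" if "m \<le> (\<Sum>q = 1..t. deg_gap n q)"
    unfolding pt_type_def using that by (rule Least_le)
qed

lemma pt_type_less:
  assumes "m \<le> num_pts s n" "0 < s"
  shows "pt_type n m < s"
proof -
  have "{1..<s} = {1..s - 1}" by auto
  then show ?thesis
    using pt_type_le_iff[OF assms(1), of "s - 1"] assms by (simp add: num_pts_def)
qed

text \<open>A telescoping sum; monotonicity of \<open>n\<close> ensures that the truncation by
  \<open>nat\<close> loses nothing.\<close>

lemma sum_deg_gap:
  assumes n: "strict_mono_on {1..s} n" and kj: "1 \<le> k" "k \<le> j" "j \<le> s"
  shows "(\<Sum>q = k..<j. deg_gap n q) = nat (n j - n k)"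
  using kj(2,3)
proof (induction j rule: dec_induct)
  case (step j)
  have "n j < n (Suc j)" "n k \<le> n j"
    using n step kj(1) strict_mono_on_leD[OF n, of k j] by (auto intro: strict_mono_onD[OF n])
  then show ?case using step by (simp add: deg_gap_def)
qed simp

text \<open>The points whose cell has a free parameter at \<open>(a, b)\<close>, that is, those
  where \<open>levi_factor_iff\<close> prescribes the \<open>(a, b)\<close> entry of the
  automorphism.\<close>

definition sep_pts :: "nat \<Rightarrow> (nat \<Rightarrow> nat) \<Rightarrow> (nat \<Rightarrow> int) \<Rightarrow> nat \<Rightarrow> nat \<Rightarrow> nat set" where
  "sep_pts s i n a b =
     {m. m \<le> num_pts s n \<and> grading s i (pt_type n m) b < grading s i (pt_type n m) a}"

lemma finite_sep_pts [simp]: "finite (sep_pts s i n a b)"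
  by (rule finite_subset[of _ "{..num_pts s n}"]) (auto simp: sep_pts_def)

text \<open>Let \<open>a\<close> lie in block j and \<open>b\<close> in block k. The point of index
  0 separates all blocks, and a positive type t separates these two iff k <= t < j, contributing d_t
  points. The total is the dimension of the polynomials of degree at most n_j - n_k.\<close>

lemma card_sep_pts:
  assumes n: "strict_mono_on {1..s} n" and ab: "a < rk s i" "b < rk s i"
    and less: "row_blk s i b < row_blk s i a"
  shows "card (sep_pts s i n a b) = nat (n (row_blk s i a) - n (row_blk s i b)) + 1"
proof -
  let ?j = "row_blk s i a" and ?k = "row_blk s i b"
  let ?D = "\<lambda>t. \<Sum>q = 1..t. deg_gap n q"
  note bd = row_blk_bounds[OF ab(1)] row_blk_bounds[OF ab(2)]
  have Dj: "?D (?j - 1) = (\<Sum>q = 1..<?j. deg_gap n q)"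
    by (rule sum.cong) (use bd in auto)
  have Dk: "?D (?k - 1) = (\<Sum>q = 1..<?k. deg_gap n q)"
    by (rule sum.cong) (use bd in auto)
  have Djk: "?D (?j - 1) = ?D (?k - 1) + nat (n ?j - n ?k)"
    unfolding Dj Dk sum_deg_gap[OF n bd(3) less_imp_le[OF less] bd(2), symmetric]
    by (rule sum.atLeastLessThan_concat[symmetric]) (use bd less in auto)
  have num: "?D (?j - 1) \<le> num_pts s n"
    unfolding Dj num_pts_def using bd by (intro sum_mono2) auto
  have "m \<in> sep_pts s i n a b \<longleftrightarrow> m \<in> insert 0 {?D (?k - 1)<..?D (?j - 1)}" for m
  proof (cases "m \<le> num_pts s n")
    case True
    \<comment> \<open>The condition on the type is phrased through upper bounds and their negations,
      the form that \<open>pt_type_le_iff\<close> turns into bounds on \<open>m\<close>.\<close>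
    have "m \<in> sep_pts s i n a b \<longleftrightarrow> pt_type n m \<le> 0 \<or> (\<not> pt_type n m \<le> ?k - 1 \<and> pt_type n m \<le> ?j - 1)"
      using True bd less by (auto simp: sep_pts_def grading_def)
    also have "\<dots> \<longleftrightarrow> m \<in> insert 0 {?D (?k - 1)<..?D (?j - 1)}"
      unfolding pt_type_le_iff[OF True] by auto
    finally show ?thesis .
  next
    case False
    then show ?thesis using num by (auto simp: sep_pts_def)
  qed
  then have "sep_pts s i n a b = insert 0 {?D (?k - 1)<..?D (?j - 1)}" by blast
  then show ?thesis using Djk by simp
qed

section \<open>Interpolation on the projective line\<close>

text \<open>Polynomials of degree at most \<open>d\<close> are the sections of \<open>O(d)\<close>; the value at \<open>\<infinity>\<close> is the
  coefficient of degree \<open>d\<close>.\<close>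

definition eval_cp1 :: "nat \<Rightarrow> complex poly \<Rightarrow> cp1 \<Rightarrow> complex" where
  "eval_cp1 d p x = (case x of Some z \<Rightarrow> poly p z | None \<Rightarrow> coeff p d)"

lemma eval_cp1_simps [simp]:
  "eval_cp1 d p (Some z) = poly p z" "eval_cp1 d p None = coeff p d"
  by (simp_all add: eval_cp1_def)

lemma eval_cp1_linear [simp]:
  "eval_cp1 d 0 x = 0"
  "eval_cp1 d (p - q) x = eval_cp1 d p x - eval_cp1 d q x"
  "eval_cp1 d (Polynomial.smult c p) x = c * eval_cp1 d p x"
  "eval_cp1 d (\<Sum>k\<in>K. f k) x = (\<Sum>k\<in>K. eval_cp1 d (f k) x)"
  by (simp_all add: eval_cp1_def poly_sum coeff_sum split: option.split)

text \<open>A node at infinity contributes no factor: leaving it out lowers the degree below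
  \<open>d\<close>, which is what vanishing at infinity means.\<close>

definition lagrange_cp1 :: "nat \<Rightarrow> (nat \<Rightarrow> cp1) \<Rightarrow> nat set \<Rightarrow> nat \<Rightarrow> complex poly" where
  "lagrange_cp1 d z I m =
     (let q = \<Prod>k \<in> {k \<in> I - {m}. z k \<noteq> None}. [:- the (z k), 1:]
      in Polynomial.smult (1 / eval_cp1 d q (z m)) q)"

lemma lagrange_cp1:
  assumes I: "finite I" "card I = d + 1" "inj_on z I" and m: "m \<in> I"
  shows "degree (lagrange_cp1 d z I m) \<le> d"
    and "k \<in> I \<Longrightarrow> eval_cp1 d (lagrange_cp1 d z I m) (z k) = (if k = m then 1 else 0)"
proof -
  let ?J = "{k \<in> I - {m}. z k \<noteq> None}"
  define q where "q = (\<Prod>k \<in> ?J. [:- the (z k), 1:])"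
  have fJ: "finite ?J" using I by auto
  have cI: "card (I - {m}) = d" using I m by simp
  have cJ: "card ?J \<le> d" using card_mono[of "I - {m}" ?J] I cI by auto
  have deg: "degree q = card ?J"
    unfolding q_def by (subst degree_prod_eq_sum_degree) auto
  have lead: "coeff q (card ?J) = 1"
    unfolding deg[symmetric] by (simp add: q_def lead_coeff_prod)
  have L: "lagrange_cp1 d z I m = Polynomial.smult (1 / eval_cp1 d q (z m)) q"
    unfolding lagrange_cp1_def q_def Let_def ..
  show "degree (lagrange_cp1 d z I m) \<le> d"
    unfolding L using deg cJ by (metis degree_smult_le order_trans)
  have nz: "eval_cp1 d q (z m) \<noteq> 0"
  proof (cases "z m")
    \<comment> \<open>If \<open>m\<close> itself is the node at infinity, the \<open>d\<close> other
      nodes are all finite, and \<open>q\<close> is monic of degree \<open>d\<close>.\<close>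
    case None
    have "z k \<noteq> None" if "k \<in> I" "k \<noteq> m" for k
    proof
      assume "z k = None"
      then have "z k = z m" using None by simp
      then show False using inj_onD[OF I(3), of k m] that m by simp
    qed
    then have "?J = I - {m}" by auto
    then show ?thesis using None lead cI by simp
  next
    case (Some w)
    have "w \<noteq> the (z k)" if "k \<in> ?J" for k
    proof
      assume "w = the (z k)"
      then have "z k = z m" using that Some by auto
      then show False using inj_onD[OF I(3), of k m] that m by simp
    qed
    then show ?thesis using Some fJ by (auto simp: q_def poly_prod)
  qed
  show "eval_cp1 d (lagrange_cp1 d z I m) (z k) = (if k = m then 1 else 0)" if k: "k \<in> I"
  proof (cases "k = m")
    case True
    then show ?thesis using nz by (simp add: L)
  next
    case False
    have "eval_cp1 d q (z k) = 0"
    proof (cases "z k")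
      case None
      \<comment> \<open>With \<open>k\<close> at infinity and \<open>k \<noteq> m\<close>, fewer
        than \<open>d\<close> factors remain, so the coefficient of degree \<open>d\<close> is
        0.\<close>
      have "?J \<subseteq> I - {m} - {k}" using None by auto
      then have "card ?J \<le> card (I - {m} - {k})" using I by (intro card_mono) auto
      also have "\<dots> < card (I - {m})" using I k False by (intro card_Diff1_less) auto
      finally have "degree q < d" using deg cI by simp
      then show ?thesis using None by (simp add: coeff_eq_0)
    next
      case (Some w)
      then have "k \<in> ?J" "poly [:- the (z k), 1:] w = 0" using k False by auto
      then show ?thesis using Some fJ by (auto simp: q_def poly_prod intro!: prod_zero)
    qed
    then show ?thesis using False by (simp add: L)
  qed
qed

text \<open>Without a node at infinity there are too many roots. With one, the \<open>d\<close>
  finite roots force the degree to be \<open>d\<close>, whereas vanishing at infinity kills that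
  coefficient.\<close>

lemma eval_cp1_zero_imp_zero:
  assumes I: "finite I" "card I = d + 1" "inj_on z I" and deg: "degree p \<le> d"
    and p0: "\<And>k. k \<in> I \<Longrightarrow> eval_cp1 d p (z k) = 0"
  shows "p = 0"
proof (rule ccontr)
  assume p: "p \<noteq> 0"
  let ?J = "{k \<in> I. z k \<noteq> None}"
  have "inj_on (\<lambda>k. the (z k)) ?J"
    using I(3) by (auto simp: inj_on_def)
  then have "card ?J = card ((\<lambda>k. the (z k)) ` ?J)" by (simp add: card_image)
  also have "\<dots> \<le> card {x. poly p x = 0}"
  proof (intro card_mono poly_roots_finite[OF p] subsetI)
    fix x assume "x \<in> (\<lambda>k. the (z k)) ` ?J"
    then obtain k w where "k \<in> I" "z k = Some w" "x = w" by auto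
    then show "x \<in> {x. poly p x = 0}" using p0[of k] by simp
  qed
  also have "\<dots> \<le> degree p" by (rule card_poly_roots_bound[OF p])
  finally have J: "card ?J \<le> degree p" .
  show False
  proof (cases "\<exists>k\<in>I. z k = None")
    case True
    then obtain k where k: "k \<in> I" "z k = None" by auto
    have "I - {k} \<subseteq> ?J"
    proof
      fix j assume j: "j \<in> I - {k}"
      then have "z j \<noteq> z k" using inj_onD[OF I(3), of j k] k by auto
      then show "j \<in> ?J" using j k by simp
    qed
    then have "d \<le> card ?J" using card_mono[of ?J "I - {k}"] I k by auto
    moreover have "coeff p d = 0" using p0[OF k(1)] k(2) by simp
    ultimately have "degree p = d" "coeff p d = 0" using J deg by auto
    then show False using p by auto
  next
    case False
    then have "?J = I" by auto
    then show False using J deg I(2) by simp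
  qed
qed

section \<open>Automorphisms of the bundle\<close>

text \<open>A section of O(d) written in the chart at infinity: for \<open>degree p \<le> d\<close>
  the value at \<open>w \<noteq> 0\<close> is \<open>w ^ d * poly p (1 / w)\<close>. The monomial
  compensates for \<open>reflect_poly\<close> using the actual degree in place of
  \<open>d\<close>.\<close>

definition reflect_deg :: "nat \<Rightarrow> complex poly \<Rightarrow> complex poly" where
  "reflect_deg d p = monom 1 (d - degree p) * reflect_poly p"

lemma poly_reflect_deg:
  assumes "degree p \<le> d" "z \<noteq> 0"
  shows "poly p z = z ^ d * poly (reflect_deg d p) (1 / z)"
proof -
  have "z ^ d = z ^ (d - degree p) * z ^ degree p"
    using assms by (simp flip: power_add)
  then show ?thesis
    using assms by (simp add: reflect_deg_def poly_monom poly_reflect_poly_nz field_simps)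
qed

lemma poly_reflect_deg_0: "degree p \<le> d \<Longrightarrow> poly (reflect_deg d p) 0 = coeff p d"
  by (cases "degree p = d") (auto simp: reflect_deg_def poly_monom coeff_eq_0)

lemma poly_holomorphic [simp, intro]: "poly p holomorphic_on S"
  by (induction p) (auto intro!: holomorphic_intros)

lemma zN_carrier [simp]: "zN s i n z \<in> carrier_mat (rk s i) (rk s i)"
  by (simp add: zN_def)

lemma zN_conj_entry:
  assumes B: "B \<in> carrier_mat (rk s i) (rk s i)" and ab: "a < rk s i" "b < rk s i"
  shows "(zN s i n z * B * zN s i (\<lambda>k. - n k) z) $$ (a, b) =
    z powi n (row_blk s i a) * B $$ (a, b) * z powi (- n (row_blk s i b))"
proof -
  have "(zN s i n z * B) $$ (a, c) = z powi n (row_blk s i a) * B $$ (a, c)" if "c < rk s i" for c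
  proof -
    have "(zN s i n z * B) $$ (a, c) =
      (\<Sum>d<rk s i. if d = a then z powi n (row_blk s i a) * B $$ (a, c) else 0)"
      using B ab that
      by (subst mat_mult_entry[of _ "rk s i"]) (simp_all add: zN_def if_distrib[of "\<lambda>x. x * _"] cong: if_cong)
    then show ?thesis using ab by simp
  qed
  then have "(zN s i n z * B * zN s i (\<lambda>k. - n k) z) $$ (a, b) =
     (\<Sum>d<rk s i. if d = b then z powi n (row_blk s i a) * B $$ (a, b) * z powi (- n (row_blk s i b)) else 0)"
    using B ab by (subst mat_mult_entry[of _ "rk s i"])
      (simp_all add: zN_def if_distrib[of "\<lambda>x. _ * x"] del: index_mult_mat(1) cong: if_cong)
  then show ?thesis using ab by simp
qed

lemma AutE_carrier_iff:
  "(g0, g1) \<in> carrier (AutE s i n) \<longleftrightarrow> holomorphic_GL (rk s i) g0 \<and> holomorphic_GL (rk s i) g1 \<and>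
     (\<forall>z. z \<noteq> 0 \<longrightarrow> (\<forall>a < rk s i. \<forall>b < rk s i. g0 z $$ (a, b) =
        z powi n (row_blk s i a) * g1 (1 / z) $$ (a, b) * z powi (- n (row_blk s i b))))"
proof -
  have "g0 z = zN s i n z * g1 (1 / z) * zN s i (\<lambda>k. - n k) z \<longleftrightarrow>
      (\<forall>a < rk s i. \<forall>b < rk s i. g0 z $$ (a, b) =
        z powi n (row_blk s i a) * g1 (1 / z) $$ (a, b) * z powi (- n (row_blk s i b)))"
    if "holomorphic_GL (rk s i) g0" "holomorphic_GL (rk s i) g1" for z
  proof -
    have c: "g0 z \<in> carrier_mat (rk s i) (rk s i)" "g1 (1 / z) \<in> carrier_mat (rk s i) (rk s i)"
      using that by (auto simp: holomorphic_GL_def carrier_GL_iff)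
    show ?thesis
      using c zN_conj_entry[OF c(2), where n = n and z = z] 
      by (subst square_mat_eq_iff[of _ "rk s i"]) (auto intro!: square_mult_closed simp del: index_mult_mat)
  qed
  then show ?thesis by (auto simp: AutE_def)
qed

lemma holomorphic_GL_mult:
  assumes "holomorphic_GL r g" "holomorphic_GL r h"
  shows "holomorphic_GL r (\<lambda>z. g z * h z)"
proof -
  have c: "g z \<in> carrier_mat r r" "h z \<in> carrier_mat r r" for z
    using assms by (auto simp: holomorphic_GL_def carrier_GL_iff)
  have "(\<lambda>z. (g z * h z) $$ (a, b)) holomorphic_on UNIV" if "a < r" "b < r" for a b
  proof -
    have "(\<lambda>z. \<Sum>c<r. g z $$ (a, c) * h z $$ (c, b)) holomorphic_on UNIV"
      using assms that by (intro holomorphic_intros) (auto simp: holomorphic_GL_def)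
    then show ?thesis using that c by (simp add: mat_mult_entry[of _ r] del: index_mult_mat)
  qed
  then show ?thesis using assms by (auto simp: holomorphic_GL_def GL_mult_closed)
qed

lemma mult_AutE [simp]:
  "(g0, g1) \<otimes>\<^bsub>AutE s i n\<^esub> (h0, h1) = (\<lambda>z. g0 z * h0 z, \<lambda>w. g1 w * h1 w)"
  by (simp add: AutE_def)

lemma one_AutE: "\<one>\<^bsub>AutE s i n\<^esub> = (\<lambda>_. 1\<^sub>m (rk s i), \<lambda>_. 1\<^sub>m (rk s i))"
  by (simp add: AutE_def)

lemma fst_mult_AutE: "fst (g \<otimes>\<^bsub>AutE s i n\<^esub> h) z = fst g z * fst h z"
  by (cases g; cases h) simp

lemma restr_mult: "restr (g \<otimes>\<^bsub>AutE s i n\<^esub> h) x = restr g x * restr h x"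
  by (cases g; cases h; cases x) auto

lemma restr_one: "restr \<one>\<^bsub>AutE s i n\<^esub> x = 1\<^sub>m (rk s i)"
  by (cases x) (auto simp: one_AutE)

lemma AutE_carrier_mat:
  assumes "(g0, g1) \<in> carrier (AutE s i n)"
  shows "g0 z \<in> carrier_mat (rk s i) (rk s i)" "g1 z \<in> carrier_mat (rk s i) (rk s i)"
  using assms by (auto simp: AutE_def holomorphic_GL_def carrier_GL_iff)

text \<open>A monoid suffices at this stage; inverses of block-unipotent elements are obtained later
  from the action.\<close>

lemma monoid_AutE: "monoid (AutE s i n)"
proof (rule monoidI)
  let ?r = "rk s i"
  fix g h assume gh: "g \<in> carrier (AutE s i n)" "h \<in> carrier (AutE s i n)"
  obtain g0 g1 h0 h1 where e: "g = (g0, g1)" "h = (h0, h1)" by (cases g; cases h)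
  have c: "g0 z \<in> carrier_mat ?r ?r" "g1 z \<in> carrier_mat ?r ?r"
    "h0 z \<in> carrier_mat ?r ?r" "h1 z \<in> carrier_mat ?r ?r" for z
    using AutE_carrier_mat gh e by auto
  have "(g0 z * h0 z) $$ (a, b) =
        z powi n (row_blk s i a) * (g1 (1 / z) * h1 (1 / z)) $$ (a, b) * z powi (- n (row_blk s i b))"
    if "z \<noteq> 0" "a < ?r" "b < ?r" for z a b
  proof -
    have "(g0 z * h0 z) $$ (a, b) = (\<Sum>c<?r. g0 z $$ (a, c) * h0 z $$ (c, b))"
      using c that by (intro mat_mult_entry) auto
    also have "\<dots> = (\<Sum>c<?r. z powi n (row_blk s i a) * (g1 (1 / z) $$ (a, c) * h1 (1 / z) $$ (c, b)) *
        z powi (- n (row_blk s i b)))"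
    proof (rule sum.cong[OF refl])
      fix k assume "k \<in> {..<?r}"
      then have *: "g0 z $$ (a, k) = z powi n (row_blk s i a) * g1 (1 / z) $$ (a, k) * z powi (- n (row_blk s i k))"
        "h0 z $$ (k, b) = z powi n (row_blk s i k) * h1 (1 / z) $$ (k, b) * z powi (- n (row_blk s i b))"
        using gh e that by (auto simp: AutE_carrier_iff)
      have "z powi (- n (row_blk s i k)) * z powi n (row_blk s i k) = 1"
        using that(1) by (simp flip: power_int_add)
      then show "g0 z $$ (a, k) * h0 z $$ (k, b) =
         z powi n (row_blk s i a) * (g1 (1 / z) $$ (a, k) * h1 (1 / z) $$ (k, b)) *
        z powi (- n (row_blk s i b))"
        unfolding * by (simp add: mult_ac)
    qed
    also have "\<dots> = z powi n (row_blk s i a) * (g1 (1 / z) * h1 (1 / z)) $$ (a, b) * z powi (- n (row_blk s i b))"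
      using c that by (subst mat_mult_entry[of _ ?r]) (auto simp: sum_distrib_left sum_distrib_right)
    finally show ?thesis .
  qed
  then show "g \<otimes>\<^bsub>AutE s i n\<^esub> h \<in> carrier (AutE s i n)"
    using gh unfolding e mult_AutE AutE_carrier_iff by (simp add: holomorphic_GL_mult del: index_mult_mat)
next
  have "holomorphic_GL (rk s i) (\<lambda>_. 1\<^sub>m (rk s i))"
    using unip_GL[OF one_unip] by (auto simp: holomorphic_GL_def)
  then show "\<one>\<^bsub>AutE s i n\<^esub> \<in> carrier (AutE s i n)"
    unfolding one_AutE AutE_carrier_iff by (auto simp flip: power_int_add)
next
  fix g h k assume "g \<in> carrier (AutE s i n)" "h \<in> carrier (AutE s i n)" "k \<in> carrier (AutE s i n)"
  then show "g \<otimes>\<^bsub>AutE s i n\<^esub> h \<otimes>\<^bsub>AutE s i n\<^esub> k = g \<otimes>\<^bsub>AutE s i n\<^esub> (h \<otimes>\<^bsub>AutE s i n\<^esub> k)"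
    by (cases g; cases h; cases k) (simp add: fun_eq_iff square_mult_assoc[OF AutE_carrier_mat(1) AutE_carrier_mat(1) AutE_carrier_mat(1)]
      square_mult_assoc[OF AutE_carrier_mat(2) AutE_carrier_mat(2) AutE_carrier_mat(2)])
next
  fix g assume g: "g \<in> carrier (AutE s i n)"
  show "\<one>\<^bsub>AutE s i n\<^esub> \<otimes>\<^bsub>AutE s i n\<^esub> g = g" "g \<otimes>\<^bsub>AutE s i n\<^esub> \<one>\<^bsub>AutE s i n\<^esub> = g"
  proof -
    obtain g0 g1 where e: "g = (g0, g1)" by (cases g)
    note c = AutE_carrier_mat[OF g[unfolded e]]
    show "\<one>\<^bsub>AutE s i n\<^esub> \<otimes>\<^bsub>AutE s i n\<^esub> g = g" "g \<otimes>\<^bsub>AutE s i n\<^esub> \<one>\<^bsub>AutE s i n\<^esub> = g"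
      unfolding e one_AutE mult_AutE
      by (simp_all add: left_mult_one_mat[OF c(1)] left_mult_one_mat[OF c(2)]
          right_mult_one_mat[OF c(1)] right_mult_one_mat[OF c(2)])
  qed
qed

text \<open>The transition relation determines the second component from the first away from
  \<open>w = 0\<close>, and continuity determines it there.\<close>

lemma AutE_eqI:
  assumes g: "g \<in> carrier (AutE s i n)" and h: "h \<in> carrier (AutE s i n)"
    and eq: "\<And>z. fst g z = fst h z"
  shows "g = h"
proof -
  let ?r = "rk s i"
  obtain g0 g1 h0 h1 where e: "g = (g0, g1)" "h = (h0, h1)" by (cases g; cases h)
  have 0: "g0 = h0" using eq e by auto
  have "g1 w $$ (a, b) = h1 w $$ (a, b)" if ab: "a < ?r" "b < ?r" for w a b
  proof -
    have nz: "g1 w $$ (a, b) = h1 w $$ (a, b)" if w: "w \<noteq> 0" for w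
    proof -
      have w': "1 / w \<noteq> 0" "1 / (1 / w) = w" using w by auto
      have "(1 / w) powi n (row_blk s i a) * k (1 / (1 / w)) $$ (a, b) * (1 / w) powi (- n (row_blk s i b)) =
         g0 (1 / w) $$ (a, b)" if "(g0, k) \<in> carrier (AutE s i n)" for k
        by (rule conjunct2[OF conjunct2[OF that[unfolded AutE_carrier_iff]], rule_format, OF w'(1) ab, symmetric])
      from this[of g1] this[of h1]
      have "(1 / w) powi n (row_blk s i a) * g1 w $$ (a, b) * (1 / w) powi (- n (row_blk s i b)) =
         (1 / w) powi n (row_blk s i a) * h1 w $$ (a, b) * (1 / w) powi (- n (row_blk s i b))"
        using g h 0 unfolding e w'(2) by simp
      then show ?thesis using w by simp
    qed
    have "(\<lambda>w. g1 w $$ (a, b) - h1 w $$ (a, b)) holomorphic_on UNIV"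
      using g h ab by (intro holomorphic_intros) (auto simp: e AutE_carrier_iff holomorphic_GL_def)
    then have "isCont (\<lambda>w. g1 w $$ (a, b) - h1 w $$ (a, b)) 0"
      using holomorphic_on_imp_continuous_on continuous_on_eq_continuous_at open_UNIV by blast
    then have "((\<lambda>w. g1 w $$ (a, b) - h1 w $$ (a, b)) \<longlongrightarrow> g1 0 $$ (a, b) - h1 0 $$ (a, b)) (at 0)"
      by (simp add: isCont_def)
    moreover have "((\<lambda>w. g1 w $$ (a, b) - h1 w $$ (a, b)) \<longlongrightarrow> 0) (at 0)"
      by (rule Lim_transform_eventually[OF tendsto_const]) (auto simp: eventually_at_filter nz)
    ultimately have "g1 0 $$ (a, b) - h1 0 $$ (a, b) = 0"
      by (rule tendsto_unique[rotated]) simp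
    then show ?thesis using nz by (cases "w = 0") auto
  qed
  then have "g1 w = h1 w" for w
    using AutE_carrier_mat(2)[of g0 g1 s i n w] AutE_carrier_mat(2)[of h0 h1 s i n w] g h
    unfolding e by (intro eq_matI) auto
  then show ?thesis using 0 e by auto
qed

text \<open>Outside the unit disc \<open>norm (f z)\<close> is at most
  \<open>B * norm z ^ d\<close>, where \<open>B\<close> bounds \<open>g\<close> on the closed unit
  disc; Liouville's theorem for polynomial growth applies.\<close>

lemma entire_bounded_growth_poly:
  fixes f g :: "complex \<Rightarrow> complex"
  assumes f: "f holomorphic_on UNIV" and g: "g holomorphic_on UNIV"
    and eq: "\<And>z. z \<noteq> 0 \<Longrightarrow> f z = z ^ d * g (1 / z)"
  obtains p where "degree p \<le> d" "\<And>z. f z = poly p z"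
proof -
  have "compact (g ` cball 0 1)"
    by (intro compact_continuous_image compact_cball
        continuous_on_subset[OF holomorphic_on_imp_continuous_on[OF g] subset_UNIV])
  then have "bounded (g ` cball 0 1)" by (rule compact_imp_bounded)
  then obtain B where B: "\<And>w. w \<in> cball 0 1 \<Longrightarrow> norm (g w) \<le> B"
    unfolding bounded_iff by blast
  have "norm (f z) \<le> B * norm z ^ d" if "1 \<le> norm z" for z
  proof -
    have "z \<noteq> 0" using that by auto
    moreover have "norm (g (1 / z)) \<le> B" using that by (intro B) (auto simp: norm_divide divide_le_eq_1)
    ultimately show ?thesis
      using mult_right_mono[of "norm (g (1 / z))" B "norm z ^ d"]
      by (simp add: eq norm_mult norm_power mult.commute)
  qed
  from Liouville_polynomial[OF f this]
  have *: "f z = (\<Sum>k\<le>d. (deriv ^^ k) f 0 / fact k * z ^ k)" for z by simp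
  define p where "p = (\<Sum>k\<le>d. monom ((deriv ^^ k) f 0 / fact k) k)"
  have "degree p \<le> d"
    unfolding p_def
  proof (rule degree_sum_le)
    show "degree (monom ((deriv ^^ k) f 0 / fact k) k) \<le> d" if "k \<in> {..d}" for k
      using that degree_monom_le[of "(deriv ^^ k) f 0 / fact k" k] by simp
  qed simp
  moreover have "f z = poly p z" for z
    by (rule trans[OF *]) (simp add: p_def poly_sum poly_monom)
  ultimately show thesis by (rule that)
qed

section \<open>Block-unipotent automorphisms as matrix polynomials\<close>

locale split_bundle =
  fixes s :: nat and i :: "nat \<Rightarrow> nat" and n :: "nat \<Rightarrow> int"
  assumes n_mono: "strict_mono_on {1..s} n"
begin

abbreviation r where "r \<equiv> rk s i"
abbreviation \<beta> where "\<beta> \<equiv> row_blk s i"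
abbreviation Aut where "Aut \<equiv> AutE s i n"

text \<open>Truncation makes this 0 when \<open>\<beta> a \<le> \<beta> b\<close>, so the same
  degree bound, reflection and value at infinity also serve the constant entries.\<close>

definition gap :: "nat \<Rightarrow> nat \<Rightarrow> nat" where
  "gap a b = nat (n (\<beta> a) - n (\<beta> b))"

lemma n_le: "a < r \<Longrightarrow> b < r \<Longrightarrow> \<beta> b \<le> \<beta> a \<Longrightarrow> n (\<beta> b) \<le> n (\<beta> a)"
  using strict_mono_on_leD[OF n_mono, of "\<beta> b" "\<beta> a"] row_blk_bounds by auto

lemma transition_factor:
  fixes z x :: complex
  assumes "z \<noteq> 0" "a < r" "b < r" "\<beta> b \<le> \<beta> a"
  shows "z powi n (\<beta> a) * x * z powi (- n (\<beta> b)) = z ^ gap a b * x"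
proof -
  have "z powi n (\<beta> a) * z powi (- n (\<beta> b)) = z powi (n (\<beta> a) - n (\<beta> b))"
    using power_int_add[of z "n (\<beta> a)" "- n (\<beta> b)"] assms(1) by simp
  also have "\<dots> = z ^ gap a b"
    using n_le[OF assms(2-)] by (simp add: gap_def flip: power_int_of_nat)
  finally show ?thesis by (metis mult.assoc mult.commute)
qed

text \<open>By Liouville's theorem, these are all elements of \<open>Aut\<close> with identity diagonal blocks.\<close>

definition unipotents :: "aut set" where
  "unipotents = {g \<in> carrier Aut. \<forall>z. fst g z \<in> unip r \<beta>}"

definition poly_family :: "(nat \<Rightarrow> nat \<Rightarrow> complex poly) \<Rightarrow> bool" where
  "poly_family P \<longleftrightarrow> (\<forall>a<r. \<forall>b<r. (\<beta> a \<le> \<beta> b \<longrightarrow> P a b = (if a = b then 1 else 0)) \<and>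
     (\<beta> b < \<beta> a \<longrightarrow> degree (P a b) \<le> gap a b))"

definition aut_of :: "(nat \<Rightarrow> nat \<Rightarrow> complex poly) \<Rightarrow> aut" where
  "aut_of P = (\<lambda>z. mat r r (\<lambda>(a, b). poly (P a b) z),
     \<lambda>w. mat r r (\<lambda>(a, b). poly (reflect_deg (gap a b) (P a b)) w))"

lemma poly_family_degree:
  assumes "poly_family P" "a < r" "b < r"
  shows "degree (P a b) \<le> gap a b"
  using assms by (cases "\<beta> a \<le> \<beta> b") (auto simp: poly_family_def)

lemma restr_aut_of:
  assumes "poly_family P"
  shows "restr (aut_of P) x = mat r r (\<lambda>(a, b). eval_cp1 (gap a b) (P a b) x)"
  using poly_family_degree[OF assms]
  by (cases x) (auto simp: aut_of_def poly_reflect_deg_0 intro!: eq_matI)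

lemma fst_aut_of: "fst (aut_of P) z = mat r r (\<lambda>(a, b). poly (P a b) z)"
  by (simp add: aut_of_def)

lemma restr_aut_of_unip:
  assumes "poly_family P"
  shows "restr (aut_of P) x \<in> unip r \<beta>"
proof -
  have "eval_cp1 (gap a b) (P a b) x = (if a = b then 1 else 0)" if "a < r" "b < r" "\<beta> a \<le> \<beta> b" for a b
    using assms that by (cases x) (auto simp: poly_family_def gap_def)
  then show ?thesis unfolding restr_aut_of[OF assms] by (simp add: unip_def)
qed

lemma aut_of_unipotents:
  assumes P: "poly_family P"
  shows "aut_of P \<in> unipotents"
proof -
  obtain g0 g1 where g: "aut_of P = (g0, g1)" by (cases "aut_of P")
  have g0: "g0 z = mat r r (\<lambda>(a, b). poly (P a b) z)" for z
    using g by (simp add: aut_of_def fun_eq_iff)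
  have g1: "g1 w = mat r r (\<lambda>(a, b). poly (reflect_deg (gap a b) (P a b)) w)" for w
    using g by (simp add: aut_of_def fun_eq_iff)
  have u0: "g0 z \<in> unip r \<beta>" for z using restr_aut_of_unip[OF P, of "Some z"] g by simp
  have u1: "g1 w \<in> unip r \<beta>" for w
    unfolding g1 using P by (auto simp: unip_def poly_family_def gap_def reflect_deg_def)
  have "g0 z $$ (a, b) = z powi n (\<beta> a) * g1 (1 / z) $$ (a, b) * z powi (- n (\<beta> b))"
    if z: "z \<noteq> 0" and ab: "a < r" "b < r" for z a b
  proof (cases "\<beta> b \<le> \<beta> a")
    case True
    then show ?thesis
      unfolding transition_factor[OF z ab True]
      using ab poly_reflect_deg[OF poly_family_degree[OF P ab] z] by (simp add: g0 g1)
  next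
    case False
    then show ?thesis using unip_entry[OF u0 ab] unip_entry[OF u1 ab] by auto
  qed
  moreover have "holomorphic_GL r g0" "holomorphic_GL r g1"
    using unip_GL[OF u0] unip_GL[OF u1] by (auto simp: holomorphic_GL_def) (auto simp: g0 g1)
  ultimately have "aut_of P \<in> carrier Aut" unfolding g AutE_carrier_iff by blast
  then show ?thesis using u0 g by (simp add: unipotents_def)
qed

text \<open>Below the diagonal blocks the transition relation reads
  \<open>g0 z = z ^ d * g1 (1 / z)\<close> entry by entry, so the growth lemma yields polynomials.
  The second component then agrees by \<open>AutE_eqI\<close>.\<close>

lemma unipotents_aut_of:
  assumes g: "g \<in> unipotents"
  obtains P where "poly_family P" "g = aut_of P"
proof -
  obtain g0 g1 where e: "g = (g0, g1)" by (cases g)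
  have gA: "(g0, g1) \<in> carrier Aut" and gu: "\<And>z. g0 z \<in> unip r \<beta>"
    using g by (auto simp: unipotents_def e)
  define Q where "Q a b p \<longleftrightarrow> (\<beta> a \<le> \<beta> b \<longrightarrow> p = (if a = b then 1 else 0)) \<and>
     (\<beta> b < \<beta> a \<longrightarrow> degree p \<le> gap a b) \<and> (\<forall>z. g0 z $$ (a, b) = poly p z)" for a b p
  have "\<exists>p. Q a b p" if ab: "a < r" "b < r" for a b
  proof (cases "\<beta> a \<le> \<beta> b")
    case True
    then show ?thesis
      using unip_entry[OF gu ab True] by (intro exI[of _ "if a = b then 1 else 0"]) (auto simp: Q_def)
  next
    case False
    have eq: "g0 z $$ (a, b) = z ^ gap a b * g1 (1 / z) $$ (a, b)" if z: "z \<noteq> 0" for z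
    proof -
      have "g0 z $$ (a, b) = z powi n (\<beta> a) * g1 (1 / z) $$ (a, b) * z powi (- n (\<beta> b))"
        by (rule conjunct2[OF conjunct2[OF gA[unfolded AutE_carrier_iff]], rule_format, OF z ab])
      also have "\<dots> = z ^ gap a b * g1 (1 / z) $$ (a, b)"
        by (rule transition_factor) (use z ab False in auto)
      finally show ?thesis .
    qed
    have "(\<lambda>z. g0 z $$ (a, b)) holomorphic_on UNIV" "(\<lambda>z. g1 z $$ (a, b)) holomorphic_on UNIV"
      using gA ab by (auto simp: AutE_carrier_iff holomorphic_GL_def)
    from entire_bounded_growth_poly[OF this eq]
    obtain p where "degree p \<le> gap a b" "\<And>z. g0 z $$ (a, b) = poly p z" by blast
    then show ?thesis using False by (auto simp: Q_def)
  qed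
  note ex = this
  define P where "P a b = (SOME p. Q a b p)" for a b
  have QP: "Q a b (P a b)" if "a < r" "b < r" for a b
    unfolding P_def using ex[OF that] by (rule someI_ex)
  have P: "poly_family P" using QP by (auto simp: poly_family_def Q_def)
  have "g = aut_of P"
  proof (rule AutE_eqI)
    show "g \<in> carrier Aut" using gA e by simp
    show "aut_of P \<in> carrier Aut" using aut_of_unipotents[OF P] by (simp add: unipotents_def)
    show "fst g z = fst (aut_of P) z" for z
      using QP carrier_matD[OF unip_carrier_mat[OF gu]] unfolding fst_aut_of e
      by (intro eq_matI) (auto simp: Q_def)
  qed
  with P that show thesis by blast
qed

lemma restr_unip: "g \<in> unipotents \<Longrightarrow> restr g x \<in> unip r \<beta>"
  by (metis unipotents_aut_of restr_aut_of_unip)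

lemma unipotents_carrier: "g \<in> unipotents \<Longrightarrow> g \<in> carrier Aut"
  by (simp add: unipotents_def)

lemma unipotents_mult: "g \<in> unipotents \<Longrightarrow> h \<in> unipotents \<Longrightarrow> g \<otimes>\<^bsub>Aut\<^esub> h \<in> unipotents"
  using monoid.m_closed[OF monoid_AutE, of g s i n h]
  by (auto simp: unipotents_def fst_mult_AutE unip_mult_closed)

lemma one_unipotents: "\<one>\<^bsub>Aut\<^esub> \<in> unipotents"
  using monoid.one_closed[OF monoid_AutE, of s i n]
  by (auto simp: unipotents_def one_AutE one_unip)

lemma unipotents_eqI:
  assumes "g \<in> unipotents" "h \<in> unipotents"
    and "\<And>z a b. a < r \<Longrightarrow> b < r \<Longrightarrow> \<beta> b < \<beta> a \<Longrightarrow> fst g z $$ (a, b) = fst h z $$ (a, b)"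
  shows "g = h"
proof (rule AutE_eqI[OF unipotents_carrier[OF assms(1)] unipotents_carrier[OF assms(2)]])
  show "fst g z = fst h z" for z
    by (rule unip_eqI[of _ r \<beta>]) (use assms in \<open>auto simp: unipotents_def\<close>)
qed

lemma continuous_map_AutE_top:
  assumes "\<And>x. x \<in> topspace X \<Longrightarrow> G x \<in> carrier Aut"
    and "\<And>y. mat_continuous X r (\<lambda>x. restr (G x) y)"
    and "\<And>x y. x \<in> topspace X \<Longrightarrow> restr (G x) y \<in> carrier (GL r)"
  shows "continuous_map X (AutE_top s i n) G"
  unfolding AutE_top_def
proof (rule continuous_map_pullback')
  show "continuous_map X (product_topology (\<lambda>_. GL_top r) UNIV) (restr \<circ> G)"
    unfolding continuous_map_componentwise_UNIV continuous_map_GL_top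
    using assms by auto
qed (use assms in auto)

lemma mat_continuous_restr:
  "mat_continuous (AutE_top s i n) r (\<lambda>g. restr g y)"
proof -
  have "continuous_map (AutE_top s i n) (product_topology (\<lambda>_. GL_top r) UNIV) restr"
    unfolding AutE_top_def using continuous_map_pullback[OF continuous_map_id, of "carrier Aut" restr]
    by (simp add: o_def)
  then have "continuous_map (AutE_top s i n) (GL_top r) (\<lambda>g. restr g y)"
    unfolding continuous_map_componentwise_UNIV by auto
  then show ?thesis unfolding continuous_map_GL_top by auto
qed

lemma topspace_AutE_top_unipotents: "unipotents \<subseteq> topspace (AutE_top s i n)"
  using restr_unip unip_GL unipotents_carrier
  by (fastforce simp: AutE_top_def topspace_pullback_topology topspace_GL_top PiE_def)

end

section \<open>Solving for the automorphism\<close>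

locale marked_bundle = split_bundle +
  fixes z :: "nat \<Rightarrow> cp1"
  assumes s_pos: "0 < s"
    and z_inj: "inj_on z {..num_pts s n}"
begin

definition \<gamma> :: "nat \<Rightarrow> nat \<Rightarrow> nat" where
  "\<gamma> m = grading s i (pt_type n m)"

abbreviation pts where "pts \<equiv> sep_pts s i n"

lemma pts_iff: "m \<in> pts a b \<longleftrightarrow> m \<le> num_pts s n \<and> \<gamma> m b < \<gamma> m a"
  by (simp add: sep_pts_def \<gamma>_def)

lemma pts_interpolation:
  assumes "a < r" "b < r" "\<beta> b < \<beta> a"
  shows "finite (pts a b)" "card (pts a b) = gap a b + 1" "inj_on z (pts a b)"
proof -
  have "pts a b \<subseteq> {..num_pts s n}" by (auto simp: sep_pts_def)
  then show "inj_on z (pts a b)" by (rule inj_on_subset[OF z_inj])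
qed (use card_sep_pts[OF n_mono assms] in \<open>auto simp: gap_def\<close>)

lemma graded_\<gamma>: "graded r \<beta> (\<gamma> m)"
  unfolding \<gamma>_def by (rule graded_grading)

text \<open>The right-hand side of \<open>levi_factor_iff\<close> at the \<open>m\<close>-th point
  for the automorphism with entries \<open>P\<close>; the conditional is the Levi part.\<close>

definition target :: "(nat \<Rightarrow> nat \<Rightarrow> complex poly) \<Rightarrow> (nat \<Rightarrow> complex mat) \<Rightarrow> (nat \<Rightarrow> complex mat) \<Rightarrow>
    nat \<Rightarrow> nat \<Rightarrow> nat \<Rightarrow> complex" where
  "target P A A' m a b = A' m $$ (a, b) - A m $$ (a, b) +
     (\<Sum>c | c < r \<and> \<beta> b < \<beta> c \<and> \<beta> c < \<beta> a.
       A' m $$ (a, c) * (if \<gamma> m b < \<gamma> m c then 0 else eval_cp1 (gap c b) (P c b) (z m))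
       - eval_cp1 (gap a c) (P a c) (z m) * A m $$ (c, b))"

definition transports :: "aut \<Rightarrow> (nat \<Rightarrow> complex mat) \<Rightarrow> (nat \<Rightarrow> complex mat) \<Rightarrow> bool" where
  "transports g A A' \<longleftrightarrow> (\<forall>m \<le> num_pts s n.
     restr g (z m) * A m = A' m * levi r (\<gamma> m) (restr g (z m)))"

definition point_data :: "(nat \<Rightarrow> complex mat) \<Rightarrow> bool" where
  "point_data A \<longleftrightarrow> (\<forall>m \<le> num_pts s n. A m \<in> unip r (\<gamma> m))"

text \<open>Regroups the matrix equations at the individual points into one interpolation problem on
  \<open>pts a b\<close> for each entry \<open>(a, b)\<close>.\<close>

lemma transports_aut_of_iff:
  assumes P: "poly_family P" and A: "point_data A" and A': "point_data A'"
  shows "transports (aut_of P) A A' \<longleftrightarrow> (\<forall>a<r. \<forall>b<r. \<beta> b < \<beta> a \<longrightarrow>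
    (\<forall>m \<in> pts a b. eval_cp1 (gap a b) (P a b) (z m) = target P A A' m a b))"
proof -
  have entry: "restr (aut_of P) (z m) $$ (a, b) = eval_cp1 (gap a b) (P a b) (z m)"
    if "a < r" "b < r" for a b m
    using that by (simp add: restr_aut_of[OF P])
  have "restr (aut_of P) (z m) * A m = A' m * levi r (\<gamma> m) (restr (aut_of P) (z m)) \<longleftrightarrow>
     (\<forall>a<r. \<forall>b<r. \<gamma> m b < \<gamma> m a \<longrightarrow> eval_cp1 (gap a b) (P a b) (z m) = target P A A' m a b)"
    if m: "m \<le> num_pts s n" for m
  proof -
    interpret graded r \<beta> "\<gamma> m" by (rule graded_\<gamma>)
    let ?g = "restr (aut_of P) (z m)"
    have "A' m $$ (a, b) - A m $$ (a, b) +
       (\<Sum>c | c < r \<and> \<beta> b < \<beta> c \<and> \<beta> c < \<beta> a.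
          A' m $$ (a, c) * levi r (\<gamma> m) ?g $$ (c, b) - ?g $$ (a, c) * A m $$ (c, b)) =
       target P A A' m a b" if "a < r" "b < r" for a b
      unfolding target_def using that entry
      by (intro arg_cong2[where f = "(+)"] sum.cong refl) (auto simp: levi_def)
    then show ?thesis
      using levi_factor_iff[OF restr_aut_of_unip[OF P], of "A m" "A' m" "z m"] A A' m entry
      by (simp add: point_data_def)
  qed
  then have "transports (aut_of P) A A' \<longleftrightarrow> (\<forall>m \<le> num_pts s n. \<forall>a<r. \<forall>b<r. \<gamma> m b < \<gamma> m a \<longrightarrow>
      eval_cp1 (gap a b) (P a b) (z m) = target P A A' m a b)"
    unfolding transports_def by blast
  also have "\<dots> \<longleftrightarrow> (\<forall>a<r. \<forall>b<r. \<beta> b < \<beta> a \<longrightarrow>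
    (\<forall>m \<in> pts a b. eval_cp1 (gap a b) (P a b) (z m) = target P A A' m a b))"
    (is "?L \<longleftrightarrow> ?R")
  proof
    assume ?L
    then show ?R by (simp add: pts_iff)
  next
    assume R: ?R
    show ?L
    proof (intro allI impI)
      fix m a b
      assume *: "m \<le> num_pts s n" "a < r" "b < r" "\<gamma> m b < \<gamma> m a"
      then have "\<beta> b < \<beta> a" "m \<in> pts a b"
        using graded.less_imp[OF graded_\<gamma>, of b a m] by (auto simp: pts_iff)
      then show "eval_cp1 (gap a b) (P a b) (z m) = target P A A' m a b" using R * by blast
    qed
  qed
  finally show ?thesis .
qed

context
  notes sum.cong [fundef_cong]
begin

text \<open>The unknown \<open>(a, b)\<close> entry is interpolated from its values at the \<open>gap a b + 1\<close> points of
  \<open>pts a b\<close>, which only involve entries closer to the diagonal blocks.\<close>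

function solution :: "(nat \<Rightarrow> complex mat) \<Rightarrow> (nat \<Rightarrow> complex mat) \<Rightarrow> nat \<Rightarrow> nat \<Rightarrow> complex poly" where
  "solution A A' a b = (if \<beta> b < \<beta> a then
     (\<Sum>m \<in> pts a b. Polynomial.smult (A' m $$ (a, b) - A m $$ (a, b) +
        (\<Sum>c \<in> {c. c < r \<and> \<beta> b < \<beta> c \<and> \<beta> c < \<beta> a}.
          A' m $$ (a, c) * (if \<gamma> m b < \<gamma> m c then 0 else eval_cp1 (gap c b) (solution A A' c b) (z m))
          - eval_cp1 (gap a c) (solution A A' a c) (z m) * A m $$ (c, b)))
        (lagrange_cp1 (gap a b) z (pts a b) m))
     else if a = b then 1 else 0)"
  by pat_completeness auto
termination
  \<comment> \<open>Recursive calls replace one index by a \<open>c\<close> strictly between the two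
    blocks, so the difference of block numbers drops. The congruence rule \<open>sum.cong\<close> is
    what makes this range of \<open>c\<close> available here.\<close>
  by (relation "Wellfounded.measure (\<lambda>(A, A', a, b). \<beta> a - \<beta> b)") auto

end

declare solution.simps [simp del]

lemma solution_less:
  "\<beta> b < \<beta> a \<Longrightarrow> solution A A' a b = (\<Sum>m \<in> pts a b.
     Polynomial.smult (target (solution A A') A A' m a b) (lagrange_cp1 (gap a b) z (pts a b) m))"
  by (subst solution.simps) (simp add: target_def)

lemma poly_family_solution: "poly_family (solution A A')"
  unfolding poly_family_def
proof (intro allI impI conjI)
  fix a b assume ab: "a < r" "b < r"
  show "solution A A' a b = (if a = b then 1 else 0)" if "\<beta> a \<le> \<beta> b"
    using that by (subst solution.simps) auto
  show "degree (solution A A' a b) \<le> gap a b" if "\<beta> b < \<beta> a"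
    unfolding solution_less[OF that]
  proof (rule degree_sum_le)
    show "degree (Polynomial.smult (target (solution A A') A A' m a b)
        (lagrange_cp1 (gap a b) z (pts a b) m)) \<le> gap a b" if "m \<in> pts a b" for m
      using lagrange_cp1(1)[OF pts_interpolation[OF ab \<open>\<beta> b < \<beta> a\<close>] that] degree_smult_le order_trans
      by blast
  qed simp
qed

lemma eval_solution:
  assumes "a < r" "b < r" "\<beta> b < \<beta> a" "m \<in> pts a b"
  shows "eval_cp1 (gap a b) (solution A A' a b) (z m) = target (solution A A') A A' m a b"
proof -
  have "eval_cp1 (gap a b) (solution A A' a b) (z m) =
     (\<Sum>k \<in> pts a b. if k = m then target (solution A A') A A' k a b else 0)"
    unfolding solution_less[OF assms(3)] eval_cp1_linear
    using lagrange_cp1(2)[OF pts_interpolation[OF assms(1-3)] _ assms(4)]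
    by (intro sum.cong) auto
  then show ?thesis using assms(4) by simp
qed

lemma solution_transports:
  "point_data A \<Longrightarrow> point_data A' \<Longrightarrow> transports (aut_of (solution A A')) A A'"
  by (simp add: transports_aut_of_iff poly_family_solution eval_solution)

text \<open>When the entries closer to the diagonal blocks agree, so do the targets. Then
  \<open>P a b - solution A A' a b\<close> has degree at most \<open>gap a b\<close> and vanishes at
  \<open>gap a b + 1\<close> points.\<close>

lemma transports_unique:
  assumes g: "g \<in> unipotents" and A: "point_data A" "point_data A'" and tr: "transports g A A'"
  shows "g = aut_of (solution A A')"
proof -
  obtain P where P: "poly_family P" "g = aut_of P" using unipotents_aut_of[OF g] .
  let ?S = "solution A A'"
  note Seq = poly_family_solution[of A A']
  have "P a b = ?S a b" if "a < r" "b < r" for a b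
    using that
  proof (induction "\<beta> a - \<beta> b" arbitrary: a b rule: less_induct)
    case less
    show ?case
    proof (cases "\<beta> b < \<beta> a")
      case False
      then show ?thesis using P(1) Seq less.prems by (simp add: poly_family_def)
    next
      case True
      have IH: "P a c = ?S a c" "P c b = ?S c b" if "c < r" "\<beta> b < \<beta> c" "\<beta> c < \<beta> a" for c
        using that less.prems by (auto intro!: less.hyps)
      have "eval_cp1 (gap a b) (P a b) (z m) = eval_cp1 (gap a b) (?S a b) (z m)"
        if m: "m \<in> pts a b" for m
      proof -
        have "eval_cp1 (gap a b) (P a b) (z m) = target P A A' m a b"
          using transports_aut_of_iff[OF P(1) A] tr P(2) less.prems True m by blast
        also have "\<dots> = target ?S A A' m a b"
          unfolding target_def using IH by (intro arg_cong2[where f = "(+)"] sum.cong refl) auto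
        finally show ?thesis using eval_solution[OF less.prems True m] by simp
      qed
      moreover have "degree (P a b - ?S a b) \<le> gap a b"
        using P(1) Seq less.prems True by (intro degree_diff_le) (auto simp: poly_family_def)
      ultimately have "P a b - ?S a b = 0"
        by (intro eval_cp1_zero_imp_zero[OF pts_interpolation[OF less.prems True]]) auto
      then show ?thesis by simp
    qed
  qed
  then show ?thesis unfolding P(2) aut_of_def by (auto intro!: eq_matI)
qed

text \<open>The Lagrange polynomials depend only on the marked points, so each entry is a fixed
  linear combination of targets, which are polynomial in the parameters and in values of earlier
  entries. The evaluation point \<open>y\<close> varies in the induction because the targets use
  values at the marked points.\<close>

lemma continuous_solution:
  assumes A: "\<And>m. m \<le> num_pts s n \<Longrightarrow> mat_continuous X r (\<lambda>x. A x m)"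
    and A': "\<And>m. m \<le> num_pts s n \<Longrightarrow> mat_continuous X r (\<lambda>x. A' x m)"
    and ab: "a < r" "b < r"
  shows "continuous_map X euclidean (\<lambda>x. eval_cp1 (gap a b) (solution (A x) (A' x) a b) y)"
  using ab
proof (induction "\<beta> a - \<beta> b" arbitrary: a b y rule: less_induct)
  case less
  show ?case
  proof (cases "\<beta> b < \<beta> a")
    case False
    then have "solution (A x) (A' x) a b = (if a = b then 1 else 0)" for x
      by (subst solution.simps) auto
    then show ?thesis by simp
  next
    case True
    have IH: "continuous_map X euclidean (\<lambda>x. eval_cp1 (gap c b) (solution (A x) (A' x) c b) y)"
      "continuous_map X euclidean (\<lambda>x. eval_cp1 (gap a c) (solution (A x) (A' x) a c) y)"
      if "c < r" "\<beta> b < \<beta> c" "\<beta> c < \<beta> a" for c y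
      using that less.prems by (auto intro!: less.hyps)
    have "continuous_map X euclidean (\<lambda>x. target (solution (A x) (A' x)) (A x) (A' x) m a b)"
      if m: "m \<in> pts a b" for m
    proof -
      have c: "continuous_map X euclidean (\<lambda>x. A x m $$ (c, d))"
          "continuous_map X euclidean (\<lambda>x. A' x m $$ (c, d))" if "c < r" "d < r" for c d
        using A[of m] A'[of m] m that by (auto simp: pts_iff mat_continuous_def)
      have "continuous_map X euclidean
         (\<lambda>x. if \<gamma> m b < \<gamma> m c then 0 else eval_cp1 (gap c b) (solution (A x) (A' x) c b) (z m))"
        if "c < r" "\<beta> b < \<beta> c" "\<beta> c < \<beta> a" for c
        using IH(1)[OF that] by (cases "\<gamma> m b < \<gamma> m c") auto
      then show ?thesis
        unfolding target_def using less.prems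
        by (intro continuous_map_add continuous_map_diff continuous_map_sum continuous_map_mult_algebra c IH)
          auto
    qed
    then show ?thesis
      unfolding solution_less[OF True] eval_cp1_linear
      by (intro continuous_map_sum continuous_map_mult_algebra) auto
  qed
qed

end

section \<open>The action on the product of cells\<close>

context marked_bundle
begin

abbreviation num where "num \<equiv> num_pts s n"
abbreviation ptype where "ptype m \<equiv> pt_type n m"
abbreviation cell where "cell m \<equiv> bruhat_cell (lam s i (ptype m)) (tau s i (ptype m))"
abbreviation cell_top where "cell_top m \<equiv> subtopology (flag_top (lam s i (ptype m))) (cell m)"
abbreviation flag where "flag m \<equiv> bruhat_data.flag_of r (tau s i (ptype m)) (lam s i (ptype m))"
abbreviation crd where
  "crd m \<equiv> bruhat_data.coord r (\<gamma> m) (tau s i (ptype m)) (lam s i (ptype m))"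
abbreviation X where "X \<equiv> cells s i n"
abbreviation act_on where "act_on \<equiv> act s i n z"

lemma bruhat_data_pt:
  assumes "m \<le> num"
  shows "bruhat_data r \<beta> (\<gamma> m) (tau s i (ptype m)) (tau_inv s i (ptype m)) (lam s i (ptype m))"
  unfolding \<gamma>_def using assms pt_type_less s_pos by (intro bruhat_data_lam_tau) auto

definition coords :: "(nat \<Rightarrow> complex mat set) \<Rightarrow> nat \<Rightarrow> complex mat" where
  "coords x m = crd m (x m)"

lemma cells_iff: "x \<in> X \<longleftrightarrow> x \<in> extensional {..num} \<and> (\<forall>m\<le>num. x m \<in> cell m)"
  by (auto simp: cells_def PiE_def Pi_iff)

lemma point_data_coords: "x \<in> X \<Longrightarrow> point_data (coords x)"
  using bruhat_data.coord_unip[OF bruhat_data_pt]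
  by (simp add: point_data_def coords_def cells_iff)

lemma flag_coords: "x \<in> X \<Longrightarrow> m \<le> num \<Longrightarrow> flag m (coords x m) = x m"
  using bruhat_data.flag_of_coord[OF bruhat_data_pt] by (simp add: coords_def cells_iff)

lemma act_apply: "x \<in> X \<Longrightarrow> m \<le> num \<Longrightarrow> act_on g x m = restr g (z m) <#\<^bsub>GL r\<^esub> x m"
  by (simp add: act_def)

lemma act_extensional: "x \<in> X \<Longrightarrow> act_on g x \<in> extensional {..num}"
  by (simp add: act_def)

lemma act_closed:
  assumes g: "g \<in> unipotents" and x: "x \<in> X"
  shows "act_on g x \<in> X"
  unfolding cells_iff[of "act_on g x"]
proof (intro conjI allI impI act_extensional x)
  fix m assume m: "m \<le> num"
  have "x m \<in> cell m" using x m by (simp add: cells_iff)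
  from bruhat_data.act_bruhat_cell[OF bruhat_data_pt[OF m] restr_unip[OF g] this]
  show "act_on g x m \<in> cell m" by (simp add: act_apply[OF x m])
qed

lemma cells_eqI: "x \<in> X \<Longrightarrow> y \<in> X \<Longrightarrow> (\<And>m. m \<le> num \<Longrightarrow> x m = y m) \<Longrightarrow> x = y"
  unfolding cells_iff by (rule extensionalityI) auto

lemma cell_flags: "x \<in> X \<Longrightarrow> m \<le> num \<Longrightarrow> x m \<in> flags (lam s i (ptype m))"
  using bruhat_data.bruhat_cell_subset_flags[OF bruhat_data_pt] by (auto simp: cells_iff)

lemma act_mult:
  assumes "g \<in> unipotents" "h \<in> unipotents" "x \<in> X"
  shows "act_on (g \<otimes>\<^bsub>Aut\<^esub> h) x = act_on g (act_on h x)"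
proof (rule cells_eqI)
  fix m assume m: "m \<le> num"
  show "act_on (g \<otimes>\<^bsub>Aut\<^esub> h) x m = act_on g (act_on h x) m"
    using assms m bruhat_data.act_assoc[OF bruhat_data_pt[OF m] unip_GL[OF restr_unip] unip_GL[OF restr_unip] cell_flags]
    by (simp add: act_apply act_closed restr_mult)
qed (use assms act_closed unipotents_mult in auto)

lemma act_one:
  assumes "x \<in> X"
  shows "act_on \<one>\<^bsub>Aut\<^esub> x = x"
proof (rule cells_eqI)
  fix m assume m: "m \<le> num"
  show "act_on \<one>\<^bsub>Aut\<^esub> x m = x m"
    using assms m bruhat_data.act_one[OF bruhat_data_pt[OF m] cell_flags]
    by (simp add: act_apply restr_one)
qed (use assms act_closed one_unipotents in auto)

lemma act_eq_iff:
  assumes g: "g \<in> unipotents" and x: "x \<in> X" and y: "y \<in> X"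
  shows "act_on g x = y \<longleftrightarrow> transports g (coords x) (coords y)"
proof -
  have *: "act_on g x m = y m \<longleftrightarrow>
      restr g (z m) * coords x m = coords y m * levi r (\<gamma> m) (restr g (z m))" if m: "m \<le> num" for m
    using bruhat_data.act_flag_of_iff[OF bruhat_data_pt[OF m] restr_unip[OF g], of "coords x m" "coords y m" "z m"]
      point_data_coords[OF x] point_data_coords[OF y] m flag_coords[OF x m] flag_coords[OF y m]
    by (simp add: act_apply x point_data_def)
  have "act_on g x = y \<longleftrightarrow> (\<forall>m\<le>num. act_on g x m = y m)"
    using cells_eqI[OF act_closed[OF g x] y] by auto
  then show ?thesis using * by (simp add: transports_def)
qed

definition transporter :: "(nat \<Rightarrow> complex mat set) \<Rightarrow> (nat \<Rightarrow> complex mat set) \<Rightarrow> aut" where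
  "transporter x y = aut_of (solution (coords x) (coords y))"

lemma transporter_unipotents: "transporter x y \<in> unipotents"
  unfolding transporter_def by (rule aut_of_unipotents[OF poly_family_solution])

lemma act_transporter: "x \<in> X \<Longrightarrow> y \<in> X \<Longrightarrow> act_on (transporter x y) x = y"
  using act_eq_iff[OF transporter_unipotents] solution_transports[OF point_data_coords point_data_coords]
  by (simp add: transporter_def)

lemma transporter_unique:
  "g \<in> unipotents \<Longrightarrow> x \<in> X \<Longrightarrow> y \<in> X \<Longrightarrow> act_on g x = y \<Longrightarrow> g = transporter x y"
  using act_eq_iff transports_unique[OF _ point_data_coords point_data_coords]
  by (simp add: transporter_def)

lemma transporter_act: "g \<in> unipotents \<Longrightarrow> x \<in> X \<Longrightarrow> transporter x (act_on g x) = g"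
  using transporter_unique[of g x "act_on g x"] act_closed by simp

section \<open>The group structure and free transitivity\<close>

lemma cells_nonempty: "\<exists>x. x \<in> X"
proof
  show "(\<lambda>m\<in>{..num}. flag m (1\<^sub>m r)) \<in> X"
    using one_unip by (auto simp: cells_iff bruhat_data.bruhat_cell_eq[OF bruhat_data_pt])
qed

text \<open>The transporter \<open>h\<close> from \<open>g x\<close> back to \<open>x\<close> exists
  by interpolation. The product of \<open>h\<close> and \<open>g\<close> fixes \<open>x\<close>, as
  does the identity, so uniqueness of transporters makes them equal.\<close>

lemma unipotents_left_inverse:
  assumes g: "g \<in> unipotents"
  shows "\<exists>h\<in>unipotents. h \<otimes>\<^bsub>Aut\<^esub> g = \<one>\<^bsub>Aut\<^esub>"
proof -
  obtain x where x: "x \<in> X" using cells_nonempty ..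
  let ?h = "transporter (act_on g x) x"
  have h: "?h \<in> unipotents" by (rule transporter_unipotents)
  have "act_on (?h \<otimes>\<^bsub>Aut\<^esub> g) x = x"
    using act_mult[OF h g x] act_transporter[OF act_closed[OF g x] x] by simp
  then have "?h \<otimes>\<^bsub>Aut\<^esub> g = transporter x x"
    using transporter_unique[OF unipotents_mult[OF h g] x x] by simp
  also have "\<dots> = \<one>\<^bsub>Aut\<^esub>" using transporter_unique[OF one_unipotents x x act_one[OF x]] by simp
  finally show ?thesis using h by blast
qed

lemma group_unipotents: "group (Aut\<lparr>carrier := unipotents\<rparr>)"
proof (rule groupI)
  fix g h k assume "g \<in> carrier (Aut\<lparr>carrier := unipotents\<rparr>)"
    "h \<in> carrier (Aut\<lparr>carrier := unipotents\<rparr>)" "k \<in> carrier (Aut\<lparr>carrier := unipotents\<rparr>)"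
  then show "g \<otimes>\<^bsub>Aut\<lparr>carrier := unipotents\<rparr>\<^esub> h \<otimes>\<^bsub>Aut\<lparr>carrier := unipotents\<rparr>\<^esub> k =
     g \<otimes>\<^bsub>Aut\<lparr>carrier := unipotents\<rparr>\<^esub> (h \<otimes>\<^bsub>Aut\<lparr>carrier := unipotents\<rparr>\<^esub> k)"
    using monoid.m_assoc[OF monoid_AutE] unipotents_carrier by simp
qed (use unipotents_mult one_unipotents unipotents_left_inverse monoid.l_one[OF monoid_AutE]
      unipotents_carrier in auto)

lemma unipotents_inverse:
  assumes g: "g \<in> unipotents"
  obtains h where "h \<in> unipotents" "h \<otimes>\<^bsub>Aut\<^esub> g = \<one>\<^bsub>Aut\<^esub>" "g \<otimes>\<^bsub>Aut\<^esub> h = \<one>\<^bsub>Aut\<^esub>"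
  using group.inv_closed[OF group_unipotents, of g] group.l_inv[OF group_unipotents, of g]
    group.r_inv[OF group_unipotents, of g] g by auto

lemma subgroup_unipotents: "subgroup unipotents Aut"
proof
  fix g assume g: "g \<in> unipotents"
  obtain h where h: "h \<in> unipotents" "h \<otimes>\<^bsub>Aut\<^esub> g = \<one>\<^bsub>Aut\<^esub>" "g \<otimes>\<^bsub>Aut\<^esub> h = \<one>\<^bsub>Aut\<^esub>"
    using unipotents_inverse[OF g] .
  \<comment> \<open>\<open>Aut\<close> is handled only as a monoid, so its \<open>inv\<close> must
    be identified with the inverse found among the unipotents.\<close>
  then have "inv\<^bsub>Aut\<^esub> g = h"
    using g unipotents_carrier by (intro monoid.inv_char[OF monoid_AutE]) auto
  then show "inv\<^bsub>Aut\<^esub> g \<in> unipotents" using h by simp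
qed (use unipotents_carrier unipotents_mult one_unipotents in auto)

lemma transitive_action_unipotents: "transitive_action (Aut\<lparr>carrier := unipotents\<rparr>) X act_on"
proof -
  have Bij: "act_on g \<in> Bij X" if g: "g \<in> unipotents" for g
  proof -
    obtain h where h: "h \<in> unipotents" "h \<otimes>\<^bsub>Aut\<^esub> g = \<one>\<^bsub>Aut\<^esub>" "g \<otimes>\<^bsub>Aut\<^esub> h = \<one>\<^bsub>Aut\<^esub>"
      using unipotents_inverse[OF g] .
    have "bij_betw (act_on g) X X"
      by (rule bij_betw_byWitness[where f' = "act_on h"])
        (use h act_closed[OF g] act_closed[OF h(1)] in \<open>auto simp: act_mult[symmetric] g act_one\<close>)
    then show ?thesis by (simp add: Bij_def act_def)
  qed
  have hom: "act_on \<in> hom (Aut\<lparr>carrier := unipotents\<rparr>) (BijGroup X)"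
  proof (rule homI)
    show "act_on g \<in> carrier (BijGroup X)" if "g \<in> carrier (Aut\<lparr>carrier := unipotents\<rparr>)" for g
      using Bij that by (simp add: BijGroup_def)
    fix g h assume gh: "g \<in> carrier (Aut\<lparr>carrier := unipotents\<rparr>)" "h \<in> carrier (Aut\<lparr>carrier := unipotents\<rparr>)"
    have "act_on (g \<otimes>\<^bsub>Aut\<^esub> h) = compose X (act_on g) (act_on h)"
    proof (rule extensionalityI[of _ X])
      show "act_on (g \<otimes>\<^bsub>Aut\<^esub> h) \<in> extensional X" by (simp add: act_def)
    qed (use gh in \<open>auto simp: compose_def act_mult\<close>)
    then show "act_on (g \<otimes>\<^bsub>Aut\<lparr>carrier := unipotents\<rparr>\<^esub> h) = act_on g \<otimes>\<^bsub>BijGroup X\<^esub> act_on h"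
      using Bij gh by (simp add: BijGroup_def)
  qed
  have "group_hom (Aut\<lparr>carrier := unipotents\<rparr>) (BijGroup X) act_on"
    using group_unipotents group_BijGroup hom by (simp add: group_hom_def group_hom_axioms_def)
  then show ?thesis
  proof (rule transitive_action.intro[OF group_action.intro transitive_action_axioms.intro])
    fix x y assume "x \<in> X" "y \<in> X"
    then show "\<exists>g\<in>carrier (Aut\<lparr>carrier := unipotents\<rparr>). act_on g x = y"
      using act_transporter transporter_unipotents by (intro bexI[of _ "transporter x y"]) auto
  qed
qed

lemma unipotents_fixing_point:
  assumes "g \<in> unipotents" "x \<in> X" "act_on g x = x"
  shows "g = \<one>\<^bsub>Aut\<^esub>"
  using transporter_unique[OF assms(1,2,2,3)]
    transporter_unique[OF one_unipotents assms(2,2) act_one[OF assms(2)]] by metis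

lemma stabilizer_unipotents:
  assumes x: "x \<in> X"
  shows "stabilizer (Aut\<lparr>carrier := unipotents\<rparr>) act_on x = {\<one>\<^bsub>Aut\<^esub>}"
proof (intro equalityI subsetI)
  fix g assume "g \<in> stabilizer (Aut\<lparr>carrier := unipotents\<rparr>) act_on x"
  then have "g \<in> unipotents" "act_on g x = x" by (simp_all add: stabilizer_def)
  then show "g \<in> {\<one>\<^bsub>Aut\<^esub>}" using unipotents_fixing_point x by blast
next
  fix g assume "g \<in> {\<one>\<^bsub>Aut\<^esub>}"
  then show "g \<in> stabilizer (Aut\<lparr>carrier := unipotents\<rparr>) act_on x"
    using one_unipotents act_one[OF x] by (simp add: stabilizer_def)
qed

section \<open>Continuity and properness\<close>

lemma topspace_cells_top: "topspace (cells_top s i n) = X"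
proof -
  have "topspace (cell_top m) = cell m" if "m \<le> num" for m
    using bruhat_data.bruhat_cell_subset_flags[OF bruhat_data_pt[OF that]]
    by (auto simp: topspace_flag_top)
  then show ?thesis
    unfolding cells_top_def cells_def topspace_product_topology
    by (intro PiE_cong) (auto simp del: topspace_subtopology)
qed

lemma coords_continuous:
  assumes m: "m \<le> num"
  shows "mat_continuous (cells_top s i n) r (\<lambda>x. coords x m)"
proof -
  have "continuous_map (cells_top s i n) (cell_top m) (\<lambda>x. x m)"
    unfolding cells_top_def using m by (intro continuous_map_product_projection) simp
  from mat_continuous_compose[OF this bruhat_data.coord_continuous[OF bruhat_data_pt[OF m]]]
  show ?thesis unfolding coords_def .
qed

abbreviation TG where "TG \<equiv> subtopology (AutE_top s i n) unipotents"
abbreviation TX where "TX \<equiv> cells_top s i n"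

lemma topspace_TG: "topspace TG = unipotents"
  using topspace_AutE_top_unipotents by auto

text \<open>Each flag is rewritten as \<open>flag m (coords x m)\<close>. This gives a continuously
  varying representing matrix, so no statement about products of quotient maps is needed.\<close>

lemma act_continuous: "continuous_map (prod_topology TG TX) TX (\<lambda>(g, x). act_on g x)"
proof -
  have top: "topspace (prod_topology TG TX) = unipotents \<times> X"
    by (simp add: topspace_TG topspace_cells_top del: topspace_subtopology)
  have "continuous_map (prod_topology TG TX) (cell_top m) (\<lambda>(g, x). act_on g x m)" if m: "m \<le> num" for m
  proof -
    have "mat_continuous (prod_topology TG TX) r (\<lambda>y. restr (fst y) (z m))"
      by (rule mat_continuous_compose[OF _ mat_continuous_restr])
        (rule continuous_map_into_fulltopology[OF continuous_map_fst])
    moreover have "mat_continuous (prod_topology TG TX) r (\<lambda>y. coords (snd y) m)"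
      by (rule mat_continuous_compose[OF continuous_map_snd coords_continuous[OF m]])
    ultimately have "continuous_map (prod_topology TG TX) (cell_top m)
        (\<lambda>y. restr (fst y) (z m) <#\<^bsub>GL r\<^esub> flag m (coords (snd y) m))"
    proof (intro bruhat_data.act_flag_of_continuous[OF bruhat_data_pt[OF m]])
      fix y assume "y \<in> topspace (prod_topology TG TX)"
      then have y: "fst y \<in> unipotents" "snd y \<in> X" unfolding top by auto
      show "restr (fst y) (z m) \<in> unip r \<beta>" by (rule restr_unip[OF y(1)])
      show "coords (snd y) m \<in> unip r (\<gamma> m)"
        using point_data_coords[OF y(2)] m by (simp add: point_data_def)
    qed
    then show ?thesis
    proof (rule continuous_map_eq)
      fix y assume "y \<in> topspace (prod_topology TG TX)"
      then have "snd y \<in> X" unfolding top by auto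
      then show "restr (fst y) (z m) <#\<^bsub>GL r\<^esub> flag m (coords (snd y) m) =
          (case y of (g, x) \<Rightarrow> act_on g x m)"
        by (simp add: flag_coords act_apply m case_prod_unfold)
    qed
  qed
  then show ?thesis
    unfolding cells_top_def continuous_map_componentwise top[unfolded cells_top_def]
    using act_extensional by (auto simp: case_prod_unfold)
qed

text \<open>The topology on automorphisms is induced by the restrictions to all fibers, so the
  entries of the solution must be controlled at every point of the projective line, not only at the
  marked ones.\<close>

lemma transporter_continuous:
  "continuous_map (prod_topology TX TX) TG (\<lambda>(y, x). transporter x y)"
proof -
  have "continuous_map (prod_topology TX TX) (AutE_top s i n) (\<lambda>w. transporter (snd w) (fst w))"
  proof (rule continuous_map_AutE_top)
    fix y
    have "continuous_map (prod_topology TX TX) euclidean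
        (\<lambda>w. eval_cp1 (gap a b) (solution (coords (snd w)) (coords (fst w)) a b) y)"
      if "a < r" "b < r" for a b
      using that
      by (intro continuous_solution mat_continuous_compose[OF continuous_map_snd coords_continuous]
          mat_continuous_compose[OF continuous_map_fst coords_continuous])
    then show "mat_continuous (prod_topology TX TX) r (\<lambda>w. restr (transporter (snd w) (fst w)) y)"
      unfolding transporter_def restr_aut_of[OF poly_family_solution] mat_continuous_def by simp
  qed (simp_all add: unipotents_carrier[OF transporter_unipotents]
      unip_GL[OF restr_unip[OF transporter_unipotents]])
  then show ?thesis
    using transporter_unipotents by (auto simp: continuous_map_in_subtopology case_prod_unfold)
qed

lemma proper_action_unipotents: "proper_action TG TX act_on"
proof -
  have "homeomorphic_maps (prod_topology TG TX) (prod_topology TX TX)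
     (\<lambda>(g, x). (act_on g x, x)) (\<lambda>(y, x). (transporter x y, x))"
    unfolding homeomorphic_maps_def
  proof (intro conjI)
    show "continuous_map (prod_topology TG TX) (prod_topology TX TX) (\<lambda>(g, x). (act_on g x, x))"
      using act_continuous continuous_map_snd[of TG TX]
      by (auto simp: case_prod_unfold intro: continuous_map_pairedI)
    show "continuous_map (prod_topology TX TX) (prod_topology TG TX) (\<lambda>(y, x). (transporter x y, x))"
      using transporter_continuous continuous_map_snd[of TX TX]
      by (auto simp: case_prod_unfold intro: continuous_map_pairedI)
  qed (auto simp: topspace_TG topspace_cells_top transporter_act act_transporter simp del: topspace_subtopology)
  then have "homeomorphic_map (prod_topology TG TX) (prod_topology TX TX) (\<lambda>(g, x). (act_on g x, x))"
    unfolding homeomorphic_map_maps by blast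
  then show ?thesis
    unfolding proper_action_def using act_continuous homeomorphic_imp_proper_map by blast
qed

end

section \<open>The subgroup\<close>

lemma vector_space_smult: "vector_space (Polynomial.smult :: 'a::field \<Rightarrow> _)"
  by unfold_locales (simp_all add: smult_add_right smult_add_left)

lemma decomposition_exists:
  assumes W: "decomposition s i n W" and ab: "a < rk s i" "b < rk s i"
    and less: "row_blk s i b < row_blk s i a"
    and p: "degree p \<le> nat (n (row_blk s i a) - n (row_blk s i b))" "poly p 0 = 0"
  obtains q where "\<And>l. l \<in> {row_blk s i b..<row_blk s i a} \<Longrightarrow> q l \<in> W l a b"
    "p = (\<Sum>l\<in>{row_blk s i b..<row_blk s i a}. q l)"
proof -
  let ?I = "{row_blk s i b..<row_blk s i a}"
  have "bij_betw (\<lambda>q. \<Sum>l\<in>?I. q l) (\<Pi>\<^sub>E l \<in> ?I. W l a b)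
         {p. degree p \<le> nat (n (row_blk s i a) - n (row_blk s i b)) \<and> poly p 0 = 0}"
    using W ab less by (auto simp: decomposition_def Let_def)
  then have "p \<in> (\<lambda>q. \<Sum>l\<in>?I. q l) ` (\<Pi>\<^sub>E l \<in> ?I. W l a b)"
    using p by (simp add: bij_betw_def)
  then obtain q where "q \<in> (\<Pi>\<^sub>E l \<in> ?I. W l a b)" "p = (\<Sum>l\<in>?I. q l)" by blast
  then show thesis using that[of q] PiE_mem[of q ?I] by blast
qed

lemma decomposition_degree:
  assumes W: "decomposition s i n W" and ab: "a < rk s i" "b < rk s i"
    and l: "l \<in> {row_blk s i b..<row_blk s i a}" and p: "p \<in> W l a b"
  shows "degree p \<le> nat (n (row_blk s i a) - n (row_blk s i b))"
proof -
  let ?I = "{row_blk s i b..<row_blk s i a}"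
  have less: "row_blk s i b < row_blk s i a" using l by simp
  have bij: "bij_betw (\<lambda>q. \<Sum>l\<in>?I. q l) (\<Pi>\<^sub>E l \<in> ?I. W l a b)
         {p. degree p \<le> nat (n (row_blk s i a) - n (row_blk s i b)) \<and> poly p 0 = 0}"
    and sub: "module.subspace Polynomial.smult (W k a b)" if "k \<in> ?I" for k
    using W ab less that by (auto simp: decomposition_def Let_def)
  interpret vector_space "Polynomial.smult :: complex \<Rightarrow> _" by (rule vector_space_smult)
  \<comment> \<open>The tuple with \<open>p\<close> as its only nonzero component sums to
    \<open>p\<close>, which therefore lies in the range of the sum map.\<close>
  let ?q = "\<lambda>k\<in>?I. if k = l then p else 0"
  have "?q \<in> (\<Pi>\<^sub>E l \<in> ?I. W l a b)"
    using p subspace_0[OF sub] by auto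
  then have "(\<Sum>k\<in>?I. ?q k) \<in> {p. degree p \<le> nat (n (row_blk s i a) - n (row_blk s i b)) \<and> poly p 0 = 0}"
    using bij[OF l] unfolding bij_betw_def by blast
  moreover have "(\<Sum>k\<in>?I. ?q k) = p" using l by simp
  ultimately show ?thesis by simp
qed

context marked_bundle
begin

lemma G_sub_unipotents: "G_sub s i n W l \<subseteq> unipotents"
proof
  fix g assume g: "g \<in> G_sub s i n W l"
  obtain g0 g1 where e: "g = (g0, g1)" by (cases g)
  have gA: "(g0, g1) \<in> carrier Aut" using g by (auto simp: G_sub_def e)
  have "g0 z $$ (a, b) = (if a = b then 1 else 0)" if "a < r" "b < r" "\<beta> a \<le> \<beta> b" for z a b
    using g that unfolding G_sub_def e Let_def by (fastforce split: if_splits)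
  then show "g \<in> unipotents"
    using gA AutE_carrier_mat(1)[OF gA] by (auto simp: unipotents_def e unip_def)
qed

lemma N_sub_unipotents: "N_sub s i n \<subseteq> unipotents"
proof
  fix g assume g: "g \<in> N_sub s i n"
  obtain g0 g1 where e: "g = (g0, g1)" by (cases g)
  have gA: "(g0, g1) \<in> carrier Aut" using g by (auto simp: N_sub_def e)
  obtain A where A: "\<And>z. g0 z = A" "\<forall>a < r. \<forall>b < r. (\<beta> a = \<beta> b \<longrightarrow> A $$ (a, b) = (if a = b then 1 else 0)) \<and>
        (\<beta> a < \<beta> b \<longrightarrow> A $$ (a, b) = 0)"
    using g by (auto simp: N_sub_def e)
  have "A $$ (a, b) = (if a = b then 1 else 0)" if "a < r" "b < r" "\<beta> a \<le> \<beta> b" for a b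
    using A(2) that by (cases "\<beta> a = \<beta> b") auto
  then have "A \<in> unip r \<beta>" using AutE_carrier_mat(1)[OF gA] A(1) by (auto simp: unip_def)
  then show "g \<in> unipotents" using gA A(1) by (auto simp: unipotents_def e)
qed

lemma set_mult_unipotents:
  assumes "S \<subseteq> unipotents" "T \<subseteq> unipotents"
  shows "S <#>\<^bsub>Aut\<^esub> T \<subseteq> unipotents"
proof
  fix g assume "g \<in> S <#>\<^bsub>Aut\<^esub> T"
  then obtain h k where "h \<in> S" "k \<in> T" "g = h \<otimes>\<^bsub>Aut\<^esub> k" unfolding set_mult_def by blast
  then show "g \<in> unipotents" using assms unipotents_mult by blast
qed

lemma GN_sub_subset: "GN_sub s i n W \<subseteq> unipotents"
proof -
  have "foldr (\<lambda>l S. G_sub s i n W l <#>\<^bsub>Aut\<^esub> S) ls {\<one>\<^bsub>Aut\<^esub>} \<subseteq> unipotents" for ls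
  proof (induction ls)
    case Nil
    then show ?case using one_unipotents by simp
  next
    case (Cons l ls)
    then show ?case using set_mult_unipotents[OF G_sub_unipotents] by simp
  qed
  then show ?thesis unfolding GN_sub_def by (intro set_mult_unipotents N_sub_unipotents)
qed

text \<open>For \<open>l < l'\<close> the off-diagonal parts of elements of \<open>G\<^sub>l\<close> and \<open>G\<^sub>l'\<close> multiply to 0, so the
  product \<open>G\<^sub>1 \<cdots> G\<^sub>s\<^sub>-\<^sub>1\<close> simply adds up the components of the decomposition.\<close>

lemma product_of_G_subs:
  assumes W: "decomposition s i n W"
    and q: "\<And>a b l. a < r \<Longrightarrow> b < r \<Longrightarrow> l \<in> {\<beta> b..<\<beta> a} \<Longrightarrow> q a b l \<in> W l a b"
    and l: "l \<le> s"
  shows "aut_of (\<lambda>a b. if \<beta> b < \<beta> a then \<Sum>k\<in>{l..<s} \<inter> {\<beta> b..<\<beta> a}. q a b k else if a = b then 1 else 0)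
    \<in> foldr (\<lambda>l S. G_sub s i n W l <#>\<^bsub>Aut\<^esub> S) [l..<s] {\<one>\<^bsub>Aut\<^esub>}"
  using l
proof (induction l rule: inc_induct)
  case base
  let ?V = "\<lambda>a b. if \<beta> b < \<beta> a then \<Sum>k\<in>{s..<s} \<inter> {\<beta> b..<\<beta> a}. q a b k else if a = b then 1 else 0"
  have "poly_family ?V" by (auto simp: poly_family_def)
  then have "aut_of ?V = \<one>\<^bsub>Aut\<^esub>"
    by (intro unipotents_eqI aut_of_unipotents one_unipotents) (auto simp: one_AutE fst_aut_of)
  then show ?case by simp
next
  case (step l)
  let ?U = "\<lambda>a b. if \<beta> b < \<beta> a then (if l \<in> {\<beta> b..<\<beta> a} then q a b l else 0) else if a = b then 1 else 0"
  let ?V = "\<lambda>l a b. if \<beta> b < \<beta> a then \<Sum>k\<in>{l..<s} \<inter> {\<beta> b..<\<beta> a}. q a b k else if a = b then 1 else 0"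
  have deg: "degree (q a b k) \<le> gap a b" if "a < r" "b < r" "k \<in> {\<beta> b..<\<beta> a}" for a b k
    unfolding gap_def by (rule decomposition_degree[OF W that q[OF that]])
  have U: "poly_family ?U" using deg by (auto simp: poly_family_def)
  have V: "poly_family (?V l)" for l
    unfolding poly_family_def by (auto intro!: degree_sum_le deg)
  have "aut_of (?V l) = aut_of ?U \<otimes>\<^bsub>Aut\<^esub> aut_of (?V (Suc l))"
  proof (rule unipotents_eqI)
    fix z a b assume ab: "a < r" "b < r" "\<beta> b < \<beta> a"
    interpret graded r \<beta> \<beta> by unfold_locales
    let ?u = "fst (aut_of ?U) z" and ?v = "fst (aut_of (?V (Suc l))) z"
    have uv: "?u \<in> unip r \<beta>" "?v \<in> unip r \<beta>"
      using aut_of_unipotents[OF U] aut_of_unipotents[OF V] by (simp_all add: unipotents_def)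
    have "(\<Sum>c | c < r \<and> \<beta> b < \<beta> c \<and> \<beta> c < \<beta> a. ?u $$ (a, c) * ?v $$ (c, b)) = 0"
    proof (intro sum.neutral ballI)
      fix c assume "c \<in> {c. c < r \<and> \<beta> b < \<beta> c \<and> \<beta> c < \<beta> a}"
      then have c: "c < r" "\<beta> b < \<beta> c" "\<beta> c < \<beta> a" by auto
      show "?u $$ (a, c) * ?v $$ (c, b) = 0"
      \<comment> \<open>A nonzero entry of \<open>?v\<close> at \<open>(c, b)\<close> needs some
        index above \<open>l\<close> and below \<open>\<beta> c\<close>, while one of
        \<open>?u\<close> at \<open>(a, c)\<close> needs \<open>\<beta> c \<le> l\<close>.\<close>
      proof (cases "\<beta> c \<le> l")
        case True
        then have "{Suc l..<s} \<inter> {\<beta> b..<\<beta> c} = {}" by auto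
        then have "?v $$ (c, b) = 0" using c ab by (simp add: fst_aut_of del: Int_atLeastLessThan)
        then show ?thesis by simp
      next
        case False
        then have "?u $$ (a, c) = 0" using c ab by (simp add: fst_aut_of)
        then show ?thesis by simp
      qed
    qed
    then have "(?u * ?v) $$ (a, b) = ?u $$ (a, b) + ?v $$ (a, b)"
      using mult_entry_less[OF uv ab] by simp
    also have "\<dots> = fst (aut_of (?V l)) z $$ (a, b)"
    proof -
      have "{l..<s} \<inter> {\<beta> b..<\<beta> a} = (if l \<in> {\<beta> b..<\<beta> a}
          then insert l ({Suc l..<s} \<inter> {\<beta> b..<\<beta> a}) else {Suc l..<s} \<inter> {\<beta> b..<\<beta> a})"
        using step.hyps by auto
      then have "?V l a b = ?U a b + ?V (Suc l) a b" using ab by simp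
      then show ?thesis using ab(1,2) by (simp add: fst_aut_of)
    qed
    finally show "fst (aut_of (?V l)) z $$ (a, b) =
        fst (aut_of ?U \<otimes>\<^bsub>Aut\<^esub> aut_of (?V (Suc l))) z $$ (a, b)"
      by (simp add: fst_mult_AutE)
  qed (intro aut_of_unipotents unipotents_mult U V)+
  moreover have "aut_of ?U \<in> G_sub s i n W l"
  proof -
    obtain g0 g1 where e: "aut_of ?U = (g0, g1)" by (cases "aut_of ?U")
    have g0: "g0 z $$ (a, b) = poly (?U a b) z" if "a < r" "b < r" for a b z
      using fst_aut_of[of ?U z] e that by simp
    have "(g0, g1) \<in> carrier Aut"
      using unipotents_carrier[OF aut_of_unipotents[OF U]] e by simp
    moreover have "if \<beta> a = \<beta> b then (\<forall>z. g0 z $$ (a, b) = (if a = b then 1 else 0))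
       else if \<beta> b \<le> l \<and> l < \<beta> a then (\<exists>p \<in> W l a b. \<forall>z. g0 z $$ (a, b) = poly p z)
       else (\<forall>z. g0 z $$ (a, b) = 0)" if ab: "a < r" "b < r" for a b
      using g0[OF ab] q[OF ab, of l] by auto
    ultimately show ?thesis unfolding e G_sub_def Let_def by blast
  qed
  moreover have "[l..<s] = l # [Suc l..<s]" using step.hyps by (simp add: upt_conv_Cons)
  ultimately show ?case using step.IH by (auto simp: set_mult_def)
qed

text \<open>Split off the constant \<open>c\<close> with value \<open>h(0)\<close>, which lies in
  \<open>N_sub\<close>. What remains is the identity at 0, so its entries below the diagonal blocks
  are polynomials vanishing at 0, to which the decomposition applies.\<close>

lemma GN_sub_eq:
  assumes W: "decomposition s i n W"
  shows "GN_sub s i n W = unipotents"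
proof (intro equalityI GN_sub_subset subsetI)
  fix h assume h: "h \<in> unipotents"
  define c where "c = aut_of (\<lambda>a b. [:fst h 0 $$ (a, b):])"
  have h0: "fst h 0 \<in> unip r \<beta>" using h by (simp add: unipotents_def)
  have "poly_family (\<lambda>a b. [:fst h 0 $$ (a, b):])"
    using unip_entry[OF h0] by (auto simp: poly_family_def one_pCons)
  then have c: "c \<in> unipotents" unfolding c_def by (rule aut_of_unipotents)
  have fc: "fst c z = fst h 0" for z
    using carrier_matD[OF unip_carrier_mat[OF h0]] unfolding c_def fst_aut_of by (intro eq_matI) auto
  have cN: "c \<in> N_sub s i n"
  proof -
    obtain c0 c1 where e: "c = (c0, c1)" by (cases c)
    have "\<exists>A. (\<forall>z. c0 z = A) \<and> (\<forall>a < r. \<forall>b < r.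
        (\<beta> a = \<beta> b \<longrightarrow> A $$ (a, b) = (if a = b then 1 else 0)) \<and> (\<beta> a < \<beta> b \<longrightarrow> A $$ (a, b) = 0))"
      using fc e unip_entry[OF h0] by (intro exI[of _ "fst h 0"]) auto
    then show ?thesis using unipotents_carrier[OF c] unfolding N_sub_def e by blast
  qed
  obtain c' where c': "c' \<in> unipotents" "c' \<otimes>\<^bsub>Aut\<^esub> c = \<one>\<^bsub>Aut\<^esub>" "c \<otimes>\<^bsub>Aut\<^esub> c' = \<one>\<^bsub>Aut\<^esub>"
    using unipotents_inverse[OF c] .
  define g where "g = h \<otimes>\<^bsub>Aut\<^esub> c'"
  have g: "g \<in> unipotents" unfolding g_def by (rule unipotents_mult[OF h c'(1)])
  have hg: "h = g \<otimes>\<^bsub>Aut\<^esub> c"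
    using monoid.m_assoc[OF monoid_AutE[of s i n], of h c' c] monoid.r_one[OF monoid_AutE[of s i n], of h]
      unipotents_carrier[OF h] unipotents_carrier[OF c] unipotents_carrier[OF c'(1)] c'(2)
    by (simp add: g_def)
  have g0: "fst g 0 = 1\<^sub>m r"
  proof -
    have "fst g 0 = fst c 0 * fst c' 0" unfolding g_def fst_mult_AutE fc ..
    also have "\<dots> = fst (c \<otimes>\<^bsub>Aut\<^esub> c') 0" by (rule fst_mult_AutE[symmetric])
    also have "\<dots> = 1\<^sub>m r" unfolding c'(3) by (simp add: one_AutE)
    finally show ?thesis .
  qed
  obtain P where P: "poly_family P" "g = aut_of P" using unipotents_aut_of[OF g] .
  have P0: "poly (P a b) 0 = 0" if "a < r" "b < r" "\<beta> b < \<beta> a" for a b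
  proof -
    have "poly (P a b) 0 = fst g 0 $$ (a, b)" using that by (simp add: P(2) fst_aut_of)
    then show ?thesis using g0 that by auto
  qed
  have "\<exists>q. (\<forall>l\<in>{\<beta> b..<\<beta> a}. q l \<in> W l a b) \<and> P a b = (\<Sum>l\<in>{\<beta> b..<\<beta> a}. q l)"
    if ab: "a < r" "b < r" "\<beta> b < \<beta> a" for a b
    using decomposition_exists[OF W ab, of "P a b"] P(1) ab P0[OF ab]
    unfolding poly_family_def gap_def by metis
  then obtain q where q: "\<And>a b. a < r \<Longrightarrow> b < r \<Longrightarrow> \<beta> b < \<beta> a \<Longrightarrow>
      (\<forall>l\<in>{\<beta> b..<\<beta> a}. q a b l \<in> W l a b) \<and> P a b = (\<Sum>l\<in>{\<beta> b..<\<beta> a}. q a b l)"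
    by metis
  let ?V = "\<lambda>a b. if \<beta> b < \<beta> a then \<Sum>k\<in>{1..<s} \<inter> {\<beta> b..<\<beta> a}. q a b k else if a = b then 1 else 0"
  have "?V a b = P a b" if ab: "a < r" "b < r" for a b
  proof (cases "\<beta> b < \<beta> a")
    case True
    \<comment> \<open>Block numbers lie between 1 and \<open>s\<close>, so the indices
      \<open>1, ..., s - 1\<close> of the product exhaust all components of the
      decomposition.\<close>
    have "{1..<s} \<inter> {\<beta> b..<\<beta> a} = {\<beta> b..<\<beta> a}"
      using row_blk_bounds[OF ab(1)] row_blk_bounds[OF ab(2)] by auto
    then show ?thesis using True q[OF ab True] by simp
  next
    case False
    then show ?thesis using P(1) ab by (auto simp: poly_family_def)
  qed
  then have "aut_of ?V = g" unfolding P(2) aut_of_def by (auto intro!: eq_matI)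
  moreover have "aut_of ?V \<in> foldr (\<lambda>l S. G_sub s i n W l <#>\<^bsub>Aut\<^esub> S) [1..<s] {\<one>\<^bsub>Aut\<^esub>}"
    using q s_pos by (intro product_of_G_subs[OF W]) auto
  ultimately show "h \<in> GN_sub s i n W"
    unfolding GN_sub_def set_mult_def using hg cN by blast
qed

end

theorem theorem2:
  fixes s :: nat and n :: "nat \<Rightarrow> int" and i :: "nat \<Rightarrow> nat"
    and z :: "nat \<Rightarrow> complex option"
    and W :: "nat \<Rightarrow> nat \<Rightarrow> nat \<Rightarrow> complex poly set"
  assumes "s \<ge> 2"
    and "strict_mono_on {1..s} n"
    and "\<And>k. k \<in> {1..s} \<Longrightarrow> i k > 0"
    and "z 0 = Some 0"
    and "inj_on z {..num_pts s n}"
    and "decomposition s i n W"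
  shows "subgroup (GN_sub s i n W) (AutE s i n) \<and>
    transitive_action (GN_group s i n W) (cells s i n) (act s i n z) \<and>
    (\<forall>x \<in> cells s i n. stabilizer (GN_group s i n W) (act s i n z) x = {\<one>\<^bsub>AutE s i n\<^esub>}) \<and>
    proper_action (subtopology (AutE_top s i n) (GN_sub s i n W)) (cells_top s i n) (act s i n z)"
proof -
  interpret marked_bundle s i n z
    using assms by unfold_locales auto
  show ?thesis
    \<comment> \<open>After this rewriting the choice of the spaces \<open>W\<close> has disappeared
      from the goal.\<close>
    unfolding GN_group_def GN_sub_eq[OF assms(6)]
    using subgroup_unipotents transitive_action_unipotents stabilizer_unipotents proper_action_unipotents
    by blast
qed

end
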